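(* For $i=1,2$, let a finitely generated residually finite group $\Gamma_i$ act freely, cellularly, and cocompactly on a connected, locally finite, finite dimensional regular CW complex $X_i$. Suppose $\eta:\widehat\Gamma_1\xrightarrow{\cong}\widehat\Gamma_2$ is a continuous isomorphism. Form the completed full cellular residual complexes $\widehat{\mathcal I}_\bullet(X_i)$ over the standard families of characteristic subgroups $(K_m(\Gamma_i))_{m\ge1}$, and suppose that $$F:\widehat{\mathcal I}_\bullet(X_1)\xrightarrow{\cong}\widehat{\mathcal I}_\bullet(X_2)$$ is an $\eta$-equivariant isomorphism of completed full cellular residual complexes. Then there are an element $u\in\widehat\Gamma_2$ and an isomorphism $h:\Gamma_1\to\Gamma_2$ such that $$\eta=\operatorname{Inn}(u)\circ\widehat h,\qquad F(\mathcal I_\bullet(X_1))=u\,\mathcal I_\bullet(X_2)$$ on every original cell and occurrence space. Equivalently, after replacing $(\eta,F)$ by $(\operatorname{Inn}(u^{-1})\circ\eta,\,u^{-1}F)$, the normalized map sends the full original cellular residual complex of $X_1$ onto that of $X_2$.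
   Context: $K_m(G)=\bigcap_{[G:L]\le m}L$ is the intersection of all subgroups of index at most $m$; for $G$ finitely generated these are finite index characteristic subgroups, cofinal among finite index normal subgroups, and a continuous isomorphism $\eta:\widehat\Gamma_1\to\widehat\Gamma_2$ maps $\overline{K_m(\Gamma_1)}$ onto $\overline{K_m(\Gamma_2)}$. $\operatorname{Inn}(u)$ is $x\mapsto uxu^{-1}$. **Full cellular residual complex.** Let $X$ be a finite dimensional regular CW complex with a characteristic homeomorphism $\chi_\sigma$ (from the closed $k$-ball onto the closed cell) for each open $k$-cell $\sigma$. A codimension one face position of $\sigma$ is an open $(k-1)$-cell $\iota\subset S^{k-1}$ of the cell decomposition of $S^{k-1}$ pulled back by $\chi_\sigma$. Let $X^k$ be the set of open $k$-cells and $I_{k,k-1}(X)=\{(\sigma,\tau,\iota):\sigma\in X^k,\ \tau\in X^{k-1},\ \iota\text{ a codimension one face position of }\sigma,\ \chi_\sigma(\iota)=\tau\}$, with projections $p_{k,k-1}(\sigma,\tau,\iota)=\sigma$, $q_{k,k-1}(\sigma,\tau,\iota)=\tau$. $\mathcal I_\bullet(X)$ consists of all sets $X^k$, all $I_{k,k-1}(X)$ and all maps $p_{k,k-1},q_{k,k-1}$. A cellular automorphism $g$ acts by $g(\sigma,\tau,\iota)=(g\sigma,g\tau,\chi_{g\sigma}^{-1}(g\chi_\sigma(\iota)))$. For a group $N$ acting cellularly, $\mathcal I_\bullet(N\backslash X):=N\backslash\mathcal I_\bullet(X)$ componentwise (occurrence orbits are kept distinct unless identified by $N$). The completion is $\widehat{\mathcal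 I}_\bullet(X)=\varprojlim_m\mathcal I_\bullet(K_m(\Gamma)\backslash X)$, the inverse limit being taken on every cell space, occurrence space and structure map; it is a diagram of profinite spaces with a $\widehat\Gamma$-action. An isomorphism consists of homeomorphisms on all these spaces commuting with all structure maps; it is $\eta$-equivariant if $F(\gamma y)=\eta(\gamma)F(y)$. The original cells and occurrences are the points in the canonical (injective, dense) images of $X^k$ and $I_{k,k-1}(X)$; $u\,\mathcal I_\bullet(X_2)$ is the left translate of these subsets by $u$. *)

theory Defs
  imports "HOL-Analysis.Analysis" "HOL-Algebra.Generated_Groups" "HOL-Algebra.Group_Action"
begin

section \<open>Profinite completions\<close>

definition finitely_generated_group :: "('g, 'm) monoid_scheme \<Rightarrow> bool" where
  "finitely_generated_group G \<longleftrightarrow>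
     group G \<and> (\<exists>S. finite S \<and> S \<subseteq> carrier G \<and> generate G S = carrier G)"

definition fin_index_normals :: "('g, 'm) monoid_scheme \<Rightarrow> 'g set set" where
  "fin_index_normals G = {N. N \<lhd> G \<and> finite (rcosets\<^bsub>G\<^esub> N)}"

definition residually_finite_group :: "('g, 'm) monoid_scheme \<Rightarrow> bool" where
  "residually_finite_group G \<longleftrightarrow>
     group G \<and> (\<forall>g \<in> carrier G. g \<noteq> \<one>\<^bsub>G\<^esub> \<longrightarrow> (\<exists>N \<in> fin_index_normals G. g \<notin> N))"

text \<open>The intersection of all subgroups of index at most \<open>m\<close>; only used for \<open>m \<ge> 1\<close>.\<close>

definition Kcore :: "('g, 'm) monoid_scheme \<Rightarrow> nat \<Rightarrow> 'g set" where
  "Kcore G m = \<Inter>{L. subgroup L G \<and> finite (rcosets\<^bsub>G\<^esub> L) \<and> card (rcosets\<^bsub>G\<^esub> L) \<le> m}"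

text \<open>The inverse limit of the finite quotients \<open>G Mod N\<close>. For \<open>N \<subseteq> M\<close> the transition map sends a
  coset of \<open>N\<close> to the unique coset of \<open>M\<close> containing it, so compatibility of a family reads
  \<open>x N \<subseteq> x M\<close>.\<close>

definition profinite_completion :: "('g, 'm) monoid_scheme \<Rightarrow> ('g set \<Rightarrow> 'g set) monoid" where
  "profinite_completion G =
     \<lparr>carrier = {x \<in> (\<Pi>\<^sub>E N \<in> fin_index_normals G. carrier (G Mod N)).
        \<forall>N \<in> fin_index_normals G. \<forall>M \<in> fin_index_normals G. N \<subseteq> M \<longrightarrow> x N \<subseteq> x M},
      monoid.mult = (\<lambda>x y. \<lambda>N \<in> fin_index_normals G. x N \<otimes>\<^bsub>G Mod N\<^esub> y N),
      one = (\<lambda>N \<in> fin_index_normals G. \<one>\<^bsub>G Mod N\<^esub>)\<rparr>"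

definition profinite_topology :: "('g, 'm) monoid_scheme \<Rightarrow> ('g set \<Rightarrow> 'g set) topology" where
  "profinite_topology G =
     subtopology
       (product_topology (\<lambda>N. discrete_topology (carrier (G Mod N))) (fin_index_normals G))
       (carrier (profinite_completion G))"

definition continuous_iso ::
  "('g, 'm) monoid_scheme \<Rightarrow> ('h, 'n) monoid_scheme \<Rightarrow>
     (('g set \<Rightarrow> 'g set) \<Rightarrow> ('h set \<Rightarrow> 'h set)) \<Rightarrow> bool" where
  "continuous_iso G H \<eta> \<longleftrightarrow>
     \<eta> \<in> iso (profinite_completion G) (profinite_completion H) \<and>
     continuous_map (profinite_topology G) (profinite_topology H) \<eta>"

text \<open>The map of completions induced by a homomorphism \<open>h\<close>: its coordinate at \<open>N\<close> is the coset of
  \<open>N\<close> containing the image under \<open>h\<close> of the coordinate at the preimage of \<open>N\<close>.\<close>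

definition completed_hom ::
  "('g, 'm) monoid_scheme \<Rightarrow> ('h, 'n) monoid_scheme \<Rightarrow> ('g \<Rightarrow> 'h) \<Rightarrow>
     ('g set \<Rightarrow> 'g set) \<Rightarrow> ('h set \<Rightarrow> 'h set)" where
  "completed_hom G H h x =
     (\<lambda>N \<in> fin_index_normals H. N <#>\<^bsub>H\<^esub> h ` x {g \<in> carrier G. h g \<in> N})"

definition Inn :: "('c, 'm) monoid_scheme \<Rightarrow> 'c \<Rightarrow> 'c \<Rightarrow> 'c" where
  "Inn C u x = u \<otimes>\<^bsub>C\<^esub> x \<otimes>\<^bsub>C\<^esub> inv\<^bsub>C\<^esub> u"

section \<open>Regular CW complexes and cellular actions\<close>

definition ball_points :: "nat \<Rightarrow> (nat \<Rightarrow> real) set" where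
  "ball_points k = {x \<in> topspace (Euclidean_space k). (\<Sum>i<k. (x i)\<^sup>2) \<le> 1}"

definition open_ball_points :: "nat \<Rightarrow> (nat \<Rightarrow> real) set" where
  "open_ball_points k = {x \<in> topspace (Euclidean_space k). (\<Sum>i<k. (x i)\<^sup>2) < 1}"

definition sphere_points :: "nat \<Rightarrow> (nat \<Rightarrow> real) set" where
  "sphere_points k = {x \<in> topspace (Euclidean_space k). (\<Sum>i<k. (x i)\<^sup>2) = 1}"

text \<open>\<open>cw_cells X k\<close> is the set of open \<open>k\<close>-cells, as subsets of the space, and \<open>cw_char X \<sigma>\<close> is the
  chosen characteristic map of the open cell \<open>\<sigma>\<close>.\<close>

record 'a cw_complex =
  cw_top :: "'a topology"
  cw_cells :: "nat \<Rightarrow> 'a set set"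
  cw_char :: "'a set \<Rightarrow> (nat \<Rightarrow> real) \<Rightarrow> 'a"

definition regular_cw_complex :: "('a, 'z) cw_complex_scheme \<Rightarrow> bool" where
  "regular_cw_complex X \<longleftrightarrow>
     Hausdorff_space (cw_top X) \<and>
     topspace (cw_top X) = (\<Union>k. \<Union>(cw_cells X k)) \<and>
     (\<forall>k l \<sigma> \<tau>. \<sigma> \<in> cw_cells X k \<and> \<tau> \<in> cw_cells X l \<and> \<sigma> \<inter> \<tau> \<noteq> {} \<longrightarrow> k = l \<and> \<sigma> = \<tau>) \<and>
     (\<forall>k. \<forall>\<sigma> \<in> cw_cells X k.
        homeomorphic_map (subtopology (Euclidean_space k) (ball_points k))
          (subtopology (cw_top X) (cw_top X closure_of \<sigma>)) (cw_char X \<sigma>) \<and>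
        cw_char X \<sigma> ` open_ball_points k = \<sigma> \<and>
        cw_char X \<sigma> ` sphere_points k \<subseteq> (\<Union>l<k. \<Union>(cw_cells X l)) \<and>
        finite {\<tau> \<in> (\<Union>l. cw_cells X l). \<tau> \<inter> (cw_top X closure_of \<sigma>) \<noteq> {}}) \<and>
     (\<forall>A \<subseteq> topspace (cw_top X).
        (\<forall>k. \<forall>\<sigma> \<in> cw_cells X k. closedin (cw_top X) (A \<inter> (cw_top X closure_of \<sigma>)))
          \<longrightarrow> closedin (cw_top X) A)"

definition finite_dimensional_cw :: "('a, 'z) cw_complex_scheme \<Rightarrow> bool" where
  "finite_dimensional_cw X \<longleftrightarrow> (\<exists>n. \<forall>k>n. cw_cells X k = {})"

definition locally_finite_cw :: "('a, 'z) cw_complex_scheme \<Rightarrow> bool" where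
  "locally_finite_cw X \<longleftrightarrow> locally_finite_in (cw_top X) (\<Union>k. cw_cells X k)"

text \<open>The quotient topology on the orbit space: the preimage of a set \<open>U\<close> of orbits is \<open>\<Union>U\<close>.\<close>

definition orbit_space ::
  "('g, 'm) monoid_scheme \<Rightarrow> 'a topology \<Rightarrow> ('g \<Rightarrow> 'a \<Rightarrow> 'a) \<Rightarrow> 'a set topology" where
  "orbit_space G T \<phi> = topology (\<lambda>U. U \<subseteq> orbits G (topspace T) \<phi> \<and> openin T (\<Union>U))"

definition cellular_action ::
  "('g, 'm) monoid_scheme \<Rightarrow> ('a, 'z) cw_complex_scheme \<Rightarrow> ('g \<Rightarrow> 'a \<Rightarrow> 'a) \<Rightarrow> bool" where
  "cellular_action G X \<phi> \<longleftrightarrow>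
     group_action G (topspace (cw_top X)) \<phi> \<and>
     (\<forall>g \<in> carrier G. homeomorphic_map (cw_top X) (cw_top X) (\<phi> g) \<and>
        (\<forall>k. \<forall>\<sigma> \<in> cw_cells X k. \<phi> g ` \<sigma> \<in> cw_cells X k))"

definition free_action ::
  "('g, 'm) monoid_scheme \<Rightarrow> 'a set \<Rightarrow> ('g \<Rightarrow> 'a \<Rightarrow> 'a) \<Rightarrow> bool" where
  "free_action G E \<phi> \<longleftrightarrow> (\<forall>x \<in> E. stabilizer G \<phi> x = {\<one>\<^bsub>G\<^esub>})"

definition cocompact_action ::
  "('g, 'm) monoid_scheme \<Rightarrow> 'a topology \<Rightarrow> ('g \<Rightarrow> 'a \<Rightarrow> 'a) \<Rightarrow> bool" where
  "cocompact_action G T \<phi> \<longleftrightarrow> compact_space (orbit_space G T \<phi>)"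

section \<open>The full cellular residual complex\<close>

type_synonym 'a occurrence = "'a set \<times> 'a set \<times> (nat \<Rightarrow> real) set"

text \<open>The open \<open>(k-1)\<close>-cells of the decomposition of the boundary sphere of a \<open>k\<close>-cell \<open>\<sigma>\<close> that is
  pulled back by its characteristic map.\<close>

definition face_positions ::
  "('a, 'z) cw_complex_scheme \<Rightarrow> nat \<Rightarrow> 'a set \<Rightarrow> (nat \<Rightarrow> real) set set" where
  "face_positions X k \<sigma> =
     {\<iota>. \<exists>\<tau> \<in> cw_cells X (k - 1). \<tau> \<subseteq> cw_char X \<sigma> ` sphere_points k \<and>
         \<iota> = {x \<in> sphere_points k. cw_char X \<sigma> x \<in> \<tau>}}"

text \<open>\<open>occurrences X k\<close> is the set of incidences between \<open>k\<close>-cells and \<open>(k-1)\<close>-cells, for \<open>k \<ge> 1\<close>.\<close>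

definition occurrences :: "('a, 'z) cw_complex_scheme \<Rightarrow> nat \<Rightarrow> 'a occurrence set" where
  "occurrences X k =
     {(\<sigma>, \<tau>, \<iota>). 1 \<le> k \<and> \<sigma> \<in> cw_cells X k \<and> \<tau> \<in> cw_cells X (k - 1) \<and>
        \<iota> \<in> face_positions X k \<sigma> \<and> cw_char X \<sigma> ` \<iota> = \<tau>}"

definition occ_upper :: "'a occurrence \<Rightarrow> 'a set" where
  "occ_upper = (\<lambda>(\<sigma>, \<tau>, \<iota>). \<sigma>)"

definition occ_lower :: "'a occurrence \<Rightarrow> 'a set" where
  "occ_lower = (\<lambda>(\<sigma>, \<tau>, \<iota>). \<tau>)"

definition cell_act :: "('g \<Rightarrow> 'a \<Rightarrow> 'a) \<Rightarrow> 'g \<Rightarrow> 'a set \<Rightarrow> 'a set" where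
  "cell_act \<phi> g \<sigma> = \<phi> g ` \<sigma>"

definition occ_act ::
  "('a, 'z) cw_complex_scheme \<Rightarrow> ('g \<Rightarrow> 'a \<Rightarrow> 'a) \<Rightarrow> nat \<Rightarrow> 'g \<Rightarrow> 'a occurrence \<Rightarrow> 'a occurrence"
  where
  "occ_act X \<phi> k g =
     (\<lambda>(\<sigma>, \<tau>, \<iota>). (\<phi> g ` \<sigma>, \<phi> g ` \<tau>,
        {x \<in> ball_points k. cw_char X (\<phi> g ` \<sigma>) x \<in> \<phi> g ` cw_char X \<sigma> ` \<iota>}))"

section \<open>Completion along the subgroups of bounded index\<close>

text \<open>For a set \<open>E\<close> with an action \<open>act\<close> of \<open>G\<close>, the space \<open>completed_space G E act\<close> is the inverse
  limit over \<open>m \<ge> 1\<close> of the discrete orbit sets of \<open>Kcore G m\<close> on \<open>E\<close>. For \<open>m \<le> n\<close> the transition map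
  sends an orbit of \<open>Kcore G n\<close> to the unique orbit of \<open>Kcore G m\<close> containing it.\<close>

definition K_orbit :: "('g, 'm) monoid_scheme \<Rightarrow> ('g \<Rightarrow> 'e \<Rightarrow> 'e) \<Rightarrow> nat \<Rightarrow> 'e \<Rightarrow> 'e set" where
  "K_orbit G act m = orbit (G\<lparr>carrier := Kcore G m\<rparr>) act"

definition K_orbits ::
  "('g, 'm) monoid_scheme \<Rightarrow> 'e set \<Rightarrow> ('g \<Rightarrow> 'e \<Rightarrow> 'e) \<Rightarrow> nat \<Rightarrow> 'e set set" where
  "K_orbits G E act m = orbits (G\<lparr>carrier := Kcore G m\<rparr>) E act"

definition completed_space ::
  "('g, 'm) monoid_scheme \<Rightarrow> 'e set \<Rightarrow> ('g \<Rightarrow> 'e \<Rightarrow> 'e) \<Rightarrow> (nat \<Rightarrow> 'e set) topology" where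
  "completed_space G E act =
     subtopology
       (product_topology (\<lambda>m. discrete_topology (K_orbits G E act m)) {1..})
       {y. \<forall>m\<ge>1. \<forall>n\<ge>m. y n \<subseteq> y m}"

definition completed_map :: "('e \<Rightarrow> 'f) \<Rightarrow> (nat \<Rightarrow> 'e set) \<Rightarrow> (nat \<Rightarrow> 'f set)" where
  "completed_map f y = (\<lambda>m \<in> {1..}. f ` y m)"

text \<open>An element \<open>x\<close> of the profinite completion acts on the \<open>m\<close>-th coordinate through its own
  coordinate at \<open>Kcore G m\<close>, a coset of that subgroup.\<close>

definition completed_act ::
  "('g, 'm) monoid_scheme \<Rightarrow> ('g \<Rightarrow> 'e \<Rightarrow> 'e) \<Rightarrow> ('g set \<Rightarrow> 'g set) \<Rightarrow>
     (nat \<Rightarrow> 'e set) \<Rightarrow> (nat \<Rightarrow> 'e set)" where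
  "completed_act G act x y = (\<lambda>m \<in> {1..}. {act g s | g s. g \<in> x (Kcore G m) \<and> s \<in> y m})"

definition original_points ::
  "('g, 'm) monoid_scheme \<Rightarrow> 'e set \<Rightarrow> ('g \<Rightarrow> 'e \<Rightarrow> 'e) \<Rightarrow> (nat \<Rightarrow> 'e set) set" where
  "original_points G E act = (\<lambda>s. \<lambda>m \<in> {1..}. K_orbit G act m s) ` E"

text \<open>A diagram of spaces: \<open>rc_cells D k\<close> for every \<open>k\<close>, and for \<open>k \<ge> 1\<close> a space \<open>rc_occs D k\<close> with
  maps \<open>rc_p D k\<close> to \<open>rc_cells D k\<close> and \<open>rc_q D k\<close> to \<open>rc_cells D (k - 1)\<close>.\<close>

record ('c, 'o) residual_complex =
  rc_cells :: "nat \<Rightarrow> 'c topology"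
  rc_occs :: "nat \<Rightarrow> 'o topology"
  rc_p :: "nat \<Rightarrow> 'o \<Rightarrow> 'c"
  rc_q :: "nat \<Rightarrow> 'o \<Rightarrow> 'c"

definition completed_residual_complex ::
  "('g, 'm) monoid_scheme \<Rightarrow> ('a, 'z) cw_complex_scheme \<Rightarrow> ('g \<Rightarrow> 'a \<Rightarrow> 'a) \<Rightarrow>
     (nat \<Rightarrow> 'a set set, nat \<Rightarrow> 'a occurrence set) residual_complex" where
  "completed_residual_complex G X \<phi> =
     \<lparr>rc_cells = (\<lambda>k. completed_space G (cw_cells X k) (cell_act \<phi>)),
      rc_occs = (\<lambda>k. completed_space G (occurrences X k) (occ_act X \<phi> k)),
      rc_p = (\<lambda>k. completed_map occ_upper),
      rc_q = (\<lambda>k. completed_map occ_lower)\<rparr>"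

definition residual_complex_iso ::
  "('c, 'o) residual_complex \<Rightarrow> ('d, 'p) residual_complex \<Rightarrow>
     (nat \<Rightarrow> 'c \<Rightarrow> 'd) \<Rightarrow> (nat \<Rightarrow> 'o \<Rightarrow> 'p) \<Rightarrow> bool" where
  "residual_complex_iso D E Fc Fo \<longleftrightarrow>
     (\<forall>k. homeomorphic_map (rc_cells D k) (rc_cells E k) (Fc k)) \<and>
     (\<forall>k\<ge>1. homeomorphic_map (rc_occs D k) (rc_occs E k) (Fo k) \<and>
        (\<forall>y \<in> topspace (rc_occs D k).
           Fc k (rc_p D k y) = rc_p E k (Fo k y) \<and>
           Fc (k - 1) (rc_q D k y) = rc_q E k (Fo k y)))"

definition equivariant_residual_iso ::
  "('g, 'm) monoid_scheme \<Rightarrow> ('a, 'z) cw_complex_scheme \<Rightarrow> ('g \<Rightarrow> 'a \<Rightarrow> 'a) \<Rightarrow>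
   ('h, 'n) monoid_scheme \<Rightarrow> ('b, 'w) cw_complex_scheme \<Rightarrow> ('h \<Rightarrow> 'b \<Rightarrow> 'b) \<Rightarrow>
   (('g set \<Rightarrow> 'g set) \<Rightarrow> ('h set \<Rightarrow> 'h set)) \<Rightarrow>
   (nat \<Rightarrow> (nat \<Rightarrow> 'a set set) \<Rightarrow> (nat \<Rightarrow> 'b set set)) \<Rightarrow>
   (nat \<Rightarrow> (nat \<Rightarrow> 'a occurrence set) \<Rightarrow> (nat \<Rightarrow> 'b occurrence set)) \<Rightarrow> bool" where
  "equivariant_residual_iso G X \<phi> H Y \<psi> \<eta> Fc Fo \<longleftrightarrow>
     residual_complex_iso (completed_residual_complex G X \<phi>) (completed_residual_complex H Y \<psi>) Fc Fo \<and>
     (\<forall>x \<in> carrier (profinite_completion G).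
        (\<forall>k. \<forall>y \<in> topspace (rc_cells (completed_residual_complex G X \<phi>) k).
           Fc k (completed_act G (cell_act \<phi>) x y) = completed_act H (cell_act \<psi>) (\<eta> x) (Fc k y)) \<and>
        (\<forall>k\<ge>1. \<forall>y \<in> topspace (rc_occs (completed_residual_complex G X \<phi>) k).
           Fo k (completed_act G (occ_act X \<phi> k) x y) =
             completed_act H (occ_act Y \<psi> k) (\<eta> x) (Fo k y)))"

end

theory Submission
  imports Defs "HOL-Homology.Invariance_of_Domain"
begin

text \<open>The translate by \<open>u\<close> of the original cells is, for every \<open>u\<close> in the completion, a connected
  component of the completed incidence graph: an occurrence lying over an original cell on either
  side is original, because the fibres are finite, and the incidence graph of a connected regular
  complex is connected, because every boundary sphere is the closure of its codimension one faces
  (invariance of domain). Hence \<open>F\<close> carries the original complex onto \<open>u\<close> times the original complex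
  as soon as it carries one vertex to such a translate, and every point of the completed vertex space
  is a translate of a vertex since vertices have trivial stabilizers. Finally, an element of the
  completion that moves one original vertex to another lies in the group itself, so \<open>\<eta>\<close> twisted
  by the inverse of \<open>u\<close> restricts to an isomorphism of the two groups.\<close>

section \<open>Invariance of domain on spheres\<close>

text \<open>Original points are dense in the completed spaces, so continuity alone cannot recognise
  them; the incidence structure can. Two mismatches shape the work. First,
  \<open>regular_cw_complex\<close> only places the boundary of a cell in cells of lower dimension.
  It does not say that the boundary is a union of cells or that it has faces of codimension one,
  whereas an occurrence demands a whole lower cell inside the boundary; both facts about codimension
  one faces are extracted from invariance of domain. Second, an element of the completion has a
  coordinate at every finite index normal subgroup, while the completed spaces only see the levels
  \<open>Kcore G m\<close>. Finite generation puts each \<open>Kcore G m\<close> with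
  \<open>m \<ge> 1\<close> among those subgroups, and every one of them contains some
  \<open>Kcore G m\<close>, so the levels determine all coordinates. Vertices serve as base points
  because freeness is a condition on points of the space. Residual finiteness embeds both groups in
  their completions, which turns the restriction of the twisted \<open>\<eta>\<close> into an honest
  isomorphism of groups.\<close>

definition enorm_on :: "nat \<Rightarrow> (nat \<Rightarrow> real) \<Rightarrow> real" where
  "enorm_on k x = sqrt (\<Sum>i<k. (x i)\<^sup>2)"

lemma Euclidean_space_eq_top_of_set:
  "Euclidean_space n = top_of_set {x :: nat \<Rightarrow> real. \<forall>i\<ge>n. x i = 0}"
  by (simp add: Euclidean_space_def euclidean_product_topology)

lemma subtopology_Euclidean_space:
  "S \<subseteq> topspace (Euclidean_space n) \<Longrightarrow> subtopology (Euclidean_space n) S = top_of_set S"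
  by (simp add: Euclidean_space_eq_top_of_set subtopology_subtopology inf.absorb2)

lemma continuous_on_proj: "continuous_on S (\<lambda>x :: nat \<Rightarrow> real. x i)"
  by (rule continuous_on_subset[OF continuous_on_product_coordinates]) simp

lemma continuous_on_enorm_on: "continuous_on S (enorm_on k)"
  unfolding enorm_on_def by (intro continuous_intros continuous_on_proj)

lemma enorm_on_power2: "(enorm_on k x)\<^sup>2 = (\<Sum>i<k. (x i)\<^sup>2)"
  by (simp add: enorm_on_def sum_nonneg)

lemma enorm_on_sphere: "x \<in> sphere_points k \<Longrightarrow> enorm_on k x = 1"
  by (simp add: sphere_points_def enorm_on_def)

lemma sphere_points_subset: "sphere_points k \<subseteq> topspace (Euclidean_space k)"
  by (auto simp: sphere_points_def)

lemma ball_points_subset: "ball_points k \<subseteq> topspace (Euclidean_space k)"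
  by (auto simp: ball_points_def)

lemma ball_points_eq: "ball_points k = open_ball_points k \<union> sphere_points k"
  by (auto simp: ball_points_def open_ball_points_def sphere_points_def)

text \<open>Coning off turns a map on an open subset of the sphere into one on an open subset of the next
  Euclidean space, so no charts of the sphere are needed.\<close>

lemma invariance_of_domain_sphere:
  assumes U: "openin (top_of_set (sphere_points (Suc n))) U"
    and cf: "continuous_on U f" and f: "f \<in> U \<rightarrow> topspace (Euclidean_space n)" and inj: "inj_on f U"
  shows "openin (Euclidean_space n) (f ` U)"
proof -
  define E where "E = topspace (Euclidean_space (Suc n))"
  define nn where "nn = enorm_on (Suc n)"
  define r where "r x = (\<lambda>i. inverse (nn x) * x i)" for x :: "nat \<Rightarrow> real"
  define E0 where "E0 = {x \<in> E. nn x > 0}"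
  define V where "V = E0 \<inter> r -` U"
  \<comment> \<open>\<open>F\<close> is the cone on \<open>f\<close>: the direction of
    \<open>x\<close> goes through \<open>f\<close> into the first \<open>n\<close> coordinates and
    the radius is kept as coordinate \<open>n\<close>, so that both can be recovered from
    \<open>F x\<close>.\<close>
  define F where "F x = (\<lambda>i. if i < n then f (r x) i else if i = n then nn x else 0)" for x
  have US: "U \<subseteq> sphere_points (Suc n)"
    using openin_imp_subset[OF U] .
  have rS: "r x \<in> sphere_points (Suc n)" if "x \<in> E0" for x
  proof -
    have "(\<Sum>i<Suc n. (r x i)\<^sup>2) = (inverse (nn x))\<^sup>2 * (nn x)\<^sup>2"
      unfolding r_def nn_def enorm_on_power2 sum_distrib_left power_mult_distrib by simp
    also have "\<dots> = 1"
      using that by (simp add: E0_def flip: power_mult_distrib)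
    finally have "(\<Sum>i<Suc n. (r x i)\<^sup>2) = 1" .
    then show ?thesis
      using that by (auto simp: sphere_points_def E0_def E_def r_def topspace_Euclidean_space)
  qed
  have cn: "continuous_on S nn" for S
    unfolding nn_def by (rule continuous_on_enorm_on)
  have cr: "continuous_on E0 r"
    unfolding r_def
    by (intro continuous_on_coordinatewise_then_product continuous_intros cn continuous_on_proj)
       (auto simp: E0_def)
  have E0: "openin (top_of_set E) E0"
  proof -
    have "openin (top_of_set E) (E \<inter> nn -` {0<..})"
      by (rule continuous_openin_preimage_gen[OF cn]) auto
    moreover have "E \<inter> nn -` {0<..} = E0" by (auto simp: E0_def)
    ultimately show ?thesis by simp
  qed
  have "openin (top_of_set E0) (E0 \<inter> r -` U)"
    using continuous_openin_preimage[OF cr _ U] rS by blast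
  then have V: "openin (Euclidean_space (Suc n)) V"
    using openin_trans[OF _ E0] by (simp add: V_def E_def Euclidean_space_eq_top_of_set)
  have VE: "V \<subseteq> E0" by (auto simp: V_def)
  have cfr: "continuous_on V (\<lambda>x. f (r x))"
    using continuous_on_compose2[OF cf continuous_on_subset[OF cr VE]] by (auto simp: V_def)
  have cF: "continuous_on V F"
  proof (rule continuous_on_coordinatewise_then_product)
    fix i
    have "continuous_on V (\<lambda>x. f (r x) i)"
      using continuous_on_compose2[OF continuous_on_proj cfr] by auto
    then show "continuous_on V (\<lambda>x. F x i)"
      unfolding F_def by (cases "i < n"; cases "i = n") (auto intro!: cn continuous_intros)
  qed
  have injF: "inj_on F V"
  proof (rule inj_onI)
    fix x y assume xy: "x \<in> V" "y \<in> V" "F x = F y"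
    have nn: "nn x = nn y"
      using fun_cong[OF xy(3), of n] by (simp add: F_def)
    have "f (r x) = f (r y)"
    proof
      fix i
      show "f (r x) i = f (r y) i"
      proof (cases "i < n")
        case True
        then show ?thesis using fun_cong[OF xy(3), of i] by (simp add: F_def)
      next
        case False
        then show ?thesis using f xy(1,2) by (auto simp: V_def topspace_Euclidean_space Pi_iff)
      qed
    qed
    then have "r x = r y"
      using inj xy(1,2) by (auto simp: V_def inj_on_def)
    moreover have "nn x > 0" using xy(1) by (simp add: V_def E0_def)
    ultimately show "x = y"
      unfolding r_def nn fun_eq_iff using nn by (auto simp: fun_eq_iff)
  qed
  have "openin (Euclidean_space (Suc n)) (F ` V)"
  proof (rule invariance_of_domain_Euclidean_space[OF V _ injF])
    show "continuous_map (subtopology (Euclidean_space (Suc n)) V) (Euclidean_space (Suc n)) F"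
      unfolding cm_Euclidean_space_iff_continuous_on
      using cF by (auto simp: topspace_Euclidean_space F_def continuous_on_subset)
  qed
  then obtain O' where O': "open O'" "F ` V = O' \<inter> E"
    by (auto simp: Euclidean_space_eq_top_of_set openin_open E_def)
  \<comment> \<open>\<open>j\<close> places \<open>n\<close>-space at height 1, the radius of the
    sphere. The set \<open>f\<close> U\<open>is the slice of the open set\<close>F \<open>V\<close>
    at this height.\<close>
  define j where "j z = z(n := 1)" for z :: "nat \<Rightarrow> real"
  have cj: "continuous_on S j" for S
    unfolding j_def fun_upd_def
  proof (rule continuous_on_coordinatewise_then_product)
    show "continuous_on S (\<lambda>z. if i = n then 1 else z i)" for i
      by (cases "i = n") (auto intro: continuous_on_proj)
  qed
  have "f ` U = topspace (Euclidean_space n) \<inter> j -` O'"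
  proof (intro equalityI subsetI)
    fix y assume "y \<in> f ` U"
    then obtain s where s: "s \<in> U" "y = f s" by blast
    then have sS: "s \<in> sphere_points (Suc n)" using US by blast
    then have ns: "nn s = 1" by (simp add: nn_def enorm_on_sphere)
    have rs: "r s = s" by (simp add: r_def ns)
    have sV: "s \<in> V"
      using s sS ns rs sphere_points_subset by (auto simp: V_def E0_def E_def)
    have y: "y \<in> topspace (Euclidean_space n)" using f s by auto
    then have "F s = j y"
      by (auto simp: F_def j_def rs ns s(2) fun_eq_iff topspace_Euclidean_space)
    then have "j y \<in> F ` V" using sV by force
    then show "y \<in> topspace (Euclidean_space n) \<inter> j -` O'" using O' y by auto
  next
    fix y assume y: "y \<in> topspace (Euclidean_space n) \<inter> j -` O'"
    then have "j y \<in> E" by (auto simp: E_def topspace_Euclidean_space j_def)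
    then have "j y \<in> F ` V" using y O' by auto
    then obtain x where x: "x \<in> V" "j y = F x" by auto
    have "f (r x) \<in> topspace (Euclidean_space n)" using x f by (auto simp: V_def)
    have "y = f (r x)"
    proof
      fix i
      show "y i = f (r x) i"
        using fun_cong[OF x(2), of i] y \<open>f (r x) \<in> _\<close>
        by (cases "i < n") (auto simp: j_def F_def topspace_Euclidean_space split: if_splits)
    qed
    then show "y \<in> f ` U" using x by (auto simp: V_def)
  qed
  moreover have "openin (Euclidean_space n) (topspace (Euclidean_space n) \<inter> j -` O')"
    using continuous_openin_preimage_gen[OF cj O'(1)]
    by (simp add: Euclidean_space_eq_top_of_set)
  ultimately show ?thesis by simp
qed

text \<open>Regarded as a subset of \<open>n\<close>-space, the image would be open by the previous
  lemma, yet coordinate \<open>l\<close> vanishes on all of it.\<close>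

lemma invariance_of_dimension_sphere:
  assumes U: "openin (top_of_set (sphere_points (Suc n))) U"
    and cf: "continuous_on U f" and f: "f \<in> U \<rightarrow> topspace (Euclidean_space l)" and inj: "inj_on f U"
    and "l < n"
  shows "U = {}"
proof (rule ccontr)
  assume "U \<noteq> {}"
  then obtain x where x: "x \<in> f ` U" by blast
  have ln: "topspace (Euclidean_space l) \<subseteq> topspace (Euclidean_space n)"
    using \<open>l < n\<close> by simp
  then have "openin (Euclidean_space n) (f ` U)"
    using invariance_of_domain_sphere[OF U cf _ inj] f by blast
  then obtain O' where O': "open O'" "f ` U = topspace (Euclidean_space n) \<inter> O'"
    by (auto simp: Euclidean_space_eq_top_of_set openin_open)
  \<comment> \<open>Varying coordinate \<open>l\<close> alone leaves the smaller space at once but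
    stays in any open set of \<open>n\<close>-space around \<open>x\<close> for a short
    time.\<close>
  define j where "j t = x(l := t)" for t :: real
  have cj: "continuous_on UNIV j"
    unfolding j_def fun_upd_def
  proof (rule continuous_on_coordinatewise_then_product)
    show "continuous_on UNIV (\<lambda>t. if i = l then t else x i)" for i
      by (cases "i = l") auto
  qed
  have xl: "x \<in> topspace (Euclidean_space l)" using x f by auto
  then have j0: "j 0 = x" by (auto simp: j_def topspace_Euclidean_space)
  have "open (j -` O')" using open_vimage[OF O'(1) cj] .
  moreover have "0 \<in> j -` O'" using j0 x O' by auto
  ultimately obtain e where e: "e > 0" "ball 0 e \<subseteq> j -` O'"
    using open_contains_ball by blast
  have "j (e/2) \<in> O'" using e by (auto simp: subset_iff dist_norm)
  moreover have "j (e/2) \<in> topspace (Euclidean_space n)"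
    using xl \<open>l < n\<close> by (auto simp: j_def topspace_Euclidean_space)
  ultimately have "j (e/2) \<in> f ` U" using O' by auto
  then have "j (e/2) \<in> topspace (Euclidean_space l)" using f by auto
  then show False using e by (auto simp: j_def topspace_Euclidean_space)
qed

text \<open>A finite form of the Baire argument: if \<open>W\<close> is not inside one closed set
  \<open>C\<close>, then \<open>W - C\<close> is a nonempty open set covered by the remaining
  ones.\<close>

lemma nonempty_open_in_finite_closed_cover:
  assumes "finite \<C>" "\<And>C. C \<in> \<C> \<Longrightarrow> closedin T C" "openin T W" "W \<noteq> {}" "W \<subseteq> \<Union>\<C>"
  shows "\<exists>C \<in> \<C>. \<exists>W'. openin T W' \<and> W' \<noteq> {} \<and> W' \<subseteq> W \<inter> C"
  using assms
proof (induction \<C> arbitrary: W rule: finite_induct)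
  case empty
  then show ?case by auto
next
  case (insert C \<C>)
  show ?case
  proof (cases "W \<subseteq> C")
    case True
    then show ?thesis using insert.prems by blast
  next
    case False
    have "openin T (W - C)" using insert.prems by (auto intro: openin_diff)
    then have "\<exists>D \<in> \<C>. \<exists>W'. openin T W' \<and> W' \<noteq> {} \<and> W' \<subseteq> (W - C) \<inter> D"
      using insert.IH[of "W - C"] insert.prems False by blast
    then show ?thesis by blast
  qed
qed

text \<open>The ball is star-shaped: it is the union of the segments joining its points to the
  origin.\<close>

lemma connected_open_ball_points: "connectedin (Euclidean_space k) (open_ball_points k)"
proof -
  define seg where "seg x = (\<lambda>t::real. (\<lambda>i. t * x i :: real)) ` {0..1}" for x :: "nat \<Rightarrow> real"
  have "connected (seg x)" for x
    unfolding seg_def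
    by (intro connected_continuous_image continuous_on_coordinatewise_then_product continuous_intros)
       auto
  moreover have "(\<lambda>i. 0) \<in> seg x" for x by (force simp: seg_def)
  ultimately have "connected (\<Union>x \<in> open_ball_points k. seg x)"
    by (intro connected_Union) blast+
  moreover have "(\<Union>x \<in> open_ball_points k. seg x) = open_ball_points k"
  proof (intro equalityI subsetI)
    fix y assume "y \<in> (\<Union>x \<in> open_ball_points k. seg x)"
    then obtain x t where x: "x \<in> open_ball_points k" "0 \<le> t" "t \<le> 1" "y = (\<lambda>i. t * x i)"
      by (auto simp: seg_def)
    have "(\<Sum>i<k. (y i)\<^sup>2) = t\<^sup>2 * (\<Sum>i<k. (x i)\<^sup>2)"
      by (simp add: x(4) power_mult_distrib sum_distrib_left)
    also have "\<dots> \<le> 1 * (\<Sum>i<k. (x i)\<^sup>2)"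
      using x by (intro mult_right_mono) (auto simp: power_le_one sum_nonneg)
    finally show "y \<in> open_ball_points k"
      using x by (auto simp: open_ball_points_def topspace_Euclidean_space)
  next
    fix y assume "y \<in> open_ball_points k"
    then show "y \<in> (\<Union>x \<in> open_ball_points k. seg x)"
      by (force simp: seg_def)
  qed
  moreover have "open_ball_points k \<subseteq> topspace (Euclidean_space k)"
    by (auto simp: open_ball_points_def)
  ultimately show ?thesis
    by (simp add: Euclidean_space_eq_top_of_set connectedin_subtopology open_ball_points_def topspace_Euclidean_space)
qed

section \<open>Regular CW complexes\<close>

locale regular_cw =
  fixes X :: "('a, 'z) cw_complex_scheme"
  assumes regular: "regular_cw_complex X"
begin

abbreviation cl :: "'a set \<Rightarrow> 'a set" where
  "cl \<sigma> \<equiv> cw_top X closure_of \<sigma>"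

abbreviation bd :: "nat \<Rightarrow> 'a set \<Rightarrow> 'a set" where
  "bd k \<sigma> \<equiv> cw_char X \<sigma> ` sphere_points k"

lemma Hausdorff_top: "Hausdorff_space (cw_top X)"
  using regular by (simp add: regular_cw_complex_def)

lemma topspace_cells: "topspace (cw_top X) = (\<Union>k. \<Union>(cw_cells X k))"
  using regular by (simp add: regular_cw_complex_def)

lemma cells_eq:
  "\<sigma> \<in> cw_cells X k \<Longrightarrow> \<tau> \<in> cw_cells X l \<Longrightarrow> x \<in> \<sigma> \<Longrightarrow> x \<in> \<tau> \<Longrightarrow> k = l \<and> \<sigma> = \<tau>"
proof -
  assume *: "\<sigma> \<in> cw_cells X k" "\<tau> \<in> cw_cells X l" "x \<in> \<sigma>" "x \<in> \<tau>"
  then have "\<sigma> \<inter> \<tau> \<noteq> {}" by blast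
  with * show ?thesis
    using regular[unfolded regular_cw_complex_def, THEN conjunct2, THEN conjunct2, THEN conjunct1]
    by simp
qed

lemma cell_structure:
  assumes "\<sigma> \<in> cw_cells X k"
  shows "homeomorphic_map (subtopology (Euclidean_space k) (ball_points k))
       (subtopology (cw_top X) (cl \<sigma>)) (cw_char X \<sigma>) \<and>
     cw_char X \<sigma> ` open_ball_points k = \<sigma> \<and>
     bd k \<sigma> \<subseteq> (\<Union>l<k. \<Union>(cw_cells X l)) \<and>
     finite {\<tau> \<in> (\<Union>l. cw_cells X l). \<tau> \<inter> cl \<sigma> \<noteq> {}}"
  using regular[unfolded regular_cw_complex_def, THEN conjunct2, THEN conjunct2, THEN conjunct2,
      THEN conjunct1, rule_format, OF assms] .

lemma homeomorphic_char:
  "\<sigma> \<in> cw_cells X k \<Longrightarrow>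
     homeomorphic_map (subtopology (Euclidean_space k) (ball_points k))
       (subtopology (cw_top X) (cl \<sigma>)) (cw_char X \<sigma>)"
  using cell_structure by simp

lemma char_open_ball: "\<sigma> \<in> cw_cells X k \<Longrightarrow> cw_char X \<sigma> ` open_ball_points k = \<sigma>"
  using cell_structure by simp

lemma bd_lower:
  assumes "\<sigma> \<in> cw_cells X k" "x \<in> bd k \<sigma>"
  obtains l \<tau> where "l < k" "\<tau> \<in> cw_cells X l" "x \<in> \<tau>"
proof -
  have "bd k \<sigma> \<subseteq> (\<Union>l<k. \<Union>(cw_cells X l))"
    using cell_structure[OF assms(1)] by simp
  then show thesis using assms(2) that by blast
qed

lemma finite_cells_meeting_closure:
  assumes "\<sigma> \<in> cw_cells X k"
  shows "finite {\<tau> \<in> (\<Union>l. cw_cells X l). \<tau> \<inter> cl \<sigma> \<noteq> {}}"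
  using cell_structure[OF assms] by simp

lemma cell_subset_topspace: "\<sigma> \<in> cw_cells X k \<Longrightarrow> \<sigma> \<subseteq> topspace (cw_top X)"
  using topspace_cells by blast

lemma cell_nonempty:
  assumes "\<sigma> \<in> cw_cells X k"
  shows "\<sigma> \<noteq> {}"
proof -
  have "(\<lambda>_. 0) \<in> open_ball_points k"
    by (simp add: open_ball_points_def topspace_Euclidean_space)
  then show ?thesis using char_open_ball[OF assms] by blast
qed

lemma cell_subset_closure: "\<sigma> \<in> cw_cells X k \<Longrightarrow> \<sigma> \<subseteq> cl \<sigma>"
  by (simp add: cell_subset_topspace closure_of_subset)

lemma
  assumes "\<sigma> \<in> cw_cells X k"
  shows char_ball: "cw_char X \<sigma> ` ball_points k = cl \<sigma>"
    and inj_on_char: "inj_on (cw_char X \<sigma>) (ball_points k)"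
    and continuous_char: "continuous_map (top_of_set (ball_points k)) (cw_top X) (cw_char X \<sigma>)"
proof -
  have *: "topspace (subtopology (Euclidean_space k) (ball_points k)) = ball_points k"
    using ball_points_subset by auto
  have **: "topspace (subtopology (cw_top X) (cl \<sigma>)) = cl \<sigma>"
    using closure_of_subset_topspace[of "cw_top X" \<sigma>] by auto
  show "cw_char X \<sigma> ` ball_points k = cl \<sigma>"
    using homeomorphic_imp_surjective_map[OF homeomorphic_char[OF assms]] unfolding * ** .
  show "inj_on (cw_char X \<sigma>) (ball_points k)"
    using homeomorphic_imp_injective_map[OF homeomorphic_char[OF assms]] unfolding * .
  show "continuous_map (top_of_set (ball_points k)) (cw_top X) (cw_char X \<sigma>)"
    using homeomorphic_imp_continuous_map[OF homeomorphic_char[OF assms]]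
    by (simp add: subtopology_Euclidean_space ball_points_subset continuous_map_in_subtopology)
qed

lemma closure_cell: "\<sigma> \<in> cw_cells X k \<Longrightarrow> cl \<sigma> = \<sigma> \<union> bd k \<sigma>"
  by (metis ball_points_eq char_ball char_open_ball image_Un)

lemma cell_bd_disjoint: "\<sigma> \<in> cw_cells X k \<Longrightarrow> \<sigma> \<inter> bd k \<sigma> = {}"
proof (rule equals0I)
  fix x assume *: "\<sigma> \<in> cw_cells X k" "x \<in> \<sigma> \<inter> bd k \<sigma>"
  then obtain l \<tau> where "l < k" "\<tau> \<in> cw_cells X l" "x \<in> \<tau>"
    using bd_lower by blast
  with * cells_eq[of \<sigma> k \<tau> l x] show False by simp
qed

lemma chart:
  assumes "\<sigma> \<in> cw_cells X k"
  obtains \<psi> where "continuous_map (subtopology (cw_top X) (cl \<sigma>)) (Euclidean_space k) \<psi>"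
    "\<And>y. y \<in> cl \<sigma> \<Longrightarrow> \<psi> y \<in> ball_points k"
    "\<And>y. y \<in> cl \<sigma> \<Longrightarrow> cw_char X \<sigma> (\<psi> y) = y"
proof -
  obtain \<psi> where "homeomorphic_maps (subtopology (Euclidean_space k) (ball_points k))
       (subtopology (cw_top X) (cl \<sigma>)) (cw_char X \<sigma>) \<psi>"
    using homeomorphic_char[OF assms] homeomorphic_map_maps by blast
  then have "continuous_map (subtopology (cw_top X) (cl \<sigma>)) (Euclidean_space k) \<psi>"
    "\<And>y. y \<in> cl \<sigma> \<Longrightarrow> \<psi> y \<in> ball_points k"
    "\<And>y. y \<in> cl \<sigma> \<Longrightarrow> cw_char X \<sigma> (\<psi> y) = y"
    using closure_of_subset_topspace[of "cw_top X" \<sigma>]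
    by (auto simp: homeomorphic_maps_def continuous_map_in_subtopology)
  then show thesis by (rule that)
qed

text \<open>The sphere sits in a product of countably many lines, so its compactness is obtained
  from Tychonoff for the cube with sides \<open>{-1..1}\<close> together with closedness.
  Compactness makes the boundary closed in the Hausdorff space.\<close>

lemma compactin_bd:
  assumes "\<sigma> \<in> cw_cells X k"
  shows "compactin (cw_top X) (bd k \<sigma>)"
proof -
  have cs: "continuous_on S (\<lambda>x :: nat \<Rightarrow> real. (\<Sum>i<k. (x i)\<^sup>2))" for S
    by (intro continuous_intros continuous_on_proj)
  have bounded_box: "sphere_points k \<subseteq> (\<Pi>\<^sub>E i\<in>UNIV. {-1..1::real})"
  proof
    fix x assume x: "x \<in> sphere_points k"
    have "x i \<in> {-1..1}" for i
    proof (cases "i < k")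
      case True
      have "(x i)\<^sup>2 \<le> (\<Sum>i<k. (x i)\<^sup>2)"
        by (rule member_le_sum) (use True in auto)
      also have "\<dots> = 1" using x by (simp add: sphere_points_def)
      finally show ?thesis by (simp add: abs_square_le_1 abs_le_iff)
    next
      case False
      then show ?thesis using x by (simp add: sphere_points_def topspace_Euclidean_space)
    qed
    then show "x \<in> (\<Pi>\<^sub>E i\<in>UNIV. {-1..1::real})" by auto
  qed
  have "compact (\<Pi>\<^sub>E i\<in>UNIV. {-1..1::real})"
    using compactin_PiE[of "\<lambda>_. euclideanreal" UNIV "\<lambda>_. {-1..1}"]
    by (simp add: euclidean_product_topology)
  moreover have "closed (sphere_points k)"
  proof -
    have "closed (topspace (Euclidean_space k))"
      using closedin_Euclidean_imp_closed[OF closedin_topspace] .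
    then have "closed (topspace (Euclidean_space k) \<inter> (\<lambda>x. \<Sum>i<k. (x i)\<^sup>2) -` {1})"
      by (intro continuous_closed_preimage cs) auto
    moreover have "topspace (Euclidean_space k) \<inter> (\<lambda>x. \<Sum>i<k. (x i)\<^sup>2) -` {1} = sphere_points k"
      by (auto simp: sphere_points_def)
    ultimately show ?thesis by simp
  qed
  ultimately have "compact (sphere_points k)"
    using compact_Int_closed[of "\<Pi>\<^sub>E i\<in>UNIV. {-1..1::real}" "sphere_points k"] bounded_box
    by (simp add: inf.absorb2)
  then have "compactin (top_of_set (ball_points k)) (sphere_points k)"
    by (auto simp: compactin_subtopology ball_points_eq)
  then show ?thesis
    using image_compactin[OF _ continuous_char[OF assms]] by blast
qed

lemma closedin_bd: "\<sigma> \<in> cw_cells X k \<Longrightarrow> closedin (cw_top X) (bd k \<sigma>)"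
  by (simp add: Hausdorff_top compactin_bd compactin_imp_closedin)

lemma continuous_char_sphere:
  assumes "\<sigma> \<in> cw_cells X k"
  shows "continuous_map (top_of_set (sphere_points k)) (cw_top X) (cw_char X \<sigma>)"
  using continuous_map_from_subtopology_mono[OF continuous_char[OF assms]]
  by (auto simp: ball_points_eq)

text \<open>Composing the characteristic map of \<open>\<sigma>\<close> with the inverse of that of
  \<open>\<tau>\<close> turns a statement about cells into one about a continuous injection from
  part of a sphere to a Euclidean space, the form that invariance of domain and dimension
  require.\<close>

lemma transition_map:
  assumes \<sigma>: "\<sigma> \<in> cw_cells X k" and \<tau>: "\<tau> \<in> cw_cells X l"
    and W: "W \<subseteq> sphere_points k" "cw_char X \<sigma> ` W \<subseteq> cl \<tau>"
  obtains f where "continuous_on W f" "f \<in> W \<rightarrow> topspace (Euclidean_space l)" "inj_on f W"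
    "\<And>s. s \<in> W \<Longrightarrow> cw_char X \<tau> (f s) = cw_char X \<sigma> s" "f \<in> W \<rightarrow> ball_points l"
proof -
  obtain \<psi> where \<psi>: "continuous_map (subtopology (cw_top X) (cl \<tau>)) (Euclidean_space l) \<psi>"
    "\<And>y. y \<in> cl \<tau> \<Longrightarrow> \<psi> y \<in> ball_points l"
    "\<And>y. y \<in> cl \<tau> \<Longrightarrow> cw_char X \<tau> (\<psi> y) = y"
    using chart[OF \<tau>] by blast
  let ?f = "\<psi> \<circ> cw_char X \<sigma>"
  have "continuous_map (top_of_set W) (subtopology (cw_top X) (cl \<tau>)) (cw_char X \<sigma>)"
    using continuous_map_from_subtopology_mono[OF continuous_char_sphere[OF \<sigma>] W(1)] W(2)
    by (auto simp: continuous_map_in_subtopology)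
  then have "continuous_map (top_of_set W) (Euclidean_space l) ?f"
    using \<psi>(1) continuous_map_compose by blast
  then have "continuous_on W ?f"
    by (auto simp: Euclidean_space_eq_top_of_set continuous_map_in_subtopology)
  moreover have "?f \<in> W \<rightarrow> ball_points l" using \<psi>(2) W by auto
  moreover have "cw_char X \<tau> (?f s) = cw_char X \<sigma> s" if "s \<in> W" for s
    using \<psi>(3) that W by auto
  moreover have "inj_on ?f W"
  proof (rule inj_onI)
    fix s t assume st: "s \<in> W" "t \<in> W" "?f s = ?f t"
    then have "cw_char X \<sigma> s = cw_char X \<sigma> t"
      using \<psi>(3) W by (metis comp_apply image_subset_iff)
    then show "s = t"
      using inj_on_char[OF \<sigma>] st(1,2) W(1) by (auto simp: inj_on_def ball_points_eq)
  qed
  ultimately show thesis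
    using ball_points_subset by (intro that[of ?f]) blast+
qed

text \<open>If a point were missed, an open piece of the \<open>n\<close>-sphere would be covered by
  finitely many closed sets, the preimages of closures of cells of dimension less than
  \<open>n\<close>. One of them would contain a nonempty open set, which would then embed in a space
  of dimension less than \<open>n\<close>.\<close>

lemma bd_subset_faces_closure:
  assumes \<sigma>: "\<sigma> \<in> cw_cells X (Suc n)" and x: "x \<in> bd (Suc n) \<sigma>"
  shows "\<exists>\<tau> \<in> cw_cells X n. \<tau> \<inter> bd (Suc n) \<sigma> \<noteq> {} \<and> x \<in> cl \<tau>"
proof (rule ccontr)
  assume *: "\<not> ?thesis"
  let ?S = "top_of_set (sphere_points (Suc n))"
  define pre where "pre \<tau> = {s \<in> sphere_points (Suc n). cw_char X \<sigma> s \<in> cl \<tau>}" for \<tau>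
  have pre: "closedin ?S (pre \<tau>)" for \<tau>
    using closedin_continuous_map_preimage[OF continuous_char_sphere[OF \<sigma>] closedin_closure_of]
    by (simp add: pre_def)
  define M where "M = {\<tau> \<in> (\<Union>l. cw_cells X l). \<tau> \<inter> bd (Suc n) \<sigma> \<noteq> {}}"
  have "M \<subseteq> {\<tau> \<in> (\<Union>l. cw_cells X l). \<tau> \<inter> cl \<sigma> \<noteq> {}}"
    unfolding M_def closure_cell[OF \<sigma>] by blast
  then have finM: "finite M"
    using finite_cells_meeting_closure[OF \<sigma>] finite_subset by blast
  \<comment> \<open>\<open>W\<close> is what the closures of the \<open>n\<close>-cells meeting the
    boundary leave of the sphere; it is open because finitely many closed sets are removed.\<close>
  define W where "W = sphere_points (Suc n) - \<Union>(pre ` (M \<inter> cw_cells X n))"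
  have W: "openin ?S W"
  proof -
    have "closedin ?S (\<Union>(pre ` (M \<inter> cw_cells X n)))"
      using finM pre by (intro closedin_Union) auto
    then show ?thesis
      unfolding W_def using openin_diff[OF openin_topspace, of ?S] by simp
  qed
  obtain s where s: "s \<in> sphere_points (Suc n)" "x = cw_char X \<sigma> s" using x by blast
  have "s \<in> W"
    using * s by (auto simp: W_def pre_def M_def)
  have "W \<subseteq> \<Union>(pre ` (M \<inter> (\<Union>l<n. cw_cells X l)))"
  proof
    fix t assume t: "t \<in> W"
    then have "cw_char X \<sigma> t \<in> bd (Suc n) \<sigma>" by (auto simp: W_def)
    then obtain l \<tau> where l: "l < Suc n" "\<tau> \<in> cw_cells X l" "cw_char X \<sigma> t \<in> \<tau>"
      using bd_lower[OF \<sigma>] by blast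
    have \<tau>: "\<tau> \<in> M" "t \<in> pre \<tau>"
      using l t cell_subset_closure[OF l(2)] by (auto simp: M_def pre_def W_def)
    have "l \<noteq> n" using \<tau> t l by (auto simp: W_def)
    then show "t \<in> \<Union>(pre ` (M \<inter> (\<Union>l<n. cw_cells X l)))"
      using \<tau> l by fastforce
  qed
  moreover have "W \<noteq> {}" using \<open>s \<in> W\<close> by auto
  ultimately obtain C W' where C: "C \<in> pre ` (M \<inter> (\<Union>l<n. cw_cells X l))"
      "openin ?S W'" "W' \<noteq> {}" "W' \<subseteq> W \<inter> C"
    using nonempty_open_in_finite_closed_cover[of "pre ` (M \<inter> (\<Union>l<n. cw_cells X l))" ?S W]
      finM pre W by blast
  then obtain \<tau> l where \<tau>: "l < n" "\<tau> \<in> cw_cells X l" "C = pre \<tau>" by auto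
  have "W' \<subseteq> sphere_points (Suc n)" "cw_char X \<sigma> ` W' \<subseteq> cl \<tau>"
    using C \<tau> by (auto simp: pre_def)
  then obtain f where "continuous_on W' f" "f \<in> W' \<rightarrow> topspace (Euclidean_space l)" "inj_on f W'"
    using transition_map[OF \<sigma> \<tau>(2)] by metis
  then have "W' = {}" using invariance_of_dimension_sphere[OF C(2)] \<tau>(1) by blast
  then show False using C by simp
qed

lemma connectedin_cell:
  assumes "\<sigma> \<in> cw_cells X k"
  shows "connectedin (cw_top X) \<sigma>"
proof -
  have "connectedin (top_of_set (ball_points k)) (open_ball_points k)"
    using connected_open_ball_points[of k]
    by (simp add: Euclidean_space_eq_top_of_set connectedin_subtopology ball_points_eq)
  then show ?thesis
    using connectedin_continuous_map_image[OF continuous_char[OF assms]] char_open_ball[OF assms]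
    by metis
qed

text \<open>The part of \<open>\<tau>\<close> in the boundary is closed in \<open>\<tau>\<close>
  because the boundary is compact, and open in \<open>\<tau>\<close> by invariance of domain;
  \<open>\<tau>\<close> is connected. This promotes mere contact with the boundary to the
  containment that an occurrence demands.\<close>

lemma cell_subset_bd:
  assumes \<sigma>: "\<sigma> \<in> cw_cells X (Suc n)" and \<tau>: "\<tau> \<in> cw_cells X n"
    and meet: "\<tau> \<inter> bd (Suc n) \<sigma> \<noteq> {}"
  shows "\<tau> \<subseteq> bd (Suc n) \<sigma>"
proof -
  let ?S = "top_of_set (sphere_points (Suc n))" and ?B = "bd (Suc n) \<sigma>"
  define M where "M = {\<rho> \<in> (\<Union>l<Suc n. cw_cells X l). \<rho> \<inter> ?B \<noteq> {} \<and> \<rho> \<noteq> \<tau>}"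
  have "M \<subseteq> {\<rho> \<in> (\<Union>l. cw_cells X l). \<rho> \<inter> cl \<sigma> \<noteq> {}}"
    unfolding M_def closure_cell[OF \<sigma>] by blast
  then have finM: "finite M"
    using finite_cells_meeting_closure[OF \<sigma>] finite_subset by blast
  \<comment> \<open>The closure of a cell of dimension at most \<open>n\<close> adds only points of
    cells of dimension less than \<open>n\<close>, so it cannot reach another \<open>n\<close>-cell.
    Removing these finitely many closures from the sphere leaves exactly the preimage of
    \<open>\<tau>\<close>, which is therefore open.\<close>
  have avoid: "cl \<rho> \<inter> \<tau> = {}" if \<rho>: "\<rho> \<in> M" for \<rho>
  proof -
    have "\<rho> \<in> (\<Union>l<Suc n. cw_cells X l)" "\<rho> \<noteq> \<tau>"
      using \<rho> unfolding M_def by blast+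
    then obtain l where l: "l \<le> n" "\<rho> \<in> cw_cells X l" "\<rho> \<noteq> \<tau>"
      using less_Suc_eq_le by blast
    have False if "y \<in> bd l \<rho>" "y \<in> \<tau>" for y
      using bd_lower[OF l(2) that(1)] cells_eq[OF _ \<tau> _ that(2)] l(1) by (metis leD)
    moreover have "\<rho> \<inter> \<tau> = {}"
      using cells_eq[OF l(2) \<tau>] l(3) by blast
    ultimately show ?thesis unfolding closure_cell[OF l(2)] by blast
  qed
  define W where "W = {s \<in> sphere_points (Suc n). cw_char X \<sigma> s \<in> topspace (cw_top X) - \<Union>(cl ` M)}"
  have "openin (cw_top X) (topspace (cw_top X) - \<Union>(cl ` M))"
    using finM by (intro openin_diff closedin_Union) auto
  then have W: "openin ?S W"
    using openin_continuous_map_preimage[OF continuous_char_sphere[OF \<sigma>]]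
    unfolding W_def topspace_euclidean_subtopology by blast
  have imW: "cw_char X \<sigma> ` W = \<tau> \<inter> ?B"
  proof (intro equalityI subsetI)
    fix y assume "y \<in> cw_char X \<sigma> ` W"
    then have y: "y \<in> ?B" "y \<notin> \<Union>(cl ` M)" by (auto simp: W_def)
    obtain l \<rho> where l: "l < Suc n" "\<rho> \<in> cw_cells X l" "y \<in> \<rho>"
      using bd_lower[OF \<sigma> y(1)] .
    have "\<rho> \<notin> M" using cell_subset_closure[OF l(2)] l(3) y(2) by blast
    then have "\<rho> = \<tau>" using l y(1) by (auto simp: M_def)
    then show "y \<in> \<tau> \<inter> ?B" using l y by simp
  next
    fix y assume y: "y \<in> \<tau> \<inter> ?B"
    then obtain s where s: "s \<in> sphere_points (Suc n)" "y = cw_char X \<sigma> s" by blast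
    have "y \<in> topspace (cw_top X) - \<Union>(cl ` M)"
      using y avoid cell_subset_topspace[OF \<tau>] by blast
    then show "y \<in> cw_char X \<sigma> ` W" using s by (auto simp: W_def)
  qed
  have "W \<subseteq> sphere_points (Suc n)" "cw_char X \<sigma> ` W \<subseteq> cl \<tau>"
    using imW cell_subset_closure[OF \<tau>] by (auto simp: W_def)
  then obtain f where f: "continuous_on W f" "f \<in> W \<rightarrow> topspace (Euclidean_space n)" "inj_on f W"
    "\<And>s. s \<in> W \<Longrightarrow> cw_char X \<tau> (f s) = cw_char X \<sigma> s" "f \<in> W \<rightarrow> ball_points n"
    using transition_map[OF \<sigma> \<tau>] by metis
  have "openin (Euclidean_space n) (f ` W)"
    by (rule invariance_of_domain_sphere[OF W f(1-3)])
  \<comment> \<open>Openness in the whole \<open>n\<close>-space restricts to the closed ball, and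
    from there the homeomorphism onto \<open>cl \<tau>\<close> carries it back into the
    complex.\<close>
  then have "openin (subtopology (Euclidean_space n) (ball_points n)) (f ` W)"
    using f(5) unfolding openin_subtopology by blast
  then have "openin (subtopology (cw_top X) (cl \<tau>)) (cw_char X \<tau> ` f ` W)"
    using homeomorphic_map_openness_eq[OF homeomorphic_char[OF \<tau>]] by blast
  also have "cw_char X \<tau> ` f ` W = \<tau> \<inter> ?B"
    using f(4) imW by (force simp: image_image)
  finally obtain O' where O': "openin (cw_top X) O'" "\<tau> \<inter> ?B = O' \<inter> cl \<tau>"
    by (auto simp: openin_subtopology)
  have "\<tau> \<inter> ?B = \<tau> \<inter> O'"
    using O'(2) cell_subset_closure[OF \<tau>] by blast
  then have "openin (subtopology (cw_top X) \<tau>) (\<tau> \<inter> ?B)"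
    using O'(1) openin_subtopology_Int2 by metis
  moreover have "closedin (subtopology (cw_top X) \<tau>) (\<tau> \<inter> ?B)"
    using closedin_bd[OF \<sigma>] closedin_subtopology_Int_closed by blast
  moreover have "connected_space (subtopology (cw_top X) \<tau>)"
    using connectedin_cell[OF \<tau>] by (simp add: connectedin_def)
  ultimately have "\<tau> \<inter> ?B = topspace (subtopology (cw_top X) \<tau>)"
    using meet unfolding connected_space_clopen_in by blast
  then show ?thesis using cell_subset_topspace[OF \<tau>] by auto
qed

text \<open>A face position is by definition the full preimage of a cell inside the boundary, so its
  image recovers that cell and the third component carries no further choice. An occurrence amounts
  to a pair of cells.\<close>

lemma occurrence_iff:
  "(\<sigma>, \<tau>, \<iota>) \<in> occurrences X k \<longleftrightarrow>
     1 \<le> k \<and> \<sigma> \<in> cw_cells X k \<and> \<tau> \<in> cw_cells X (k - 1) \<and> \<tau> \<subseteq> bd k \<sigma> \<and>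
     \<iota> = {x \<in> sphere_points k. cw_char X \<sigma> x \<in> \<tau>}" (is "?L \<longleftrightarrow> ?R")
proof
  have im: "cw_char X \<sigma> ` {x \<in> sphere_points k. cw_char X \<sigma> x \<in> \<rho>} = \<rho>" if "\<rho> \<subseteq> bd k \<sigma>" for \<rho>
    using that by blast
  show ?R if ?L
    using that im by (force simp: occurrences_def face_positions_def)
  show ?L if ?R
    using that im by (auto simp: occurrences_def face_positions_def)
qed

text \<open>Descent in dimension: a point of the boundary lies in the closure of some codimension
  one face, that face is joined to \<open>\<sigma>\<close> by an occurrence, and the induction
  continues from the face.\<close>

lemma related_to_closure_if_occurrence_invariant:
  assumes P: "\<And>k \<sigma> \<tau> \<iota>. (\<sigma>, \<tau>, \<iota>) \<in> occurrences X k \<Longrightarrow> P k \<sigma> \<longleftrightarrow> P (k - 1) \<tau>"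
    and "\<sigma> \<in> cw_cells X k" "\<tau> \<in> cw_cells X l" "\<tau> \<inter> cl \<sigma> \<noteq> {}"
  shows "P k \<sigma> \<longleftrightarrow> P l \<tau>"
  using assms(2-)
proof (induction k arbitrary: \<sigma>)
  case 0
  \<comment> \<open>The defining sum is empty, hence 0 and never 1: a vertex has no
    boundary.\<close>
  have "sphere_points 0 = {}" by (auto simp: sphere_points_def)
  then have "cl \<sigma> = \<sigma>" using closure_cell[OF 0(1)] by simp
  then show ?case using 0 cells_eq by blast
next
  case (Suc n)
  show ?case
  proof (cases "\<tau> \<inter> \<sigma> = {}")
    case False
    then show ?thesis using Suc.prems cells_eq by blast
  next
    case True
    then obtain x where x: "x \<in> \<tau>" "x \<in> bd (Suc n) \<sigma>"
      using Suc.prems closure_cell by blast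
    obtain \<rho> where \<rho>: "\<rho> \<in> cw_cells X n" "\<rho> \<inter> bd (Suc n) \<sigma> \<noteq> {}" "x \<in> cl \<rho>"
      using bd_subset_faces_closure[OF Suc.prems(1) x(2)] by blast
    have "(\<sigma>, \<rho>, {x \<in> sphere_points (Suc n). cw_char X \<sigma> x \<in> \<rho>}) \<in> occurrences X (Suc n)"
      using \<rho> Suc.prems(1) cell_subset_bd[OF Suc.prems(1) \<rho>(1,2)] by (simp add: occurrence_iff)
    from P[OF this] have "P (Suc n) \<sigma> \<longleftrightarrow> P n \<rho>" by simp
    also have "\<dots> \<longleftrightarrow> P l \<tau>"
      using Suc.IH[OF \<rho>(1) Suc.prems(2)] x \<rho> by blast
    finally show ?thesis .
  qed
qed

text \<open>The cells with \<open>P\<close> and the cells without \<open>P\<close> split the space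
  into two disjoint closed sets, so topological connectedness leaves only one kind.\<close>

lemma connected_occurrence_graph:
  assumes lf: "locally_finite_cw X" and conn: "connected_space (cw_top X)"
    and P: "\<And>k \<sigma> \<tau> \<iota>. (\<sigma>, \<tau>, \<iota>) \<in> occurrences X k \<Longrightarrow> P k \<sigma> \<longleftrightarrow> P (k - 1) \<tau>"
    and \<sigma>0: "\<sigma>0 \<in> cw_cells X k0" "P k0 \<sigma>0" and \<sigma>: "\<sigma> \<in> cw_cells X k"
  shows "P k \<sigma>"
proof -
  \<comment> \<open>Stated for an arbitrary invariant \<open>Q\<close> so as to serve both
    \<open>P\<close> and its negation. Local finiteness makes the union of the closures closed, and
    the preceding lemma shows that taking closures adds no cell of the other kind.\<close>
  have closed: "closedin (cw_top X) (\<Union>{\<sigma>. \<exists>k. \<sigma> \<in> cw_cells X k \<and> Q k \<sigma>})"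
    if Q: "\<And>k \<sigma> \<tau> \<iota>. (\<sigma>, \<tau>, \<iota>) \<in> occurrences X k \<Longrightarrow> Q k \<sigma> \<longleftrightarrow> Q (k - 1) \<tau>" for Q
  proof -
    let ?A = "{\<sigma>. \<exists>k. \<sigma> \<in> cw_cells X k \<and> Q k \<sigma>}"
    have "locally_finite_in (cw_top X) ?A"
      by (rule locally_finite_in_subset[OF lf[unfolded locally_finite_cw_def]]) auto
    then have "closedin (cw_top X) (\<Union>(cl ` ?A))"
      by (rule closedin_Union_locally_finite_closure)
    also have "\<Union>(cl ` ?A) = \<Union>?A"
    proof (intro equalityI subsetI)
      fix x assume "x \<in> \<Union>(cl ` ?A)"
      then obtain \<sigma> k where s: "\<sigma> \<in> cw_cells X k" "Q k \<sigma>" "x \<in> cl \<sigma>" by blast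
      then have "x \<in> topspace (cw_top X)" by (meson in_closure_of)
      then obtain l \<tau> where t: "\<tau> \<in> cw_cells X l" "x \<in> \<tau>" unfolding topspace_cells by blast
      have "Q k \<sigma> \<longleftrightarrow> Q l \<tau>"
      proof (rule related_to_closure_if_occurrence_invariant[where P = Q, OF _ s(1) t(1)])
        show "Q k' \<sigma>' = Q (k' - 1) \<tau>'" if "(\<sigma>', \<tau>', \<iota>') \<in> occurrences X k'" for k' \<sigma>' \<tau>' \<iota>'
          using Q[OF that] .
      qed (use s t in blast)
      then show "x \<in> \<Union>?A" using s t by blast
    qed (use cell_subset_closure in blast)
    finally show ?thesis .
  qed
  let ?A = "\<Union>{\<sigma>. \<exists>k. \<sigma> \<in> cw_cells X k \<and> P k \<sigma>}"
  let ?B = "\<Union>{\<sigma>. \<exists>k. \<sigma> \<in> cw_cells X k \<and> \<not> P k \<sigma>}"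
  have "closedin (cw_top X) ?A"
    by (rule closed) (rule P)
  moreover have "closedin (cw_top X) ?B"
    by (rule closed) (use P in blast)
  moreover have "?A \<union> ?B = topspace (cw_top X)"
    unfolding topspace_cells by blast
  moreover have "?A \<inter> ?B = {}"
    using cells_eq by blast
  moreover have "?A \<noteq> {}"
    using \<sigma>0 cell_nonempty by blast
  ultimately have "?B = {}"
    using conn unfolding connected_space_closedin_eq by blast
  then show ?thesis using \<sigma> cell_nonempty by blast
qed

text \<open>A neighbourhood of a single point of \<open>\<tau>\<close> meets every cell whose
  closure contains \<open>\<tau>\<close>, and it can be chosen to meet only finitely many
  cells.\<close>

lemma finite_cofaces:
  assumes lf: "locally_finite_cw X" and \<tau>: "\<tau> \<in> cw_cells X l"
  shows "finite {\<sigma> \<in> cw_cells X k. \<tau> \<subseteq> cl \<sigma>}"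
proof -
  obtain x where x: "x \<in> \<tau>" using cell_nonempty[OF \<tau>] by blast
  then have "x \<in> topspace (cw_top X)" using cell_subset_topspace[OF \<tau>] by blast
  then obtain V where V: "openin (cw_top X) V" "x \<in> V" "finite {\<sigma> \<in> (\<Union>k. cw_cells X k). \<sigma> \<inter> V \<noteq> {}}"
    using lf unfolding locally_finite_cw_def locally_finite_in_def by blast
  have "\<sigma> \<inter> V \<noteq> {}" if "\<tau> \<subseteq> cl \<sigma>" for \<sigma>
    using that x V(1,2) openin_Int_closure_of_eq_empty[OF V(1), of \<sigma>] by blast
  then show ?thesis
    by (intro finite_subset[OF _ V(3)]) blast
qed

text \<open>With the upper cell fixed, an occurrence is determined by its lower cell, which meets
  the closure of the upper one; closure finiteness applies. The corresponding bound over a lower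
  cell comes from local finiteness instead.\<close>

lemma finite_occurrences_over_upper:
  assumes "\<sigma> \<in> cw_cells X k"
  shows "finite {o' \<in> occurrences X k. occ_upper o' = \<sigma>}"
proof -
  have "{o' \<in> occurrences X k. occ_upper o' = \<sigma>} \<subseteq>
      (\<lambda>\<tau>. (\<sigma>, \<tau>, {x \<in> sphere_points k. cw_char X \<sigma> x \<in> \<tau>})) `
        {\<tau> \<in> (\<Union>l. cw_cells X l). \<tau> \<inter> cl \<sigma> \<noteq> {}}"
  proof
    fix q assume q: "q \<in> {o' \<in> occurrences X k. occ_upper o' = \<sigma>}"
    obtain \<sigma>' \<tau> \<iota> where q': "q = (\<sigma>', \<tau>, \<iota>)" using prod_cases3 by blast
    then have "\<sigma>' = \<sigma>" using q by (simp add: occ_upper_def)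
    then have *: "\<tau> \<in> cw_cells X (k - 1)" "\<tau> \<subseteq> bd k \<sigma>" "\<iota> = {x \<in> sphere_points k. cw_char X \<sigma> x \<in> \<tau>}"
      using q q' by (simp_all add: occurrence_iff)
    then have "\<tau> \<inter> cl \<sigma> \<noteq> {}"
      using cell_nonempty[OF *(1)] closure_cell[OF assms] by blast
    then show "q \<in> (\<lambda>\<tau>. (\<sigma>, \<tau>, {x \<in> sphere_points k. cw_char X \<sigma> x \<in> \<tau>})) `
        {\<tau> \<in> (\<Union>l. cw_cells X l). \<tau> \<inter> cl \<sigma> \<noteq> {}}"
      unfolding q' \<open>\<sigma>' = \<sigma>\<close> *(3) using *(1) by (intro imageI) blast
  qed
  then show ?thesis
    using finite_cells_meeting_closure[OF assms] finite_surj by blast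
qed

lemma finite_occurrences_over_lower:
  assumes "locally_finite_cw X" "\<tau> \<in> cw_cells X (k - 1)"
  shows "finite {o' \<in> occurrences X k. occ_lower o' = \<tau>}"
proof -
  have "{o' \<in> occurrences X k. occ_lower o' = \<tau>} \<subseteq>
      (\<lambda>\<sigma>. (\<sigma>, \<tau>, {x \<in> sphere_points k. cw_char X \<sigma> x \<in> \<tau>})) `
        {\<sigma> \<in> cw_cells X k. \<tau> \<subseteq> cl \<sigma>}"
  proof
    fix q assume q: "q \<in> {o' \<in> occurrences X k. occ_lower o' = \<tau>}"
    obtain \<sigma> \<tau>' \<iota> where q': "q = (\<sigma>, \<tau>', \<iota>)" using prod_cases3 by blast
    then have "\<tau>' = \<tau>" using q by (simp add: occ_lower_def)
    then have *: "\<sigma> \<in> cw_cells X k" "\<tau> \<subseteq> bd k \<sigma>" "\<iota> = {x \<in> sphere_points k. cw_char X \<sigma> x \<in> \<tau>}"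
      using q q' by (simp_all add: occurrence_iff)
    then show "q \<in> (\<lambda>\<sigma>. (\<sigma>, \<tau>, {x \<in> sphere_points k. cw_char X \<sigma> x \<in> \<tau>})) `
        {\<sigma> \<in> cw_cells X k. \<tau> \<subseteq> cl \<sigma>}"
      unfolding q' \<open>\<tau>' = \<tau>\<close> *(3) using closure_cell[OF *(1)] by (intro imageI) blast
  qed
  then show ?thesis
    using finite_cofaces[OF assms] finite_surj by blast
qed

text \<open>A cell of least dimension has no room for its boundary: if that dimension were positive,
  the boundary would be nonempty and lie in cells of smaller dimension.\<close>

lemma vertex_exists:
  assumes "topspace (cw_top X) \<noteq> {}"
  shows "cw_cells X 0 \<noteq> {}"
proof -
  have "\<exists>k. cw_cells X k \<noteq> {}" using assms topspace_cells by auto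
  then obtain k where k: "cw_cells X k \<noteq> {}" "\<And>l. l < k \<Longrightarrow> cw_cells X l = {}"
    using exists_least_iff[of "\<lambda>k. cw_cells X k \<noteq> {}"] by auto
  then obtain \<sigma> where \<sigma>: "\<sigma> \<in> cw_cells X k" by blast
  have "k = 0"
  proof (rule ccontr)
    assume "k \<noteq> 0"
    \<comment> \<open>The first unit vector witnesses that the sphere is nonempty for positive
      \<open>k\<close>.\<close>
    have "(\<Sum>i<k. ((\<lambda>i. if i = 0 then 1 else 0 :: real) i)\<^sup>2) = (\<Sum>i<k. if i = 0 then 1 else 0)"
      by (intro sum.cong) auto
    also have "\<dots> = 1" using \<open>k \<noteq> 0\<close> by simp
    finally have "(\<lambda>i. if i = 0 then 1 else 0) \<in> sphere_points k"
      using \<open>k \<noteq> 0\<close> by (auto simp: sphere_points_def topspace_Euclidean_space)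
    then show False using bd_lower[OF \<sigma>] k(2) by blast
  qed
  then show ?thesis using k by simp
qed

lemma vertex_is_point:
  assumes "\<sigma> \<in> cw_cells X 0"
  obtains p where "\<sigma> = {p}" "p \<in> topspace (cw_top X)"
proof -
  have "open_ball_points 0 = {\<lambda>_. 0}"
    by (auto simp: open_ball_points_def topspace_Euclidean_space)
  then have "\<sigma> = {cw_char X \<sigma> (\<lambda>_. 0)}"
    using char_open_ball[OF assms] by simp
  then show thesis
    using cell_subset_topspace[OF assms] that by blast
qed

end

section \<open>Cores and profinite completions\<close>

context group
begin

definition subgroups_upto :: "nat \<Rightarrow> 'a set set" where
  "subgroups_upto m = {L. subgroup L G \<and> finite (rcosets L) \<and> card (rcosets L) \<le> m}"

lemma Kcore_eq: "Kcore G m = \<Inter>(subgroups_upto m)"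
  by (simp add: Kcore_def subgroups_upto_def)

lemma rcosets_cases:
  assumes "C \<in> rcosets L"
  obtains a where "a \<in> carrier G" "C = L #> a"
  using assms by (auto simp: RCOSETS_def)

lemma rcosets_r_coset:
  assumes "subgroup L G" "C \<in> rcosets L" "g \<in> carrier G"
  shows "C #> g \<in> rcosets L"
proof -
  obtain a where a: "a \<in> carrier G" "C = L #> a" using assms(2) by (rule rcosets_cases)
  then have "C #> g = L #> (a \<otimes> g)"
    using assms(1,3) by (simp add: coset_mult_assoc subgroup.subset)
  then show ?thesis
    using a assms by (simp add: rcosetsI subgroup.subset)
qed

lemma rcosets_subset_carrier: "subgroup L G \<Longrightarrow> C \<in> rcosets L \<Longrightarrow> C \<subseteq> carrier G"
  using r_coset_subset_G[OF subgroup.subset] by (elim rcosets_cases) simp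

lemma r_coset_self: "subgroup L G \<Longrightarrow> g \<in> carrier G \<Longrightarrow> g \<in> L #> g"
  by (rule rcos_self)

lemma r_coset_eqI:
  assumes "subgroup L G" "a \<in> carrier G" "b \<in> L #> a"
  shows "L #> b = L #> a"
  using repr_independence[OF assms(3,2,1)] by simp

lemma subgroup_mem_iff_coset:
  assumes "subgroup L G" "g \<in> carrier G"
  shows "g \<in> L \<longleftrightarrow> L #> g = L"
  using coset_join1[OF _ assms(2,1)] coset_join2[OF assms(2,1)] by (rule iffI[rotated])

text \<open>A subgroup of bounded index is determined by the action of a finite generating set on its
  numbered cosets, and there are finitely many such actions.\<close>

definition coset_graph :: "('a set \<Rightarrow> nat) \<Rightarrow> 'a set \<Rightarrow> 'a \<Rightarrow> (nat \<times> nat) set" where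
  "coset_graph f L g = {(f C, f (C #> g)) | C. C \<in> rcosets L}"

lemma coset_graph_one:
  assumes "subgroup L G"
  shows "coset_graph f L \<one> = Id_on (f ` (rcosets L))"
  using coset_mult_one rcosets_subset_carrier[OF assms]
  by (force simp: coset_graph_def Id_on_def)

text \<open>Cosets are translated from the right, so graphs compose in the same order as the
  factors. Injectivity of the numbering identifies the intermediate coset.\<close>

lemma coset_graph_mult:
  assumes L: "subgroup L G" and f: "inj_on f (rcosets L)" and g: "g \<in> carrier G" and h: "h \<in> carrier G"
  shows "coset_graph f L (g \<otimes> h) = coset_graph f L g O coset_graph f L h"
proof -
  have *: "C #> g #> h = C #> (g \<otimes> h)" if "C \<in> rcosets L" for C
    using coset_mult_assoc rcosets_subset_carrier[OF L that] g h by blast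
  show ?thesis
  proof (intro equalityI subsetI)
    fix p assume "p \<in> coset_graph f L (g \<otimes> h)"
    then obtain C where C: "C \<in> rcosets L" "p = (f C, f (C #> g #> h))"
      using * by (auto simp: coset_graph_def)
    then show "p \<in> coset_graph f L g O coset_graph f L h"
      using rcosets_r_coset[OF L C(1) g] unfolding coset_graph_def by blast
  next
    fix p assume "p \<in> coset_graph f L g O coset_graph f L h"
    then obtain C D where C: "C \<in> rcosets L" "D \<in> rcosets L" "f D = f (C #> g)" "p = (f C, f (D #> h))"
      by (auto simp: coset_graph_def)
    then have "D = C #> g"
      using f rcosets_r_coset[OF L C(1) g] by (auto dest: inj_onD)
    then have "p = (f C, f (C #> (g \<otimes> h)))"
      using C(1,4) * by simp
    then show "p \<in> coset_graph f L (g \<otimes> h)"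
      using C(1) unfolding coset_graph_def by blast
  qed
qed

lemma coset_graph_inv:
  assumes L: "subgroup L G" and g: "g \<in> carrier G"
  shows "coset_graph f L (inv g) = (coset_graph f L g)\<inverse>"
proof -
  have *: "C #> g #> inv g = C" "C #> inv g #> g = C" if "C \<in> rcosets L" for C
    using rcosets_subset_carrier[OF L that] g by (simp_all add: coset_mult_assoc coset_mult_one)
  show ?thesis
  proof (intro equalityI subsetI)
    fix p assume "p \<in> coset_graph f L (inv g)"
    then obtain C where C: "C \<in> rcosets L" "p = (f C, f (C #> inv g))"
      by (auto simp: coset_graph_def)
    moreover have "C #> inv g \<in> rcosets L"
      using rcosets_r_coset[OF L C(1)] g by simp
    ultimately show "p \<in> (coset_graph f L g)\<inverse>"
      using * unfolding coset_graph_def by force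
  next
    fix p assume "p \<in> (coset_graph f L g)\<inverse>"
    then obtain C where C: "C \<in> rcosets L" "p = (f (C #> g), f C)"
      by (auto simp: coset_graph_def)
    then show "p \<in> coset_graph f L (inv g)"
      using rcosets_r_coset[OF L C(1) g] * unfolding coset_graph_def by force
  qed
qed

lemma finite_subgroups_upto:
  assumes fg: "finitely_generated_group G"
  shows "finite (subgroups_upto m)"
proof -
  obtain S where S: "finite S" "S \<subseteq> carrier G" "generate G S = carrier G"
    using fg by (auto simp: finitely_generated_group_def)
  have "\<exists>f. inj_on f (rcosets L) \<and> f ` (rcosets L) \<subseteq> {..<m}" if "L \<in> subgroups_upto m" for L
    using that card_le_inj[of "rcosets L" "{..<m}"] by (auto simp: subgroups_upto_def)
  then obtain f where f: "\<And>L. L \<in> subgroups_upto m \<Longrightarrow> inj_on (f L) (rcosets L)"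
      "\<And>L. L \<in> subgroups_upto m \<Longrightarrow> f L ` (rcosets L) \<subseteq> {..<m}"
    by metis
  \<comment> \<open>The code of \<open>L\<close> keeps the number of the trivial coset, the set of
    numbers in use (the graph of the identity), and the graphs of the generators. All of this ranges
    over a finite set.\<close>
  define code where "code L = (f L L, f L ` (rcosets L),
      {(s, p). s \<in> S \<and> p \<in> coset_graph (f L) L s})" for L
  have sub: "subgroup L G" if "L \<in> subgroups_upto m" for L
    using that by (simp add: subgroups_upto_def)
  have self: "L \<in> rcosets L" if "L \<in> subgroups_upto m" for L
    using rcosetsI[OF subgroup.subset[OF sub[OF that]], of \<one>] subgroup.subset[OF sub[OF that]]
    by (simp add: coset_mult_one)
  have "code ` subgroups_upto m \<subseteq> {..<m} \<times> Pow {..<m} \<times> Pow (S \<times> {..<m} \<times> {..<m})"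
  proof
    fix c assume "c \<in> code ` subgroups_upto m"
    then obtain L where L: "L \<in> subgroups_upto m" "c = code L" by blast
    have "coset_graph (f L) L s \<subseteq> {..<m} \<times> {..<m}" if "s \<in> S" for s
      using f(2)[OF L(1)] rcosets_r_coset[OF sub[OF L(1)]] that S(2) unfolding coset_graph_def by blast
    then show "c \<in> {..<m} \<times> Pow {..<m} \<times> Pow (S \<times> {..<m} \<times> {..<m})"
      using f(2)[OF L(1)] self[OF L(1)] unfolding L(2) code_def by blast
  qed
  then have "finite (code ` subgroups_upto m)"
    by (rule finite_subset) (use S(1) in auto)
  moreover have "inj_on code (subgroups_upto m)"
  proof (rule inj_onI)
    fix L M assume L: "L \<in> subgroups_upto m" and M: "M \<in> subgroups_upto m" and eq: "code L = code M"
    have gens: "coset_graph (f L) L s = coset_graph (f M) M s" if "s \<in> S" for s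
    proof -
      have "{(s, p). s \<in> S \<and> p \<in> coset_graph (f L) L s} = {(s, p). s \<in> S \<and> p \<in> coset_graph (f M) M s}"
        using eq by (simp add: code_def)
      from arg_cong[OF this, of "\<lambda>R. R `` {s}"] show ?thesis
        using that by (simp add: Image_def)
    qed
    have gr: "coset_graph (f L) L g = coset_graph (f M) M g" if "g \<in> generate G S" for g
      using that
    proof (induction g rule: generate.induct)
      case one
      then show ?case using eq by (simp add: coset_graph_one sub L M code_def)
    next
      case (incl s)
      then show ?case by (rule gens)
    next
      case (inv s)
      then show ?case using gens[OF inv] S(2) by (simp add: coset_graph_inv sub L M subset_iff)
    next
      case (eng g h)
      then show ?case using S(3) by (simp add: coset_graph_mult sub L M f)
    qed
    \<comment> \<open>A subgroup is the stabilizer of its trivial coset, so membership can be read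
      off from the graph of \<open>g\<close> and the number of that coset.\<close>
    have mem: "g \<in> H \<longleftrightarrow> (f H H, f H H) \<in> coset_graph (f H) H g"
      if H: "H \<in> subgroups_upto m" and g: "g \<in> carrier G" for H g
    proof -
      have "(f H H, f H H) \<in> coset_graph (f H) H g \<longleftrightarrow> H #> g = H"
      proof
        assume "(f H H, f H H) \<in> coset_graph (f H) H g"
        then obtain C where C: "C \<in> rcosets H" "f H C = f H H" "f H (C #> g) = f H H"
          by (auto simp: coset_graph_def)
        then have "C = H" using inj_onD[OF f(1)[OF H]] self[OF H] by blast
        then show "H #> g = H"
          using inj_onD[OF f(1)[OF H] C(3)] rcosets_r_coset[OF sub[OF H] C(1) g] self[OF H] by simp
      next
        assume "H #> g = H"
        then show "(f H H, f H H) \<in> coset_graph (f H) H g"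
          using self[OF H] unfolding coset_graph_def by force
      qed
      then show ?thesis
        using subgroup_mem_iff_coset[OF sub[OF H] g] by simp
    qed
    have "f L L = f M M" using eq by (simp add: code_def)
    then have "g \<in> L \<longleftrightarrow> g \<in> M" if "g \<in> carrier G" for g
      using mem[OF L that] mem[OF M that] gr that S(3) by simp
    then show "L = M"
      using subgroup.subset[OF sub[OF L]] subgroup.subset[OF sub[OF M]] by blast
  qed
  ultimately show ?thesis using finite_imageD by blast
qed

lemma carrier_in_subgroups_upto:
  assumes "m \<ge> 1"
  shows "carrier G \<in> subgroups_upto m"
proof -
  have "rcosets (carrier G) \<subseteq> {carrier G}"
    using coset_join2[OF _ subgroup_self] by (auto elim!: rcosets_cases)
  then have "finite (rcosets (carrier G))" "card (rcosets (carrier G)) \<le> card {carrier G}"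
    by (auto intro: finite_subset card_mono simp del: card_insert_disjoint)
  then show ?thesis
    using assms subgroup_self by (simp add: subgroups_upto_def)
qed

text \<open>A coset of the intersection is the intersection of the cosets with the same
  representative, so it is determined by a choice of one coset for each of the finitely many
  subgroups.\<close>

lemma finite_index_Inter:
  assumes "finite \<L>" "\<L> \<noteq> {}" "\<And>L. L \<in> \<L> \<Longrightarrow> subgroup L G \<and> finite (rcosets L)"
  shows "finite (rcosets (\<Inter>\<L>))"
proof -
  \<comment> \<open>The restricted function inside the intersection is the element of the finite
    product that encodes the coset.\<close>
  have eq: "\<Inter>\<L> #> a = (\<Inter>L\<in>\<L>. (\<lambda>L\<in>\<L>. L #> a) L)" if a: "a \<in> carrier G" for a
  proof (intro equalityI subsetI)
    fix b assume b: "b \<in> (\<Inter>L\<in>\<L>. (\<lambda>L\<in>\<L>. L #> a) L)"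
    obtain L0 where L0: "L0 \<in> \<L>" using assms(2) by blast
    have bG: "b \<in> carrier G"
      using b L0 assms(3)[OF L0] r_coset_subset_G[OF subgroup.subset a] by fastforce
    have "b \<otimes> inv a \<in> L" if "L \<in> \<L>" for L
    proof -
      have "b \<in> L #> a" using b that by auto
      then obtain l where "l \<in> L" "b = l \<otimes> a" by (auto simp: r_coset_def)
      moreover then have "l \<in> carrier G" using assms(3)[OF that] subgroup.mem_carrier by metis
      ultimately show ?thesis using a by (simp add: m_assoc)
    qed
    then have "b \<otimes> inv a \<in> \<Inter>\<L>" by blast
    then have "b \<otimes> inv a \<otimes> a \<in> \<Inter>\<L> #> a" unfolding r_coset_def by blast
    then show "b \<in> \<Inter>\<L> #> a" using a bG by (simp add: m_assoc)
  next
    fix b assume "b \<in> \<Inter>\<L> #> a"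
    then obtain c where "c \<in> \<Inter>\<L>" "b = c \<otimes> a" unfolding r_coset_def by blast
    then show "b \<in> (\<Inter>L\<in>\<L>. (\<lambda>L\<in>\<L>. L #> a) L)"
      unfolding r_coset_def by auto
  qed
  have "rcosets (\<Inter>\<L>) \<subseteq> (\<lambda>c. \<Inter>L\<in>\<L>. c L) ` (\<Pi>\<^sub>E L\<in>\<L>. rcosets L)"
  proof (intro subsetI)
    fix C assume "C \<in> rcosets (\<Inter>\<L>)"
    then obtain a where a: "a \<in> carrier G" "C = \<Inter>\<L> #> a" by (elim rcosets_cases)
    have "(\<lambda>L\<in>\<L>. L #> a) \<in> (\<Pi>\<^sub>E L\<in>\<L>. rcosets L)"
      using assms(3) a(1) by (simp add: PiE_iff rcosetsI subgroup.subset)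
    then show "C \<in> (\<lambda>c. \<Inter>L\<in>\<L>. c L) ` (\<Pi>\<^sub>E L\<in>\<L>. rcosets L)"
      unfolding a(2) eq[OF a(1)] by (rule imageI)
  qed
  moreover have "finite (\<Pi>\<^sub>E L\<in>\<L>. rcosets L)"
    using assms by (intro finite_PiE) auto
  ultimately show ?thesis by (rule finite_surj[rotated])
qed

text \<open>The cosets of a conjugate are left translates of the cosets of \<open>L\<close>, so
  conjugation does not raise the index. Hence the family intersected in \<open>Kcore\<close> is
  stable under conjugation, which makes \<open>Kcore\<close> normal.\<close>

lemma conjugate_in_subgroups_upto:
  assumes L: "L \<in> subgroups_upto m" and x: "x \<in> carrier G"
  shows "{g \<in> carrier G. x \<otimes> g \<otimes> inv x \<in> L} \<in> subgroups_upto m" (is "?C \<in> _")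
proof -
  have sub: "subgroup L G" using L by (simp add: subgroups_upto_def)
  have cancel: "inv x \<otimes> (x \<otimes> b) = b" "x \<otimes> (inv x \<otimes> b) = b" if "b \<in> carrier G" for b
    using x that by (simp_all flip: m_assoc)
  have C: "subgroup ?C G"
  proof
    fix g h assume gh: "g \<in> ?C" "h \<in> ?C"
    then have "x \<otimes> (g \<otimes> h) \<otimes> inv x = (x \<otimes> g \<otimes> inv x) \<otimes> (x \<otimes> h \<otimes> inv x)"
      using x by (simp add: m_assoc cancel)
    then show "g \<otimes> h \<in> ?C"
      using gh subgroup.m_closed[OF sub] by simp
  next
    show "\<one> \<in> ?C" using x subgroup.one_closed[OF sub] by simp
  next
    fix g assume g: "g \<in> ?C"
    then have "x \<otimes> inv g \<otimes> inv x = inv (x \<otimes> g \<otimes> inv x)"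
      using x by (simp add: m_assoc inv_mult_group)
    then show "inv g \<in> ?C"
      using g subgroup.m_inv_closed[OF sub] by simp
  qed auto
  have "?C #> a = (\<lambda>b. inv x \<otimes> b) ` (L #> (x \<otimes> a))" if a: "a \<in> carrier G" for a
  proof (intro equalityI subsetI)
    fix b assume "b \<in> ?C #> a"
    then obtain g where g: "g \<in> carrier G" "x \<otimes> g \<otimes> inv x \<in> L" "b = g \<otimes> a" by (auto simp: r_coset_def)
    then have "b = inv x \<otimes> ((x \<otimes> g \<otimes> inv x) \<otimes> (x \<otimes> a))"
      using x a by (simp add: m_assoc cancel)
    then show "b \<in> (\<lambda>b. inv x \<otimes> b) ` (L #> (x \<otimes> a))"
      using g by (auto simp: r_coset_def)
  next
    fix b assume "b \<in> (\<lambda>b. inv x \<otimes> b) ` (L #> (x \<otimes> a))"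
    then obtain l where l: "l \<in> L" "b = inv x \<otimes> (l \<otimes> (x \<otimes> a))" by (auto simp: r_coset_def)
    then have lG: "l \<in> carrier G" using subgroup.mem_carrier[OF sub] by blast
    have b: "(inv x \<otimes> l \<otimes> x) \<otimes> a = b" using l lG x a by (simp add: m_assoc)
    have "x \<otimes> (inv x \<otimes> l \<otimes> x) \<otimes> inv x = l"
      using lG x by (simp add: m_assoc cancel)
    then have "inv x \<otimes> l \<otimes> x \<in> ?C" using l lG x by simp
    then show "b \<in> ?C #> a"
      unfolding r_coset_def b[symmetric] by blast
  qed
  then have surj: "rcosets ?C \<subseteq> (\<lambda>D. (\<lambda>b. inv x \<otimes> b) ` D) ` (rcosets L)"
    using x by (auto elim!: rcosets_cases intro!: imageI rcosetsI subgroup.subset sub)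
  have fin: "finite (rcosets L)" "card (rcosets L) \<le> m"
    using L by (simp_all add: subgroups_upto_def)
  then have "finite (rcosets ?C)" "card (rcosets ?C) \<le> card (rcosets L)"
    using finite_surj[OF _ surj] surj_card_le[OF _ surj] by simp_all
  then show ?thesis
    using C fin by (simp add: subgroups_upto_def)
qed

text \<open>Finite generation enters here: only finitely many subgroups are intersected, so the
  index stays finite. As a result, an element of the completion has a genuine coordinate at
  \<open>Kcore G m\<close>.\<close>

lemma Kcore_fin_index_normal:
  assumes fg: "finitely_generated_group G" and m: "m \<ge> 1"
  shows "Kcore G m \<in> fin_index_normals G"
proof -
  have ne: "subgroups_upto m \<noteq> {}" using carrier_in_subgroups_upto[OF m] by blast
  have "subgroup (Kcore G m) G"
    unfolding Kcore_eq using ne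
    by (intro subgroups_Inter) (auto simp: subgroups_upto_def)
  moreover have "x \<otimes> h \<otimes> inv x \<in> Kcore G m" if x: "x \<in> carrier G" and h: "h \<in> Kcore G m" for x h
    unfolding Kcore_eq using conjugate_in_subgroups_upto[OF _ x] h unfolding Kcore_eq by blast
  ultimately have "Kcore G m \<lhd> G"
    by (simp add: normal_inv_iff)
  moreover have "finite (rcosets (Kcore G m))"
    unfolding Kcore_eq using ne finite_subgroups_upto[OF fg]
    by (intro finite_index_Inter) (auto simp: subgroups_upto_def)
  ultimately show ?thesis by (simp add: fin_index_normals_def)
qed

end

lemma Kcore_antimono: "m \<le> n \<Longrightarrow> Kcore G n \<subseteq> Kcore G m"
  by (auto simp: Kcore_def)

text \<open>Cofinality of the cores: \<open>N\<close> is itself one of the subgroups intersected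
  once \<open>m\<close> reaches its index. The maximum with 1 keeps \<open>m\<close> in the range of
  levels used by the completed spaces.\<close>

lemma Kcore_subset_fin_index:
  assumes "N \<in> fin_index_normals G"
  obtains m where "m \<ge> 1" "Kcore G m \<subseteq> N"
proof -
  have "Kcore G (max 1 (card (rcosets\<^bsub>G\<^esub> N))) \<subseteq> N"
    using assms by (auto simp: Kcore_def fin_index_normals_def normal_imp_subgroup)
  then show thesis by (rule that[rotated]) simp
qed

section \<open>The profinite completion as a group and the canonical map into it\<close>

definition completion_embedding :: "('g, 'm) monoid_scheme \<Rightarrow> 'g \<Rightarrow> 'g set \<Rightarrow> 'g set" where
  "completion_embedding G g = (\<lambda>N \<in> fin_index_normals G. N #>\<^bsub>G\<^esub> g)"

context group
begin

lemma fin_index_normals_normal: "N \<in> fin_index_normals G \<Longrightarrow> N \<lhd> G"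
  by (simp add: fin_index_normals_def)

lemma fin_index_normals_subgroup: "N \<in> fin_index_normals G \<Longrightarrow> subgroup N G"
  by (simp add: fin_index_normals_def normal_imp_subgroup)

lemma completion_memD:
  assumes "x \<in> carrier (profinite_completion G)" "N \<in> fin_index_normals G"
  obtains g where "g \<in> carrier G" "x N = N #> g"
proof -
  have "x N \<in> rcosets N"
    using assms by (auto simp: profinite_completion_def PiE_iff FactGroup_def)
  then show thesis using that by (elim rcosets_cases)
qed

lemma completion_mono:
  "x \<in> carrier (profinite_completion G) \<Longrightarrow> N \<in> fin_index_normals G \<Longrightarrow> M \<in> fin_index_normals G \<Longrightarrow>
    N \<subseteq> M \<Longrightarrow> x N \<subseteq> x M"
  by (simp add: profinite_completion_def)

lemma completion_memI:
  assumes "x \<in> extensional (fin_index_normals G)"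
    and "\<And>N. N \<in> fin_index_normals G \<Longrightarrow> \<exists>g \<in> carrier G. x N = N #> g"
    and "\<And>N M. N \<in> fin_index_normals G \<Longrightarrow> M \<in> fin_index_normals G \<Longrightarrow> N \<subseteq> M \<Longrightarrow> x N \<subseteq> x M"
  shows "x \<in> carrier (profinite_completion G)"
proof -
  have "x N \<in> carrier (G Mod N)" if N: "N \<in> fin_index_normals G" for N
  proof -
    obtain g where "g \<in> carrier G" "x N = N #> g" using assms(2)[OF N] by blast
    then show ?thesis
      by (simp add: FactGroup_def rcosetsI subgroup.subset[OF fin_index_normals_subgroup[OF N]])
  qed
  then show ?thesis
    using assms(1,3) by (simp add: profinite_completion_def PiE_iff)
qed

lemma completion_eqI:
  assumes "x \<in> carrier (profinite_completion G)" "y \<in> carrier (profinite_completion G)"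
    and "\<And>N. N \<in> fin_index_normals G \<Longrightarrow> x N = y N"
  shows "x = y"
proof (rule extensionalityI)
  show "x \<in> extensional (fin_index_normals G)" "y \<in> extensional (fin_index_normals G)"
    using assms(1,2) by (simp_all add: profinite_completion_def PiE_iff)
qed (rule assms(3))

lemma completion_mult:
  "N \<in> fin_index_normals G \<Longrightarrow> (x \<otimes>\<^bsub>profinite_completion G\<^esub> y) N = x N <#> y N"
  by (simp add: profinite_completion_def FactGroup_def)

lemma completion_one: "N \<in> fin_index_normals G \<Longrightarrow> \<one>\<^bsub>profinite_completion G\<^esub> N = N"
  by (simp add: profinite_completion_def FactGroup_def)

text \<open>The group laws are inherited from the finite quotients \<open>G Mod N\<close>. Inverses
  stay compatible because the inverse of a coset is its setwise inverse, which respects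
  inclusions.\<close>

lemma group_completion: "group (profinite_completion G)"
proof (rule groupI)
  fix x y assume x: "x \<in> carrier (profinite_completion G)" and y: "y \<in> carrier (profinite_completion G)"
  show "x \<otimes>\<^bsub>profinite_completion G\<^esub> y \<in> carrier (profinite_completion G)"
  proof (rule completion_memI)
    show "x \<otimes>\<^bsub>profinite_completion G\<^esub> y \<in> extensional (fin_index_normals G)"
      by (simp add: profinite_completion_def)
  next
    fix N assume N: "N \<in> fin_index_normals G"
    obtain g where g: "g \<in> carrier G" "x N = N #> g" using completion_memD[OF x N] .
    obtain h where h: "h \<in> carrier G" "y N = N #> h" using completion_memD[OF y N] .
    show "\<exists>g \<in> carrier G. (x \<otimes>\<^bsub>profinite_completion G\<^esub> y) N = N #> g"
      using g h N normal.rcos_sum[OF fin_index_normals_normal[OF N]]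
      by (intro bexI[of _ "g \<otimes> h"]) (simp_all add: completion_mult)
  next
    fix N M assume "N \<in> fin_index_normals G" "M \<in> fin_index_normals G" "N \<subseteq> M"
    then show "(x \<otimes>\<^bsub>profinite_completion G\<^esub> y) N \<subseteq> (x \<otimes>\<^bsub>profinite_completion G\<^esub> y) M"
      using completion_mono[OF x] completion_mono[OF y] by (simp add: completion_mult mono_set_mult)
  qed
next
  show one: "\<one>\<^bsub>profinite_completion G\<^esub> \<in> carrier (profinite_completion G)"
  proof (rule completion_memI)
    show "\<one>\<^bsub>profinite_completion G\<^esub> \<in> extensional (fin_index_normals G)"
      by (simp add: profinite_completion_def)
    show "\<exists>g\<in>carrier G. \<one>\<^bsub>profinite_completion G\<^esub> N = N #> g" if "N \<in> fin_index_normals G" for N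
      using that subgroup.subset[OF fin_index_normals_subgroup[OF that]]
      by (intro bexI[of _ \<one>]) (simp_all add: completion_one coset_mult_one)
  qed (simp add: completion_one)
  have ext: "x \<otimes>\<^bsub>profinite_completion G\<^esub> y \<in> extensional (fin_index_normals G)" for x y
    by (simp add: profinite_completion_def)
  have in_mod: "x N \<in> carrier (G Mod N)"
    if "x \<in> carrier (profinite_completion G)" "N \<in> fin_index_normals G" for x N
    using that by (auto simp: profinite_completion_def)
  have mod_group: "group (G Mod N)" if "N \<in> fin_index_normals G" for N
    using normal.factorgroup_is_group[OF fin_index_normals_normal[OF that]] .
  have m: "(x \<otimes>\<^bsub>profinite_completion G\<^esub> y) N = x N \<otimes>\<^bsub>G Mod N\<^esub> y N" if "N \<in> fin_index_normals G" for x y N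
    using that by (simp add: profinite_completion_def)
  have o: "\<one>\<^bsub>profinite_completion G\<^esub> N = \<one>\<^bsub>G Mod N\<^esub>" if "N \<in> fin_index_normals G" for N
    using that by (simp add: profinite_completion_def)
  {
    fix x y z
    assume "x \<in> carrier (profinite_completion G)" "y \<in> carrier (profinite_completion G)"
      "z \<in> carrier (profinite_completion G)"
    then show "x \<otimes>\<^bsub>profinite_completion G\<^esub> y \<otimes>\<^bsub>profinite_completion G\<^esub> z =
        x \<otimes>\<^bsub>profinite_completion G\<^esub> (y \<otimes>\<^bsub>profinite_completion G\<^esub> z)"
    proof (intro extensionalityI[OF ext ext])
      fix N assume N: "N \<in> fin_index_normals G"
      assume "x \<in> carrier (profinite_completion G)" "y \<in> carrier (profinite_completion G)"
        "z \<in> carrier (profinite_completion G)"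
      then show "(x \<otimes>\<^bsub>profinite_completion G\<^esub> y \<otimes>\<^bsub>profinite_completion G\<^esub> z) N =
          (x \<otimes>\<^bsub>profinite_completion G\<^esub> (y \<otimes>\<^bsub>profinite_completion G\<^esub> z)) N"
        unfolding m[OF N]
        by (intro Group.monoid.m_assoc[OF group.is_monoid[OF mod_group[OF N]]] in_mod N)
    qed
  next
    fix x assume x: "x \<in> carrier (profinite_completion G)"
    have "x \<in> extensional (fin_index_normals G)"
      using x by (auto simp: profinite_completion_def PiE_iff)
    then show "\<one>\<^bsub>profinite_completion G\<^esub> \<otimes>\<^bsub>profinite_completion G\<^esub> x = x"
    proof (intro extensionalityI[OF ext])
      fix N assume N: "N \<in> fin_index_normals G"
      show "(\<one>\<^bsub>profinite_completion G\<^esub> \<otimes>\<^bsub>profinite_completion G\<^esub> x) N = x N"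
        unfolding m[OF N] o[OF N]
        by (intro Group.monoid.l_one[OF group.is_monoid[OF mod_group[OF N]]] in_mod x N)
    qed
    define y where "y = (\<lambda>N \<in> fin_index_normals G. inv\<^bsub>G Mod N\<^esub> x N)"
    have y: "y \<in> carrier (profinite_completion G)"
    proof (rule completion_memI)
      fix N assume N: "N \<in> fin_index_normals G"
      obtain g where g: "g \<in> carrier G" "x N = N #> g" using completion_memD[OF x N] .
      show "\<exists>g\<in>carrier G. y N = N #> g"
        using g N in_mod[OF x N] normal.rcos_inv[OF fin_index_normals_normal[OF N] g(1)]
        by (intro bexI[of _ "inv g"])
           (simp_all add: y_def normal.inv_FactGroup[OF fin_index_normals_normal[OF N]])
    next
      fix N M assume *: "N \<in> fin_index_normals G" "M \<in> fin_index_normals G" "N \<subseteq> M"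
      then show "y N \<subseteq> y M"
        using completion_mono[OF x *] in_mod[OF x]
        by (auto simp: y_def normal.inv_FactGroup[OF fin_index_normals_normal] SET_INV_def)
    qed (simp add: y_def)
    have "y \<otimes>\<^bsub>profinite_completion G\<^esub> x = \<one>\<^bsub>profinite_completion G\<^esub>"
    proof (rule extensionalityI[OF ext])
      show "\<one>\<^bsub>profinite_completion G\<^esub> \<in> extensional (fin_index_normals G)"
        by (simp add: profinite_completion_def)
      fix N assume N: "N \<in> fin_index_normals G"
      have "y N = inv\<^bsub>G Mod N\<^esub> x N" using N by (simp add: y_def)
      then show "(y \<otimes>\<^bsub>profinite_completion G\<^esub> x) N = \<one>\<^bsub>profinite_completion G\<^esub> N"
        unfolding m[OF N] o[OF N] using group.l_inv[OF mod_group[OF N] in_mod[OF x N]] by metis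
    qed
    then show "\<exists>y\<in>carrier (profinite_completion G).
        y \<otimes>\<^bsub>profinite_completion G\<^esub> x = \<one>\<^bsub>profinite_completion G\<^esub>"
      using y by blast
  }
qed

lemma completion_embedding_closed:
  "g \<in> carrier G \<Longrightarrow> completion_embedding G g \<in> carrier (profinite_completion G)"
proof (rule completion_memI)
  assume g: "g \<in> carrier G"
  show "\<exists>h\<in>carrier G. completion_embedding G g N = N #> h" if "N \<in> fin_index_normals G" for N
    using g that by (intro bexI[of _ g]) (simp_all add: completion_embedding_def)
  show "completion_embedding G g N \<subseteq> completion_embedding G g M"
    if "N \<in> fin_index_normals G" "M \<in> fin_index_normals G" "N \<subseteq> M" for N M
    using that unfolding completion_embedding_def r_coset_def by auto
qed (simp add: completion_embedding_def)

lemma completion_embedding_mult: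
  assumes "g \<in> carrier G" "h \<in> carrier G"
  shows "completion_embedding G (g \<otimes> h) =
    completion_embedding G g \<otimes>\<^bsub>profinite_completion G\<^esub> completion_embedding G h"
proof (rule completion_eqI)
  show "completion_embedding G g \<otimes>\<^bsub>profinite_completion G\<^esub> completion_embedding G h
      \<in> carrier (profinite_completion G)"
    using assms group.is_monoid[OF group_completion] by (simp add: Group.monoid.m_closed completion_embedding_closed)
next
  fix N assume N: "N \<in> fin_index_normals G"
  then show "completion_embedding G (g \<otimes> h) N =
      (completion_embedding G g \<otimes>\<^bsub>profinite_completion G\<^esub> completion_embedding G h) N"
    using normal.rcos_sum[OF fin_index_normals_normal[OF N] assms]
    unfolding completion_mult[OF N] by (simp add: completion_embedding_def)
qed (use assms in \<open>simp add: completion_embedding_closed\<close>)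

text \<open>Equal cosets at every level put \<open>g \<otimes> inv h\<close> into all finite index
  normal subgroups, and residual finiteness leaves only the identity.\<close>

lemma completion_embedding_inj:
  assumes rf: "residually_finite_group G" and g: "g \<in> carrier G" and h: "h \<in> carrier G"
    and eq: "completion_embedding G g = completion_embedding G h"
  shows "g = h"
proof -
  have "g \<otimes> inv h \<in> N" if N: "N \<in> fin_index_normals G" for N
  proof -
    have "N #> g = N #> h"
      using fun_cong[OF eq, of N] N by (simp add: completion_embedding_def)
    then have "g \<in> N #> h"
      using r_coset_self[OF fin_index_normals_subgroup[OF N] g] by simp
    then obtain n where "n \<in> N" "g = n \<otimes> h" by (auto simp: r_coset_def)
    then show ?thesis
      using h subgroup.mem_carrier[OF fin_index_normals_subgroup[OF N]] by (simp add: m_assoc)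
  qed
  then have "g \<otimes> inv h = \<one>"
    using rf g h unfolding residually_finite_group_def by (meson inv_closed m_closed)
  then have "g \<otimes> inv h \<otimes> h = \<one> \<otimes> h" by simp
  then show ?thesis using g h by (simp add: m_assoc)
qed

end

section \<open>Completed sets with a group action\<close>

locale fg_group = group G for G (structure) +
  assumes fg: "finitely_generated_group G"
begin

lemma Kcore_normals: "m \<ge> 1 \<Longrightarrow> Kcore G m \<in> fin_index_normals G"
  by (rule Kcore_fin_index_normal[OF fg])

lemma Kcore_subgroup: "m \<ge> 1 \<Longrightarrow> subgroup (Kcore G m) G"
  by (rule fin_index_normals_subgroup[OF Kcore_normals])

lemma Kcore_mem_carrier: "m \<ge> 1 \<Longrightarrow> k \<in> Kcore G m \<Longrightarrow> k \<in> carrier G"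
  using subgroup.mem_carrier[OF Kcore_subgroup] .

end

text \<open>Actions are not required to be extensional, hence the direct axioms rather than
  \<open>group_action\<close>.\<close>

locale gset = fg_group G for G (structure) +
  fixes E :: "'e set" and act :: "'a \<Rightarrow> 'e \<Rightarrow> 'e"
  assumes act_closed: "g \<in> carrier G \<Longrightarrow> s \<in> E \<Longrightarrow> act g s \<in> E"
    and act_one: "s \<in> E \<Longrightarrow> act \<one> s = s"
    and act_mult: "g \<in> carrier G \<Longrightarrow> h \<in> carrier G \<Longrightarrow> s \<in> E \<Longrightarrow> act (g \<otimes> h) s = act g (act h s)"
begin

abbreviation "Ehat \<equiv> topspace (completed_space G E act)"
abbreviation "Ghat \<equiv> profinite_completion G"
abbreviation "hact \<equiv> completed_act G act"

definition point :: "'e \<Rightarrow> nat \<Rightarrow> 'e set" where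
  "point s = (\<lambda>m \<in> {1..}. K_orbit G act m s)"

lemma original_points_eq: "original_points G E act = point ` E"
  by (simp add: original_points_def point_def)

lemma K_orbit_eq: "K_orbit G act m s = {act k s | k. k \<in> Kcore G m}"
  by (simp add: K_orbit_def orbit_def)

lemma K_orbit_self: "m \<ge> 1 \<Longrightarrow> s \<in> E \<Longrightarrow> s \<in> K_orbit G act m s"
  using subgroup.one_closed[OF Kcore_subgroup] act_one unfolding K_orbit_eq by force

lemma K_orbit_subset: "m \<ge> 1 \<Longrightarrow> s \<in> E \<Longrightarrow> K_orbit G act m s \<subseteq> E"
  by (auto simp: K_orbit_eq simp del: One_nat_def intro: act_closed Kcore_mem_carrier)

lemma K_orbit_antimono: "m \<le> n \<Longrightarrow> K_orbit G act n s \<subseteq> K_orbit G act m s"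
  using Kcore_antimono[of m n G] by (auto simp: K_orbit_eq)

text \<open>Normality of the core makes the translate of an orbit by a coset an orbit.\<close>

lemma act_coset_orbit:
  assumes m: "m \<ge> 1" and g: "g \<in> carrier G" and s: "s \<in> E"
  shows "{act h t | h t. h \<in> Kcore G m #> g \<and> t \<in> K_orbit G act m s} = K_orbit G act m (act g s)"
proof (intro equalityI subsetI)
  fix y assume "y \<in> {act h t | h t. h \<in> Kcore G m #> g \<and> t \<in> K_orbit G act m s}"
  then obtain h t where ht: "h \<in> Kcore G m #> g" "t \<in> K_orbit G act m s" "y = act h t" by blast
  obtain k where k: "k \<in> Kcore G m" "h = k \<otimes> g" using ht(1) unfolding r_coset_def by blast
  obtain l where l: "l \<in> Kcore G m" "t = act l s" using ht(2) unfolding K_orbit_eq by blast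
  have kG: "k \<in> carrier G" "l \<in> carrier G" using Kcore_mem_carrier[OF m] k l by auto
  \<comment> \<open>Conjugating \<open>l\<close> by \<open>g\<close> lets it pass to the left of
    \<open>g\<close>; normality keeps it in the core.\<close>
  define c where "c = g \<otimes> l \<otimes> inv g"
  have c: "c \<in> Kcore G m"
    unfolding c_def using normal.inv_op_closed2[OF fin_index_normals_normal[OF Kcore_normals[OF m]] g l(1)] .
  have cG: "c \<in> carrier G" using Kcore_mem_carrier[OF m c] .
  have "y = act (k \<otimes> g \<otimes> l) s"
    using ht(3) k l kG g s by (simp add: act_mult)
  also have "k \<otimes> g \<otimes> l = (k \<otimes> c) \<otimes> g"
    unfolding c_def using kG g by (simp add: m_assoc)
  also have "act \<dots> s = act (k \<otimes> c) (act g s)"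
    using kG cG g s by (simp add: act_mult act_closed)
  finally show "y \<in> K_orbit G act m (act g s)"
    using subgroup.m_closed[OF Kcore_subgroup[OF m] k(1) c] unfolding K_orbit_eq by blast
next
  fix y assume "y \<in> K_orbit G act m (act g s)"
  then obtain k where k: "k \<in> Kcore G m" "y = act k (act g s)" unfolding K_orbit_eq by blast
  have "y = act (k \<otimes> g) s" using k Kcore_mem_carrier[OF m k(1)] g s by (simp add: act_mult)
  moreover have "k \<otimes> g \<in> Kcore G m #> g" using k unfolding r_coset_def by blast
  ultimately show "y \<in> {act h t | h t. h \<in> Kcore G m #> g \<and> t \<in> K_orbit G act m s}"
    using K_orbit_self[OF m s] by blast
qed

lemma K_orbit_eqI:
  assumes m: "m \<ge> 1" and s: "s \<in> E" and t: "t \<in> K_orbit G act m s"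
  shows "K_orbit G act m t = K_orbit G act m s"
proof -
  obtain k where k: "k \<in> Kcore G m" "t = act k s" using t unfolding K_orbit_eq by blast
  have kG: "k \<in> carrier G" using Kcore_mem_carrier[OF m k(1)] .
  have "Kcore G m #> k = Kcore G m #> \<one>"
    using k(1) kG coset_join2[OF kG Kcore_subgroup[OF m]] coset_mult_one subgroup.subset[OF Kcore_subgroup[OF m]]
    by simp
  then have "K_orbit G act m (act k s) = K_orbit G act m (act \<one> s)"
    using act_coset_orbit[OF m kG s] act_coset_orbit[OF m one_closed s] by simp
  then show ?thesis using k act_one s by simp
qed

lemma K_orbits_iff: "B \<in> K_orbits G E act m \<longleftrightarrow> (\<exists>s\<in>E. B = K_orbit G act m s)"
  by (auto simp: K_orbits_def orbits_def K_orbit_def)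

lemma mem_Ehat_iff:
  "y \<in> Ehat \<longleftrightarrow> y \<in> extensional {1..} \<and> (\<forall>m\<ge>1. \<exists>s\<in>E. y m = K_orbit G act m s) \<and>
     (\<forall>m\<ge>1. \<forall>n\<ge>m. y n \<subseteq> y m)"
  by (auto simp: completed_space_def PiE_iff K_orbits_iff)

lemma Ehat_memD:
  assumes "y \<in> Ehat" "m \<ge> 1"
  obtains s where "s \<in> E" "y m = K_orbit G act m s"
  using assms mem_Ehat_iff by blast

lemma Ehat_mono: "y \<in> Ehat \<Longrightarrow> m \<ge> 1 \<Longrightarrow> m \<le> n \<Longrightarrow> y n \<subseteq> y m"
  using mem_Ehat_iff by blast

lemma point_mem: "s \<in> E \<Longrightarrow> point s \<in> Ehat"
  unfolding mem_Ehat_iff using K_orbit_antimono by (auto simp: point_def)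

lemma Ehat_eqI:
  assumes "y \<in> Ehat" "z \<in> Ehat" "\<And>m. m \<ge> 1 \<Longrightarrow> y m = z m"
  shows "y = z"
  using assms by (intro extensionalityI[of y "{1..}" z]) (auto simp: mem_Ehat_iff)

lemma hact_coord:
  "m \<ge> 1 \<Longrightarrow> hact x y m = {act g s | g s. g \<in> x (Kcore G m) \<and> s \<in> y m}"
  by (simp add: completed_act_def)

text \<open>The working formula for the completed action: at each level it reduces to the original
  action on chosen representatives, and the laws below are proved through it.\<close>

lemma hact_orbit:
  assumes "m \<ge> 1" "g \<in> carrier G" "x (Kcore G m) = Kcore G m #> g" "s \<in> E" "y m = K_orbit G act m s"
  shows "hact x y m = K_orbit G act m (act g s)"
  unfolding hact_coord[OF assms(1)] assms(3,5) by (rule act_coset_orbit[OF assms(1,2,4)])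

lemma hact_closed:
  assumes x: "x \<in> carrier Ghat" and y: "y \<in> Ehat"
  shows "hact x y \<in> Ehat"
  unfolding mem_Ehat_iff
proof (intro conjI allI impI)
  show "hact x y \<in> extensional {1..}" by (simp add: completed_act_def)
next
  fix m :: nat assume m: "m \<ge> 1"
  obtain g where "g \<in> carrier G" "x (Kcore G m) = Kcore G m #> g"
    using completion_memD[OF x Kcore_normals[OF m]] .
  moreover obtain s where "s \<in> E" "y m = K_orbit G act m s"
    using Ehat_memD[OF y m] .
  ultimately show "\<exists>s\<in>E. hact x y m = K_orbit G act m s"
    using hact_orbit[of m g x s y] m act_closed by blast
next
  fix m n :: nat assume mn: "m \<ge> 1" "m \<le> n"
  then have "x (Kcore G n) \<subseteq> x (Kcore G m)"
    by (intro completion_mono[OF x] Kcore_normals Kcore_antimono) auto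
  then show "hact x y n \<subseteq> hact x y m"
    using Ehat_mono[OF y mn] mn by (simp add: hact_coord) blast
qed

lemma hact_one:
  assumes y: "y \<in> Ehat"
  shows "hact \<one>\<^bsub>Ghat\<^esub> y = y"
proof (rule Ehat_eqI)
  show "hact \<one>\<^bsub>Ghat\<^esub> y \<in> Ehat"
    using hact_closed[OF _ y] group.is_monoid[OF group_completion] by (simp add: Group.monoid.one_closed)
  fix m :: nat assume m: "m \<ge> 1"
  obtain s where s: "s \<in> E" "y m = K_orbit G act m s" using Ehat_memD[OF y m] .
  have "\<one>\<^bsub>Ghat\<^esub> (Kcore G m) = Kcore G m #> \<one>"
    unfolding completion_one[OF Kcore_normals[OF m]]
    using coset_mult_one[OF subgroup.subset[OF Kcore_subgroup[OF m]]] by simp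
  then show "hact \<one>\<^bsub>Ghat\<^esub> y m = y m"
    using hact_orbit[where x = "\<one>\<^bsub>Ghat\<^esub>" and y = y, OF m one_closed _ s] act_one s by simp
qed (rule y)

lemma hact_mult:
  assumes x: "x \<in> carrier Ghat" and z: "z \<in> carrier Ghat" and y: "y \<in> Ehat"
  shows "hact (x \<otimes>\<^bsub>Ghat\<^esub> z) y = hact x (hact z y)"
proof (rule Ehat_eqI)
  show "hact (x \<otimes>\<^bsub>Ghat\<^esub> z) y \<in> Ehat"
    using hact_closed[OF _ y] group.is_monoid[OF group_completion] x z by (simp add: Group.monoid.m_closed)
  show "hact x (hact z y) \<in> Ehat" by (intro hact_closed assms)
  fix m :: nat assume m: "m \<ge> 1"
  let ?K = "Kcore G m"
  obtain s where s: "s \<in> E" "y m = K_orbit G act m s" using Ehat_memD[OF y m] .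
  obtain g where g: "g \<in> carrier G" "x ?K = ?K #> g" using completion_memD[OF x Kcore_normals[OF m]] .
  obtain h where h: "h \<in> carrier G" "z ?K = ?K #> h" using completion_memD[OF z Kcore_normals[OF m]] .
  have "(x \<otimes>\<^bsub>Ghat\<^esub> z) ?K = ?K #> (g \<otimes> h)"
    using normal.rcos_sum[OF fin_index_normals_normal[OF Kcore_normals[OF m]] g(1) h(1)] g h
    unfolding completion_mult[OF Kcore_normals[OF m]] by simp
  then have "hact (x \<otimes>\<^bsub>Ghat\<^esub> z) y m = K_orbit G act m (act (g \<otimes> h) s)"
    using hact_orbit[where y = y and x = "x \<otimes>\<^bsub>Ghat\<^esub> z", OF m m_closed[OF g(1) h(1)] _ s] by simp
  moreover have "hact z y m = K_orbit G act m (act h s)"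
    by (rule hact_orbit[of m h z s y, OF m h s])
  then have "hact x (hact z y) m = K_orbit G act m (act g (act h s))"
    by (rule hact_orbit[of m g x "act h s" "hact z y", OF m g act_closed[OF h(1) s(1)]])
  ultimately show "hact (x \<otimes>\<^bsub>Ghat\<^esub> z) y m = hact x (hact z y) m"
    using act_mult g h s by simp
qed

lemma hact_embedding_point:
  assumes g: "g \<in> carrier G" and s: "s \<in> E"
  shows "hact (completion_embedding G g) (point s) = point (act g s)"
proof (rule Ehat_eqI)
  show "hact (completion_embedding G g) (point s) \<in> Ehat"
    by (intro hact_closed completion_embedding_closed point_mem assms)
  show "point (act g s) \<in> Ehat" by (intro point_mem act_closed assms)
  fix m :: nat assume m: "m \<ge> 1"
  have "hact (completion_embedding G g) (point s) m = K_orbit G act m (act g s)"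
    by (rule hact_orbit[OF m g _ s, of "completion_embedding G g" "point s"])
       (use m in \<open>simp_all add: completion_embedding_def Kcore_normals point_def\<close>)
  then show "hact (completion_embedding G g) (point s) m = point (act g s) m"
    using m by (simp add: point_def)
qed

text \<open>Each coordinate of the result depends only on the same coordinate of the argument,
  through a map between discrete spaces.\<close>

lemma hact_continuous:
  assumes x: "x \<in> carrier Ghat"
  shows "continuous_map (completed_space G E act) (completed_space G E act) (hact x)"
proof -
  let ?P = "product_topology (\<lambda>m. discrete_topology (K_orbits G E act m)) {1..}"
  let ?C = "completed_space G E act"
  have into: "hact x y \<in> Ehat" if "y \<in> Ehat" for y using hact_closed[OF x that] .
  have sub: "?C = subtopology ?P {y. \<forall>m\<ge>1. \<forall>n\<ge>m. y n \<subseteq> y m}" by (simp add: completed_space_def)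
  have coord: "continuous_map ?C (discrete_topology (K_orbits G E act m)) (\<lambda>y. hact x y m)"
    if m: "m \<in> {1..}" for m
  proof -
    have "continuous_map ?P (discrete_topology (K_orbits G E act m)) (\<lambda>y. y m)"
      by (rule continuous_map_product_projection[OF m])
    then have 1: "continuous_map ?C (discrete_topology (K_orbits G E act m)) (\<lambda>y. y m)"
      unfolding sub by (rule continuous_map_from_subtopology)
    define f where "f B = {act g s | g s. g \<in> x (Kcore G m) \<and> s \<in> B}" for B
    have "f B \<in> K_orbits G E act m" if B: "B \<in> K_orbits G E act m" for B
    proof -
      obtain s where s: "s \<in> E" "B = K_orbit G act m s"
        using B by (auto simp: K_orbits_iff)
      obtain g where g: "g \<in> carrier G" "x (Kcore G m) = Kcore G m #> g"
        using completion_memD[OF x Kcore_normals] m by auto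
      have "f B = K_orbit G act m (act g s)"
        unfolding f_def s g using act_coset_orbit[of m g s] m g s by simp
      then show ?thesis
        using act_closed[OF g(1) s(1)] by (auto simp: K_orbits_iff)
    qed
    then have "continuous_map (discrete_topology (K_orbits G E act m)) (discrete_topology (K_orbits G E act m)) f"
      by auto
    then have "continuous_map ?C (discrete_topology (K_orbits G E act m)) (f \<circ> (\<lambda>y. y m))"
      using 1 continuous_map_compose by blast
    moreover have "f \<circ> (\<lambda>y. y m) = (\<lambda>y. hact x y m)"
      using m by (auto simp: f_def hact_coord fun_eq_iff)
    ultimately show ?thesis by simp
  qed
  have "continuous_map ?C ?P (hact x)"
    unfolding continuous_map_componentwise
    using coord by (auto simp: completed_act_def)
  moreover have "hact x ` Ehat \<subseteq> {y. \<forall>m\<ge>1. \<forall>n\<ge>m. y n \<subseteq> y m}"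
    using into Ehat_mono by blast
  ultimately have "continuous_map ?C (subtopology ?P {y. \<forall>m\<ge>1. \<forall>n\<ge>m. y n \<subseteq> y m}) (hact x)"
    by (auto simp: continuous_map_in_subtopology)
  then show ?thesis by (simp only: sub)
qed

lemma hact_homeomorphic:
  assumes x: "x \<in> carrier Ghat"
  shows "homeomorphic_map (completed_space G E act) (completed_space G E act) (hact x)"
proof -
  interpret Gh: group Ghat by (rule group_completion)
  have "hact (inv\<^bsub>Ghat\<^esub> x) (hact x y) = y" "hact x (hact (inv\<^bsub>Ghat\<^esub> x) y) = y" if "y \<in> Ehat" for y
    using x that by (simp_all add: hact_one flip: hact_mult)
  then have "homeomorphic_maps (completed_space G E act) (completed_space G E act)
      (hact x) (hact (inv\<^bsub>Ghat\<^esub> x))"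
    unfolding homeomorphic_maps_def using x hact_continuous by simp
  then show ?thesis using homeomorphic_maps_map by blast
qed

end

section \<open>Free actions and torsors under the completion\<close>

locale free_gset = gset +
  assumes free: "g \<in> carrier G \<Longrightarrow> s \<in> E \<Longrightarrow> act g s = s \<Longrightarrow> g = \<one>"
begin

lemma act_eq_imp_eq:
  assumes "g \<in> carrier G" "h \<in> carrier G" "s \<in> E" "act g s = act h s"
  shows "g = h"
proof -
  have "act (inv h \<otimes> g) s = act (inv h) (act h s)" using assms by (simp add: act_mult)
  also have "\<dots> = s" using assms by (simp add: act_one flip: act_mult)
  finally have "inv h \<otimes> g = \<one>" using free assms by simp
  then have "h \<otimes> (inv h \<otimes> g) = h \<otimes> \<one>" by simp
  then show ?thesis using assms by (simp flip: m_assoc)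
qed

text \<open>Freeness lets the acting element be read off from the moved point, so nested orbits
  translate into nested cosets.\<close>

lemma orbit_mem_coset:
  assumes m: "m \<ge> 1" and g: "g \<in> carrier G" and h: "h \<in> carrier G" and s: "s \<in> E"
    and "act g s \<in> K_orbit G act m (act h s)"
  shows "g \<in> Kcore G m #> h"
proof -
  obtain k where k: "k \<in> Kcore G m" "act g s = act k (act h s)"
    using assms(5) unfolding K_orbit_eq by blast
  then have "g = k \<otimes> h"
    using Kcore_mem_carrier[OF m k(1)] g h s by (intro act_eq_imp_eq[of g "k \<otimes> h" s]) (simp_all add: act_mult)
  then show ?thesis using k(1) unfolding r_coset_def by blast
qed

text \<open>The level-1 coordinate already shows that \<open>t\<close> lies in the orbit of
  \<open>s\<close> under \<open>G\<close>, giving one candidate \<open>g\<close>. Freeness then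
  forces every coset of \<open>x\<close> along the cores to contain this same
  \<open>g\<close>.\<close>

lemma point_to_point:
  assumes x: "x \<in> carrier Ghat" and s: "s \<in> E" and t: "t \<in> E" and eq: "hact x (point s) = point t"
  shows "\<exists>g \<in> carrier G. x = completion_embedding G g"
proof -
  have coord: "\<exists>a \<in> carrier G. x (Kcore G m) = Kcore G m #> a \<and> t \<in> K_orbit G act m (act a s)"
    if m: "m \<ge> 1" for m
  proof -
    obtain a where a: "a \<in> carrier G" "x (Kcore G m) = Kcore G m #> a"
      using completion_memD[OF x Kcore_normals[OF m]] .
    have "hact x (point s) m = K_orbit G act m (act a s)"
      using m by (intro hact_orbit[of m a x s "point s"] a s) (simp_all add: point_def)
    then have "K_orbit G act m t = K_orbit G act m (act a s)"
      using eq m by (simp add: point_def)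
    then show ?thesis using a K_orbit_self[OF m t] by auto
  qed
  obtain a k where "a \<in> carrier G" "k \<in> Kcore G 1" "t = act k (act a s)"
    using coord[of 1] unfolding K_orbit_eq by auto
  then obtain g where g: "g \<in> carrier G" "t = act g s"
    using Kcore_mem_carrier[of 1 k] s by (metis act_mult le_refl m_closed)
  have "x = completion_embedding G g"
  proof (rule completion_eqI[OF x completion_embedding_closed[OF g(1)]])
    fix N assume N: "N \<in> fin_index_normals G"
    \<comment> \<open>The coordinates at the cores determine the one at \<open>N\<close>, by
      cofinality and compatibility.\<close>
    obtain m where m: "m \<ge> 1" "Kcore G m \<subseteq> N" using Kcore_subset_fin_index[OF N] .
    obtain a where a: "a \<in> carrier G" "x (Kcore G m) = Kcore G m #> a" "t \<in> K_orbit G act m (act a s)"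
      using coord[OF m(1)] by blast
    have "g \<in> x (Kcore G m)"
      using orbit_mem_coset[OF m(1) g(1) a(1) s] a(2,3) g(2) by simp
    then have gx: "g \<in> x N"
      using completion_mono[OF x Kcore_normals[OF m(1)] N m(2)] by blast
    obtain b where b: "b \<in> carrier G" "x N = N #> b" using completion_memD[OF x N] .
    have "N #> g = N #> b"
      using r_coset_eqI[OF fin_index_normals_subgroup[OF N] b(1)] gx b(2) by simp
    then show "x N = completion_embedding G g N"
      using b N by (simp add: completion_embedding_def)
  qed
  then show ?thesis using g(1) by blast
qed

text \<open>All coordinates of \<open>y\<close> lie in one orbit of \<open>G\<close>, that of the
  representative \<open>s\<close> at level 1, so each has the form of the orbit of
  \<open>g m\<close> applied to \<open>s\<close>. By freeness the cosets of the \<open>g m\<close>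
  are compatible and assemble to an element of the completion.\<close>

lemma Ehat_is_translate:
  assumes y: "y \<in> Ehat"
  shows "\<exists>x \<in> carrier Ghat. \<exists>s \<in> E. y = hact x (point s)"
proof -
  obtain s where s: "s \<in> E" "y 1 = K_orbit G act 1 s" using Ehat_memD[OF y] by blast
  have "\<exists>g \<in> carrier G. y m = K_orbit G act m (act g s)" if m: "m \<ge> 1" for m
  proof -
    obtain t where t: "t \<in> E" "y m = K_orbit G act m t" using Ehat_memD[OF y m] .
    have "t \<in> y 1" using Ehat_mono[OF y _ m] K_orbit_self[OF m t(1)] t(2) by auto
    then obtain k where "k \<in> Kcore G 1" "t = act k s" unfolding s(2) K_orbit_eq by blast
    then show ?thesis using t Kcore_mem_carrier[of 1 k] by auto
  qed
  then obtain g where g: "\<And>m. m \<ge> 1 \<Longrightarrow> g m \<in> carrier G"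
      "\<And>m. m \<ge> 1 \<Longrightarrow> y m = K_orbit G act m (act (g m) s)"
    by metis
  have coset: "g n \<in> Kcore G m #> g m" if mn: "m \<ge> 1" "m \<le> n" for m n
  proof -
    have "act (g n) s \<in> y n"
      using K_orbit_self act_closed g s mn by auto
    then have "act (g n) s \<in> K_orbit G act m (act (g m) s)"
      using Ehat_mono[OF y mn] g(2)[OF mn(1)] by blast
    then show ?thesis using orbit_mem_coset g s mn by auto
  qed
  \<comment> \<open>The sequence of elements \<open>g m\<close> lives on the cores only;
    \<open>ix N\<close> is a level deep enough to give the coordinate at an arbitrary
    \<open>N\<close>. Any deeper level gives the same coset, so coordinates are compared at a common
    level.\<close>
  define ix where "ix N = (SOME m. m \<ge> 1 \<and> Kcore G m \<subseteq> N)" for N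
  have ix: "ix N \<ge> 1" "Kcore G (ix N) \<subseteq> N" if "N \<in> fin_index_normals G" for N
    using someI_ex[of "\<lambda>m. m \<ge> 1 \<and> Kcore G m \<subseteq> N"] Kcore_subset_fin_index[OF that]
    unfolding ix_def by blast+
  have eqN: "N #> g n = N #> g (ix N)" if N: "N \<in> fin_index_normals G" and n: "n \<ge> ix N" for N n
  proof (rule r_coset_eqI[OF fin_index_normals_subgroup[OF N] g(1)[OF ix(1)[OF N]]])
    show "g n \<in> N #> g (ix N)"
      using coset[OF ix(1)[OF N] n] ix(2)[OF N] unfolding r_coset_def by blast
  qed
  define x where "x = (\<lambda>N \<in> fin_index_normals G. N #> g (ix N))"
  have x: "x \<in> carrier Ghat"
  proof (rule completion_memI)
    show "\<exists>h\<in>carrier G. x N = N #> h" if "N \<in> fin_index_normals G" for N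
      using that g(1) ix(1) by (auto simp: x_def)
    show "x N \<subseteq> x M" if NM: "N \<in> fin_index_normals G" "M \<in> fin_index_normals G" "N \<subseteq> M" for N M
    proof -
      let ?n = "max (ix N) (ix M)"
      have "x N = N #> g ?n" "x M = M #> g ?n"
        using NM eqN[of N ?n] eqN[of M ?n] by (simp_all add: x_def)
      then show ?thesis using NM(3) unfolding r_coset_def by auto
    qed
  qed (simp add: x_def)
  have "y = hact x (point s)"
  proof (rule Ehat_eqI[OF y])
    show "hact x (point s) \<in> Ehat" by (intro hact_closed x point_mem s)
    fix m :: nat assume m: "m \<ge> 1"
    let ?K = "Kcore G m"
    let ?n = "max m (ix ?K)"
    have "x ?K = ?K #> g ?n"
      using eqN[OF Kcore_normals[OF m], of ?n] Kcore_normals[OF m] by (simp add: x_def)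
    also have "\<dots> = ?K #> g m"
      by (rule r_coset_eqI[OF Kcore_subgroup[OF m] g(1)[OF m]]) (rule coset, use m in auto)
    finally have "hact x (point s) m = K_orbit G act m (act (g m) s)"
      using m by (intro hact_orbit[of m "g m" x s "point s", OF m g(1)[OF m] _ s(1)]) (simp_all add: point_def)
    then show "y m = hact x (point s) m" using g(2)[OF m] by simp
  qed
  then show ?thesis using x s(1) by blast
qed

end

section \<open>Equivariant maps and their completions\<close>

locale gset_map = A: gset G E act + B: gset G F act' for G (structure) and E :: "'e set" and act
    and F :: "'f set" and act' +
  fixes f :: "'e \<Rightarrow> 'f"
  assumes map_closed: "s \<in> E \<Longrightarrow> f s \<in> F"
    and equivariant: "g \<in> carrier G \<Longrightarrow> s \<in> E \<Longrightarrow> f (act g s) = act' g (f s)"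
begin

lemma image_K_orbit:
  assumes "m \<ge> 1" "s \<in> E"
  shows "f ` K_orbit G act m s = K_orbit G act' m (f s)"
proof -
  have "f ` {act k s | k. k \<in> Kcore G m} = {f (act k s) | k. k \<in> Kcore G m}" by blast
  also have "\<dots> = {act' k (f s) | k. k \<in> Kcore G m}"
    using equivariant[OF A.Kcore_mem_carrier[OF assms(1)] assms(2)] by (metis (no_types, lifting))
  finally show ?thesis by (simp only: A.K_orbit_eq B.K_orbit_eq)
qed

lemma completed_map_closed:
  assumes y: "y \<in> A.Ehat"
  shows "completed_map f y \<in> B.Ehat"
  unfolding B.mem_Ehat_iff
proof (intro conjI allI impI)
  show "completed_map f y \<in> extensional {1..}" by (simp add: completed_map_def)
next
  fix m :: nat assume m: "m \<ge> 1"
  obtain s where "s \<in> E" "y m = K_orbit G act m s" using A.Ehat_memD[OF y m] .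
  then show "\<exists>t\<in>F. completed_map f y m = K_orbit G act' m t"
    using image_K_orbit[OF m] map_closed m by (auto simp: completed_map_def)
next
  fix m n :: nat assume "m \<ge> 1" "m \<le> n"
  then show "completed_map f y n \<subseteq> completed_map f y m"
    using A.Ehat_mono[OF y, of m n] by (simp add: completed_map_def image_mono)
qed

lemma completed_map_point: "s \<in> E \<Longrightarrow> completed_map f (A.point s) = B.point (f s)"
  using image_K_orbit by (auto simp: completed_map_def A.point_def B.point_def fun_eq_iff)

lemma completed_map_hact:
  assumes x: "x \<in> carrier A.Ghat" and y: "y \<in> A.Ehat"
  shows "completed_map f (A.hact x y) = B.hact x (completed_map f y)"
proof (rule B.Ehat_eqI)
  show "completed_map f (A.hact x y) \<in> B.Ehat"
    by (intro completed_map_closed A.hact_closed assms)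
  show "B.hact x (completed_map f y) \<in> B.Ehat"
    by (intro completed_map_closed B.hact_closed assms)
  fix m :: nat assume m: "m \<ge> 1"
  obtain s where s: "s \<in> E" "y m = K_orbit G act m s" using A.Ehat_memD[OF y m] .
  obtain g where g: "g \<in> carrier G" "x (Kcore G m) = Kcore G m #> g"
    using A.completion_memD[OF x A.Kcore_normals[OF m]] .
  have "completed_map f (A.hact x y) m = K_orbit G act' m (f (act g s))"
    using A.hact_orbit[of m g x s y] image_K_orbit[OF m A.act_closed[OF g(1) s(1)]] m g s
    by (simp add: completed_map_def)
  moreover have "completed_map f y m = K_orbit G act' m (f s)"
    using image_K_orbit[OF m s(1)] s m by (simp add: completed_map_def)
  then have "B.hact x (completed_map f y) m = K_orbit G act' m (act' g (f s))"
    using B.hact_orbit[of m g x "f s" "completed_map f y"] m g map_closed[OF s(1)] by simp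
  ultimately show "completed_map f (A.hact x y) m = B.hact x (completed_map f y) m"
    using equivariant[OF g(1) s(1)] by simp
qed

text \<open>A compatible family lying over \<open>t\<close> picks at each level one of the finitely many elements of the
  fibre of \<open>t\<close>; one of them is picked infinitely often, and then at every level.\<close>

lemma fibre_over_point:
  assumes y: "y \<in> A.Ehat" and t: "t \<in> F" and yt: "completed_map f y = B.point t"
    and fin: "finite {s \<in> E. f s = t}"
  shows "\<exists>s \<in> E. f s = t \<and> y = A.point s"
proof -
  \<comment> \<open>By equivariance the orbit at level \<open>m\<close> maps onto the orbit of
    \<open>t\<close>, so it contains a point of the fibre, which can replace the
    representative.\<close>
  have "\<exists>s \<in> {s \<in> E. f s = t}. y m = K_orbit G act m s" if m: "m \<ge> 1" for m
  proof -
    obtain s where s: "s \<in> E" "y m = K_orbit G act m s" using A.Ehat_memD[OF y m] .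
    have "f ` K_orbit G act m s = K_orbit G act' m t"
      using fun_cong[OF yt, of m] m s by (simp add: completed_map_def B.point_def)
    then have "t \<in> f ` K_orbit G act m s" using B.K_orbit_self[OF m t] by simp
    then obtain s' where s': "s' \<in> K_orbit G act m s" "f s' = t" by blast
    then have "s' \<in> E" using A.K_orbit_subset[OF m s(1)] by blast
    then show ?thesis using A.K_orbit_eqI[OF m s(1) s'(1)] s' s by auto
  qed
  then obtain c where c: "\<And>m. m \<ge> 1 \<Longrightarrow> c m \<in> {s \<in> E. f s = t}"
      "\<And>m. m \<ge> 1 \<Longrightarrow> y m = K_orbit G act m (c m)" by metis
  have "c ` {1..} \<subseteq> {s \<in> E. f s = t}" using c(1) by auto
  then have "finite (c ` {1..})" using fin by (rule finite_subset)
  then obtain m0 where m0: "m0 \<in> {1..}" "infinite {m \<in> {1..}. c m = c m0}"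
    using pigeonhole_infinite[of "{1::nat..}" c] infinite_Ici by blast
  let ?s = "c m0"
  have s: "?s \<in> E" "f ?s = t" using c(1)[of m0] m0(1) by auto
  have "y = A.point ?s"
  proof (rule A.Ehat_eqI[OF y A.point_mem[OF s(1)]])
    fix m :: nat assume m: "m \<ge> 1"
    obtain n where n: "n > m" "n \<in> {m \<in> {1..}. c m = c m0}"
      using m0(2) unfolding infinite_nat_iff_unbounded by blast
    then have "?s \<in> y n" using c(2)[of n] A.K_orbit_self[OF _ s(1), of n] by simp
    then have "?s \<in> y m" using A.Ehat_mono[OF y m] n(1) by (meson in_mono less_imp_le)
    then have "K_orbit G act m ?s = y m"
      using c(2)[OF m] c(1)[OF m] A.K_orbit_eqI[OF m, of "c m" ?s] by simp
    then show "y m = A.point ?s m" using m by (simp add: A.point_def)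
  qed
  then show ?thesis using s by blast
qed

end

section \<open>Isomorphisms of completed residual complexes\<close>

locale residual_setting = fg_group G + regular_cw X
  for G :: "('g, 'm) monoid_scheme" (structure) and X :: "('a, 'z) cw_complex_scheme" +
  fixes \<phi> :: "'g \<Rightarrow> 'a \<Rightarrow> 'a"
  assumes cellular: "cellular_action G X \<phi>"
begin

lemma action: "group_action G (topspace (cw_top X)) \<phi>"
  using cellular by (simp add: cellular_action_def)

lemma act_homeo: "g \<in> carrier G \<Longrightarrow> homeomorphic_map (cw_top X) (cw_top X) (\<phi> g)"
  using cellular by (simp add: cellular_action_def)

lemma act_cell: "g \<in> carrier G \<Longrightarrow> \<sigma> \<in> cw_cells X k \<Longrightarrow> \<phi> g ` \<sigma> \<in> cw_cells X k"
  using cellular by (simp add: cellular_action_def)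

lemma act_image_one:
  assumes "A \<subseteq> topspace (cw_top X)"
  shows "\<phi> \<one> ` A = A"
proof -
  have "\<phi> \<one> x = x" if "x \<in> A" for x
    using fun_cong[OF group_action.id_eq_one[OF action], of x] that assms by auto
  then show ?thesis by simp
qed

lemma act_image_mult:
  assumes "A \<subseteq> topspace (cw_top X)" "g \<in> carrier G" "h \<in> carrier G"
  shows "\<phi> (g \<otimes> h) ` A = \<phi> g ` \<phi> h ` A"
  unfolding image_image
  by (intro image_cong refl group_action.composition_rule[OF action] assms(2,3) subsetD[OF assms(1)])

lemma act_closure:
  assumes "g \<in> carrier G" "\<sigma> \<in> cw_cells X k"
  shows "cl (\<phi> g ` \<sigma>) = \<phi> g ` cl \<sigma>"
  using homeomorphic_map_closure_of[OF act_homeo[OF assms(1)] cell_subset_topspace[OF assms(2)]] .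

text \<open>The action need not commute with the characteristic maps. The boundary, however, is the
  closure minus the open cell, and a homeomorphism preserves that.\<close>

lemma act_bd:
  assumes g: "g \<in> carrier G" and \<sigma>: "\<sigma> \<in> cw_cells X k"
  shows "bd k (\<phi> g ` \<sigma>) = \<phi> g ` bd k \<sigma>"
proof -
  have bd: "bd k \<rho> = cl \<rho> - \<rho>" if "\<rho> \<in> cw_cells X k" for \<rho>
    using closure_cell[OF that] cell_bd_disjoint[OF that] by blast
  have "inj_on (\<phi> g) (cl \<sigma>)"
    using homeomorphic_imp_injective_map[OF act_homeo[OF g]] closure_of_subset_topspace
    by (rule inj_on_subset)
  then have "\<phi> g ` (cl \<sigma> - \<sigma>) = \<phi> g ` cl \<sigma> - \<phi> g ` \<sigma>"
    by (rule inj_on_image_set_diff) (use cell_subset_closure[OF \<sigma>] in auto)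
  then show ?thesis
    by (simp add: bd[OF \<sigma>] bd[OF act_cell[OF g \<sigma>]] act_closure[OF g \<sigma>])
qed

lemma cells_gset: "gset G (cw_cells X k) (cell_act \<phi>)"
proof
  show "cell_act \<phi> g \<sigma> \<in> cw_cells X k" if "g \<in> carrier G" "\<sigma> \<in> cw_cells X k" for g \<sigma>
    using that by (simp add: cell_act_def act_cell)
  show "cell_act \<phi> \<one> \<sigma> = \<sigma>" if "\<sigma> \<in> cw_cells X k" for \<sigma>
    using act_image_one[OF cell_subset_topspace[OF that]] by (simp add: cell_act_def)
  show "cell_act \<phi> (g \<otimes> h) \<sigma> = cell_act \<phi> g (cell_act \<phi> h \<sigma>)"
    if "g \<in> carrier G" "h \<in> carrier G" "\<sigma> \<in> cw_cells X k" for g h \<sigma>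
    using act_image_mult[OF cell_subset_topspace[OF that(3)] that(1,2)] by (simp add: cell_act_def)
qed

text \<open>The action takes a preimage in the whole closed ball. The moved lower cell is disjoint
  from the moved open upper cell, so this preimage lies in the sphere and has the normal form of a
  face position.\<close>

lemma occ_act_eq:
  assumes g: "g \<in> carrier G" and o: "(\<sigma>, \<tau>, \<iota>) \<in> occurrences X k"
  shows "occ_act X \<phi> k g (\<sigma>, \<tau>, \<iota>) =
    (\<phi> g ` \<sigma>, \<phi> g ` \<tau>, {x \<in> sphere_points k. cw_char X (\<phi> g ` \<sigma>) x \<in> \<phi> g ` \<tau>})"
proof -
  have im: "cw_char X \<sigma> ` \<iota> = \<tau>" using o by (simp add: occurrences_def)
  have \<sigma>: "\<sigma> \<in> cw_cells X k" and \<tau>: "\<tau> \<subseteq> bd k \<sigma>" using o by (auto simp: occurrence_iff)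
  note g\<sigma> = act_cell[OF g \<sigma>]
  have "\<phi> g ` \<tau> \<inter> \<phi> g ` \<sigma> = {}"
    using \<tau> cell_bd_disjoint[OF g\<sigma>] unfolding act_bd[OF g \<sigma>] by blast
  then have "x \<notin> open_ball_points k" if "cw_char X (\<phi> g ` \<sigma>) x \<in> \<phi> g ` \<tau>" for x
    using that char_open_ball[OF g\<sigma>] by blast
  then have "{x \<in> ball_points k. cw_char X (\<phi> g ` \<sigma>) x \<in> \<phi> g ` \<tau>} =
      {x \<in> sphere_points k. cw_char X (\<phi> g ` \<sigma>) x \<in> \<phi> g ` \<tau>}"
    unfolding ball_points_eq by blast
  then show ?thesis by (simp add: occ_act_def im)
qed

lemma occ_act_occurrence:
  assumes g: "g \<in> carrier G" and o: "(\<sigma>, \<tau>, \<iota>) \<in> occurrences X k"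
  shows "occ_act X \<phi> k g (\<sigma>, \<tau>, \<iota>) \<in> occurrences X k"
proof -
  have *: "1 \<le> k" "\<sigma> \<in> cw_cells X k" "\<tau> \<in> cw_cells X (k - 1)" "\<tau> \<subseteq> bd k \<sigma>"
    using o by (simp_all add: occurrence_iff)
  then show ?thesis
    unfolding occ_act_eq[OF assms] occurrence_iff act_bd[OF g *(2)]
    using act_cell[OF g *(2)] act_cell[OF g *(3)] image_mono[OF *(4)] by blast
qed

lemma occurrences_gset: "gset G (occurrences X k) (occ_act X \<phi> k)"
proof
  show "occ_act X \<phi> k g q \<in> occurrences X k" if "g \<in> carrier G" "q \<in> occurrences X k" for g q
    using that occ_act_occurrence by (cases q) auto
  show "occ_act X \<phi> k \<one> q = q" if "q \<in> occurrences X k" for q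
  proof (cases q)
    case (fields \<sigma> \<tau> \<iota>)
    with that have o: "(\<sigma>, \<tau>, \<iota>) \<in> occurrences X k" by simp
    then have *: "\<sigma> \<in> cw_cells X k" "\<tau> \<in> cw_cells X (k - 1)"
        "\<iota> = {x \<in> sphere_points k. cw_char X \<sigma> x \<in> \<tau>}"
      by (simp_all add: occurrence_iff)
    show ?thesis
      unfolding fields occ_act_eq[OF one_closed o]
        act_image_one[OF cell_subset_topspace[OF *(1)]] act_image_one[OF cell_subset_topspace[OF *(2)]]
      using *(3) by simp
  qed
  show "occ_act X \<phi> k (g \<otimes> h) q = occ_act X \<phi> k g (occ_act X \<phi> k h q)"
    if g: "g \<in> carrier G" and h: "h \<in> carrier G" and q: "q \<in> occurrences X k" for g h q
  proof (cases q)
    case (fields \<sigma> \<tau> \<iota>)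
    with q have o: "(\<sigma>, \<tau>, \<iota>) \<in> occurrences X k" by simp
    then have *: "\<sigma> \<in> cw_cells X k" "\<tau> \<in> cw_cells X (k - 1)" by (simp_all add: occurrence_iff)
    have ho: "(\<phi> h ` \<sigma>, \<phi> h ` \<tau>, {x \<in> sphere_points k. cw_char X (\<phi> h ` \<sigma>) x \<in> \<phi> h ` \<tau>}) \<in> occurrences X k"
      using occ_act_occurrence[OF h o] unfolding occ_act_eq[OF h o] .
    show ?thesis
      unfolding fields occ_act_eq[OF h o] occ_act_eq[OF g ho] occ_act_eq[OF m_closed[OF g h] o]
        act_image_mult[OF cell_subset_topspace[OF *(1)] g h]
        act_image_mult[OF cell_subset_topspace[OF *(2)] g h] ..
  qed
qed

lemma upper_gset_map:
  "gset_map G (occurrences X k) (occ_act X \<phi> k) (cw_cells X k) (cell_act \<phi>) occ_upper"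
proof -
  interpret A: gset G "occurrences X k" "occ_act X \<phi> k" by (rule occurrences_gset)
  interpret B: gset G "cw_cells X k" "cell_act \<phi>" by (rule cells_gset)
  show ?thesis
    by unfold_locales (auto simp: occ_upper_def occurrence_iff occ_act_def cell_act_def)
qed

lemma lower_gset_map:
  "gset_map G (occurrences X k) (occ_act X \<phi> k) (cw_cells X (k - 1)) (cell_act \<phi>) occ_lower"
proof -
  interpret A: gset G "occurrences X k" "occ_act X \<phi> k" by (rule occurrences_gset)
  interpret B: gset G "cw_cells X (k - 1)" "cell_act \<phi>" by (rule cells_gset)
  show ?thesis
    by unfold_locales (auto simp: occ_lower_def occurrence_iff occ_act_def cell_act_def)
qed

text \<open>A vertex is a single point, so fixing it as a cell is fixing that point; for cells of
  positive dimension the same conclusion would call for a fixed point theorem.\<close>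

lemma vertices_free_gset:
  assumes free: "free_action G (topspace (cw_top X)) \<phi>"
  shows "free_gset G (cw_cells X 0) (cell_act \<phi>)"
proof -
  interpret gset G "cw_cells X 0" "cell_act \<phi>" by (rule cells_gset)
  show ?thesis
  proof
    fix g \<sigma> assume g: "g \<in> carrier G" and \<sigma>: "\<sigma> \<in> cw_cells X 0" and eq: "cell_act \<phi> g \<sigma> = \<sigma>"
    obtain p where p: "\<sigma> = {p}" "p \<in> topspace (cw_top X)" using vertex_is_point[OF \<sigma>] .
    then have "g \<in> stabilizer G \<phi> p" using eq g by (simp add: stabilizer_def cell_act_def)
    then show "g = \<one>" using free p(2) by (auto simp: free_action_def)
  qed
qed

abbreviation "cell_point \<equiv> gset.point G (cell_act \<phi>)"
abbreviation "occ_point k \<equiv> gset.point G (occ_act X \<phi> k)"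

abbreviation "residual \<equiv> completed_residual_complex G X \<phi>"

lemma residual_simps:
  "rc_cells residual k = completed_space G (cw_cells X k) (cell_act \<phi>)"
  "rc_occs residual k = completed_space G (occurrences X k) (occ_act X \<phi> k)"
  "rc_p residual k = completed_map occ_upper"
  "rc_q residual k = completed_map occ_lower"
  by (simp_all add: completed_residual_complex_def)

abbreviation "cell_points k \<equiv> original_points G (cw_cells X k) (cell_act \<phi>)"
abbreviation "occ_points k \<equiv> original_points G (occurrences X k) (occ_act X \<phi> k)"

lemma cell_points_eq: "cell_points k = cell_point ` cw_cells X k"
  by (rule gset.original_points_eq[OF cells_gset])

lemma occ_points_eq: "occ_points k = occ_point k ` occurrences X k"
  by (rule gset.original_points_eq[OF occurrences_gset])

lemma cell_points_subset: "cell_points k \<subseteq> topspace (rc_cells residual k)"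
  using gset.point_mem[OF cells_gset] unfolding cell_points_eq residual_simps by blast

lemma occ_points_subset: "occ_points k \<subseteq> topspace (rc_occs residual k)"
  using gset.point_mem[OF occurrences_gset] unfolding occ_points_eq residual_simps by blast

lemma rc_p_closed: "y \<in> topspace (rc_occs residual k) \<Longrightarrow> rc_p residual k y \<in> topspace (rc_cells residual k)"
  unfolding residual_simps by (rule gset_map.completed_map_closed[OF upper_gset_map])

lemma rc_q_closed: "y \<in> topspace (rc_occs residual k) \<Longrightarrow> rc_q residual k y \<in> topspace (rc_cells residual (k - 1))"
  unfolding residual_simps by (rule gset_map.completed_map_closed[OF lower_gset_map])

lemma rc_p_occ_point: "q \<in> occurrences X k \<Longrightarrow> rc_p residual k (occ_point k q) = cell_point (occ_upper q)"
  unfolding residual_simps by (rule gset_map.completed_map_point[OF upper_gset_map])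

lemma rc_q_occ_point: "q \<in> occurrences X k \<Longrightarrow> rc_q residual k (occ_point k q) = cell_point (occ_lower q)"
  unfolding residual_simps by (rule gset_map.completed_map_point[OF lower_gset_map])

lemma rc_p_in_cell_points_iff:
  assumes y: "y \<in> topspace (rc_occs residual k)"
  shows "rc_p residual k y \<in> cell_points k \<longleftrightarrow> y \<in> occ_points k"
proof
  assume "rc_p residual k y \<in> cell_points k"
  then obtain \<sigma> where \<sigma>: "\<sigma> \<in> cw_cells X k" "completed_map occ_upper y = cell_point \<sigma>"
    unfolding cell_points_eq residual_simps by blast
  then show "y \<in> occ_points k"
    using gset_map.fibre_over_point[OF upper_gset_map _ \<sigma> finite_occurrences_over_upper[OF \<sigma>(1)]] y
    unfolding residual_simps occ_points_eq by blast
next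
  assume "y \<in> occ_points k"
  then obtain q where q: "q \<in> occurrences X k" "y = occ_point k q" unfolding occ_points_eq by blast
  then show "rc_p residual k y \<in> cell_points k"
    using rc_p_occ_point[OF q(1)] gset_map.map_closed[OF upper_gset_map q(1)]
    unfolding cell_points_eq by simp
qed

lemma rc_q_in_cell_points_iff:
  assumes lf: "locally_finite_cw X" and y: "y \<in> topspace (rc_occs residual k)"
  shows "rc_q residual k y \<in> cell_points (k - 1) \<longleftrightarrow> y \<in> occ_points k"
proof
  assume "rc_q residual k y \<in> cell_points (k - 1)"
  then obtain \<tau> where \<tau>: "\<tau> \<in> cw_cells X (k - 1)" "completed_map occ_lower y = cell_point \<tau>"
    unfolding cell_points_eq residual_simps by blast
  then show "y \<in> occ_points k"
    using gset_map.fibre_over_point[OF lower_gset_map _ \<tau> finite_occurrences_over_lower[OF lf \<tau>(1)]] y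
    unfolding residual_simps occ_points_eq by blast
next
  assume "y \<in> occ_points k"
  then obtain q where q: "q \<in> occurrences X k" "y = occ_point k q" unfolding occ_points_eq by blast
  then show "rc_q residual k y \<in> cell_points (k - 1)"
    using rc_q_occ_point[OF q(1)] gset_map.map_closed[OF lower_gset_map q(1)]
    unfolding cell_points_eq by simp
qed

end

section \<open>Transport of original points by isomorphisms and translations\<close>

lemma residual_complex_isoD:
  assumes "residual_complex_iso D E Fc Fo"
  shows "homeomorphic_map (rc_cells D k) (rc_cells E k) (Fc k)"
    and "1 \<le> k \<Longrightarrow> homeomorphic_map (rc_occs D k) (rc_occs E k) (Fo k)"
    and "1 \<le> k \<Longrightarrow> y \<in> topspace (rc_occs D k) \<Longrightarrow> Fc k (rc_p D k y) = rc_p E k (Fo k y)"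
    and "1 \<le> k \<Longrightarrow> y \<in> topspace (rc_occs D k) \<Longrightarrow> Fc (k - 1) (rc_q D k y) = rc_q E k (Fo k y)"
  using assms unfolding residual_complex_iso_def by blast+

text \<open>Inverses are chosen level by level and inherit compatibility with the structure maps.
  The closure assumptions on \<open>rc_p\<close> and \<open>rc_q\<close> place the points where the
  inverse is cancelled in its domain.\<close>

lemma residual_complex_iso_inverse:
  assumes iso: "residual_complex_iso D E Fc Fo"
    and p: "\<And>k y. y \<in> topspace (rc_occs D k) \<Longrightarrow> rc_p D k y \<in> topspace (rc_cells D k)"
    and q: "\<And>k y. y \<in> topspace (rc_occs D k) \<Longrightarrow> rc_q D k y \<in> topspace (rc_cells D (k - 1))"
  obtains Gc Go where "residual_complex_iso E D Gc Go"
    "\<And>k y. y \<in> topspace (rc_cells D k) \<Longrightarrow> Gc k (Fc k y) = y"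
    "\<And>k z. z \<in> topspace (rc_cells E k) \<Longrightarrow> Fc k (Gc k z) = z"
    "\<And>k z. 1 \<le> k \<Longrightarrow> z \<in> topspace (rc_occs E k) \<Longrightarrow> Fo k (Go k z) = z"
proof -
  note D = residual_complex_isoD[OF iso]
  have "\<forall>k. \<exists>g. homeomorphic_maps (rc_cells D k) (rc_cells E k) (Fc k) g"
    using D(1) unfolding homeomorphic_map_maps by blast
  then obtain Gc where Gc: "\<And>k. homeomorphic_maps (rc_cells D k) (rc_cells E k) (Fc k) (Gc k)"
    by metis
  have "\<forall>k. \<exists>g. 1 \<le> k \<longrightarrow> homeomorphic_maps (rc_occs D k) (rc_occs E k) (Fo k) g"
    using D(2) unfolding homeomorphic_map_maps by blast
  then obtain Go where Go: "\<And>k. 1 \<le> k \<Longrightarrow> homeomorphic_maps (rc_occs D k) (rc_occs E k) (Fo k) (Go k)"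
    by metis
  have c1: "Gc k (Fc k y) = y" if "y \<in> topspace (rc_cells D k)" for k y
    using Gc[of k] that by (simp add: homeomorphic_maps_def)
  have c2: "Fc k (Gc k z) = z" if "z \<in> topspace (rc_cells E k)" for k z
    using Gc[of k] that by (simp add: homeomorphic_maps_def)
  have o2: "Fo k (Go k z) = z" if "1 \<le> k" "z \<in> topspace (rc_occs E k)" for k z
    using Go[OF that(1)] that by (simp add: homeomorphic_maps_def)
  have o3: "Go k z \<in> topspace (rc_occs D k)" if "1 \<le> k" "z \<in> topspace (rc_occs E k)" for k z
    using Go[OF that(1)] that(2) by (auto simp: homeomorphic_maps_def continuous_map_def)
  have "residual_complex_iso E D Gc Go"
    unfolding residual_complex_iso_def
  proof (intro allI impI conjI ballI)
    show "homeomorphic_map (rc_cells E k) (rc_cells D k) (Gc k)" for k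
      using Gc homeomorphic_maps_map by blast
    fix k :: nat assume k: "1 \<le> k"
    show "homeomorphic_map (rc_occs E k) (rc_occs D k) (Go k)"
      using Go[OF k] homeomorphic_maps_map by blast
    fix z assume z: "z \<in> topspace (rc_occs E k)"
    show "Gc k (rc_p E k z) = rc_p D k (Go k z)"
      using D(3)[OF k o3[OF k z]] c1[OF p[OF o3[OF k z]]] o2[OF k z] by simp
    show "Gc (k - 1) (rc_q E k z) = rc_q D k (Go k z)"
      using D(4)[OF k o3[OF k z]] c1[OF q[OF o3[OF k z]]] o2[OF k z] by simp
  qed
  then show thesis using c1 c2 o2 by (rule that)
qed

text \<open>Occurrences lying over original cells are original, so the original cells form a connected
  component of the completed incidence graph, which an isomorphism must respect.\<close>

lemma residual_iso_maps_original_points: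
  assumes A: "residual_setting G X \<phi>" and B: "residual_setting H Y \<psi>"
    and lfX: "locally_finite_cw X" and conn: "connected_space (cw_top X)" and lfY: "locally_finite_cw Y"
    and iso: "residual_complex_iso (completed_residual_complex G X \<phi>) (completed_residual_complex H Y \<psi>) Fc Fo"
    and v: "v \<in> original_points G (cw_cells X k0) (cell_act \<phi>)"
    and Fv: "Fc k0 v \<in> original_points H (cw_cells Y k0) (cell_act \<psi>)"
  shows "Fc k ` original_points G (cw_cells X k) (cell_act \<phi>) \<subseteq> original_points H (cw_cells Y k) (cell_act \<psi>)"
    and "1 \<le> k \<Longrightarrow> Fo k ` original_points G (occurrences X k) (occ_act X \<phi> k) \<subseteq>
           original_points H (occurrences Y k) (occ_act Y \<psi> k)"
proof -
  interpret A: residual_setting G X \<phi> by (rule A)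
  interpret B: residual_setting H Y \<psi> by (rule B)
  note D = residual_complex_isoD[OF iso]
  have occ: "A.occ_point k q \<in> topspace (rc_occs A.residual k)"
      "Fo k (A.occ_point k q) \<in> topspace (rc_occs B.residual k)"
    if q: "q \<in> occurrences X k" and k: "1 \<le> k" for k q
  proof -
    show *: "A.occ_point k q \<in> topspace (rc_occs A.residual k)"
      using A.occ_points_subset q unfolding A.occ_points_eq by blast
    then show "Fo k (A.occ_point k q) \<in> topspace (rc_occs B.residual k)"
      using homeomorphic_imp_surjective_map[OF D(2)[OF k]] by blast
  qed
  \<comment> \<open>Each end of an edge has an original image exactly when the edge itself does.
    Having an original image is thus constant along occurrences and spreads over the connected
    incidence graph.\<close>
  have step: "Fc k (A.cell_point \<sigma>) \<in> B.cell_points k \<longleftrightarrow> Fo k (A.occ_point k (\<sigma>, \<tau>, \<iota>)) \<in> B.occ_points k"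
      "Fc (k - 1) (A.cell_point \<tau>) \<in> B.cell_points (k - 1) \<longleftrightarrow> Fo k (A.occ_point k (\<sigma>, \<tau>, \<iota>)) \<in> B.occ_points k"
    if o: "(\<sigma>, \<tau>, \<iota>) \<in> occurrences X k" for k \<sigma> \<tau> \<iota>
  proof -
    have k: "1 \<le> k" using o by (simp add: A.occurrence_iff)
    have "Fc k (A.cell_point \<sigma>) = rc_p B.residual k (Fo k (A.occ_point k (\<sigma>, \<tau>, \<iota>)))"
      using D(3)[OF k occ(1)[OF o k]] A.rc_p_occ_point[OF o] by (simp add: occ_upper_def)
    then show "Fc k (A.cell_point \<sigma>) \<in> B.cell_points k \<longleftrightarrow> Fo k (A.occ_point k (\<sigma>, \<tau>, \<iota>)) \<in> B.occ_points k"
      using B.rc_p_in_cell_points_iff[OF occ(2)[OF o k]] by simp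
    have "Fc (k - 1) (A.cell_point \<tau>) = rc_q B.residual k (Fo k (A.occ_point k (\<sigma>, \<tau>, \<iota>)))"
      using D(4)[OF k occ(1)[OF o k]] A.rc_q_occ_point[OF o] by (simp add: occ_lower_def)
    then show "Fc (k - 1) (A.cell_point \<tau>) \<in> B.cell_points (k - 1) \<longleftrightarrow> Fo k (A.occ_point k (\<sigma>, \<tau>, \<iota>)) \<in> B.occ_points k"
      using B.rc_q_in_cell_points_iff[OF lfY occ(2)[OF o k]] by simp
  qed
  obtain \<sigma>0 where \<sigma>0: "\<sigma>0 \<in> cw_cells X k0" "v = A.cell_point \<sigma>0"
    using v unfolding A.cell_points_eq by blast
  have cells: "Fc k (A.cell_point \<sigma>) \<in> B.cell_points k" if "\<sigma> \<in> cw_cells X k" for k \<sigma>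
  proof (rule A.connected_occurrence_graph[where P = "\<lambda>k \<sigma>. Fc k (A.cell_point \<sigma>) \<in> B.cell_points k",
        OF lfX conn _ \<sigma>0(1) _ that])
    show "Fc k0 (A.cell_point \<sigma>0) \<in> B.cell_points k0" using Fv \<sigma>0 by simp
    fix k \<sigma> \<tau> \<iota> assume o: "(\<sigma>, \<tau>, \<iota>) \<in> occurrences X k"
    show "(Fc k (A.cell_point \<sigma>) \<in> B.cell_points k) = (Fc (k - 1) (A.cell_point \<tau>) \<in> B.cell_points (k - 1))"
      using step[OF o] by simp
  qed
  then show "Fc k ` A.cell_points k \<subseteq> B.cell_points k" for k
    unfolding A.cell_points_eq by blast
  show "Fo k ` A.occ_points k \<subseteq> B.occ_points k" if "1 \<le> k" for k
  proof
    fix z assume "z \<in> Fo k ` A.occ_points k"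
    then obtain \<sigma> \<tau> \<iota> where o: "(\<sigma>, \<tau>, \<iota>) \<in> occurrences X k" "z = Fo k (A.occ_point k (\<sigma>, \<tau>, \<iota>))"
      unfolding A.occ_points_eq by auto
    then have "\<sigma> \<in> cw_cells X k" by (simp add: A.occurrence_iff)
    then show "z \<in> B.occ_points k" using step(1)[OF o(1)] cells o(2) by simp
  qed
qed

text \<open>The inclusion just proved is applied to the inverse as well, with \<open>Fc k0 v\<close>
  as its base point.\<close>

lemma residual_iso_onto_original_points:
  assumes A: "residual_setting G X \<phi>" and B: "residual_setting H Y \<psi>"
    and lfX: "locally_finite_cw X" and connX: "connected_space (cw_top X)"
    and lfY: "locally_finite_cw Y" and connY: "connected_space (cw_top Y)"
    and iso: "residual_complex_iso (completed_residual_complex G X \<phi>) (completed_residual_complex H Y \<psi>) Fc Fo"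
    and v: "v \<in> original_points G (cw_cells X k0) (cell_act \<phi>)"
    and Fv: "Fc k0 v \<in> original_points H (cw_cells Y k0) (cell_act \<psi>)"
  shows "Fc k ` original_points G (cw_cells X k) (cell_act \<phi>) = original_points H (cw_cells Y k) (cell_act \<psi>)"
    and "1 \<le> k \<Longrightarrow> Fo k ` original_points G (occurrences X k) (occ_act X \<phi> k) =
           original_points H (occurrences Y k) (occ_act Y \<psi> k)"
proof -
  interpret A: residual_setting G X \<phi> by (rule A)
  interpret B: residual_setting H Y \<psi> by (rule B)
  obtain Gc Go where G: "residual_complex_iso B.residual A.residual Gc Go"
    "\<And>k y. y \<in> topspace (rc_cells A.residual k) \<Longrightarrow> Gc k (Fc k y) = y"
    "\<And>k z. z \<in> topspace (rc_cells B.residual k) \<Longrightarrow> Fc k (Gc k z) = z"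
    "\<And>k z. 1 \<le> k \<Longrightarrow> z \<in> topspace (rc_occs B.residual k) \<Longrightarrow> Fo k (Go k z) = z"
    using residual_complex_iso_inverse[OF iso A.rc_p_closed A.rc_q_closed] by blast
  have "Gc k0 (Fc k0 v) = v" using G(2) A.cell_points_subset v by blast
  then have "Gc k0 (Fc k0 v) \<in> A.cell_points k0" using v by simp
  note into = residual_iso_maps_original_points[OF A B lfX connX lfY iso v Fv]
    and onto = residual_iso_maps_original_points[OF B A lfY connY lfX G(1) Fv this]
  show "Fc k ` A.cell_points k = B.cell_points k" for k
  proof (rule equalityI[OF into(1) subsetI])
    fix z assume z: "z \<in> B.cell_points k"
    then have "Gc k z \<in> A.cell_points k" "Fc k (Gc k z) = z"
      using onto(1) G(3) B.cell_points_subset by blast+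
    then show "z \<in> Fc k ` A.cell_points k" by force
  qed
  show "Fo k ` A.occ_points k = B.occ_points k" if k: "1 \<le> k" for k
  proof (rule equalityI[OF into(2)[OF k] subsetI])
    fix z assume z: "z \<in> B.occ_points k"
    then have "Go k z \<in> A.occ_points k" "Fo k (Go k z) = z"
      using onto(2)[OF k] G(4)[OF k] B.occ_points_subset by blast+
    then show "z \<in> Fo k ` A.occ_points k" by force
  qed
qed

lemma equivariant_residual_isoD:
  assumes "equivariant_residual_iso G X \<phi> H Y \<psi> \<eta> Fc Fo" "x \<in> carrier (profinite_completion G)"
  shows "y \<in> topspace (completed_space G (cw_cells X k) (cell_act \<phi>)) \<Longrightarrow>
      Fc k (completed_act G (cell_act \<phi>) x y) = completed_act H (cell_act \<psi>) (\<eta> x) (Fc k y)"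
    and "1 \<le> k \<Longrightarrow> z \<in> topspace (completed_space G (occurrences X k) (occ_act X \<phi> k)) \<Longrightarrow>
      Fo k (completed_act G (occ_act X \<phi> k) x z) = completed_act H (occ_act Y \<psi> k) (\<eta> x) (Fo k z)"
  using assms unfolding equivariant_residual_iso_def by (auto simp: completed_residual_complex_def)

text \<open>This rests on \<open>v x = (v x v^-1) v\<close>, and it is why translating
  \<open>F\<close> by \<open>v\<close> must be accompanied by an inner twist of
  \<open>\<eta>\<close>.\<close>

lemma (in gset) hact_Inn:
  assumes v: "v \<in> carrier Ghat" and x: "x \<in> carrier Ghat" and y: "y \<in> Ehat"
  shows "hact v (hact x y) = hact (Inn Ghat v x) (hact v y)"
proof -
  interpret Gh: group Ghat by (rule group_completion)
  have "Inn Ghat v x \<otimes>\<^bsub>Ghat\<^esub> v = v \<otimes>\<^bsub>Ghat\<^esub> x"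
    using v x by (simp add: Inn_def Gh.m_assoc)
  then show ?thesis
    using v x y by (simp add: Inn_def flip: hact_mult)
qed

text \<open>Translation by \<open>v\<close> is a homeomorphism on every space and commutes with the
  completed projections, because these come from equivariant maps.\<close>

lemma equivariant_residual_iso_translate:
  assumes A: "residual_setting G X \<phi>" and B: "residual_setting H Y \<psi>"
    and iso: "equivariant_residual_iso G X \<phi> H Y \<psi> \<eta> Fc Fo"
    and \<eta>: "\<eta> \<in> carrier (profinite_completion G) \<rightarrow> carrier (profinite_completion H)"
    and v: "v \<in> carrier (profinite_completion H)"
  shows "equivariant_residual_iso G X \<phi> H Y \<psi> (Inn (profinite_completion H) v \<circ> \<eta>)
    (\<lambda>k. completed_act H (cell_act \<psi>) v \<circ> Fc k) (\<lambda>k. completed_act H (occ_act Y \<psi> k) v \<circ> Fo k)"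
proof -
  interpret A: residual_setting G X \<phi> by (rule A)
  interpret B: residual_setting H Y \<psi> by (rule B)
  have riso: "residual_complex_iso A.residual B.residual Fc Fo"
    using iso by (simp add: equivariant_residual_iso_def)
  note D = residual_complex_isoD[OF riso]
  have Fo: "Fo k y \<in> topspace (rc_occs B.residual k)" if "1 \<le> k" "y \<in> topspace (rc_occs A.residual k)" for k y
    using homeomorphic_imp_surjective_map[OF D(2)[OF that(1)]] that(2) by blast
  have Fc: "Fc k y \<in> topspace (rc_cells B.residual k)" if "y \<in> topspace (rc_cells A.residual k)" for k y
    using homeomorphic_imp_surjective_map[OF D(1)] that by blast
  note E = equivariant_residual_isoD[OF iso]
  show ?thesis
    unfolding equivariant_residual_iso_def residual_complex_iso_def
  proof (intro conjI allI impI ballI)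
    show "homeomorphic_map (rc_cells A.residual k) (rc_cells B.residual k) (completed_act H (cell_act \<psi>) v \<circ> Fc k)" for k
      using homeomorphic_map_compose[OF D(1)] gset.hact_homeomorphic[OF B.cells_gset v]
      unfolding B.residual_simps by blast
    show "homeomorphic_map (rc_occs A.residual k) (rc_occs B.residual k) (completed_act H (occ_act Y \<psi> k) v \<circ> Fo k)"
      if "1 \<le> k" for k
      using homeomorphic_map_compose[OF D(2)[OF that]] gset.hact_homeomorphic[OF B.occurrences_gset v]
      unfolding B.residual_simps by blast
    show "(completed_act H (cell_act \<psi>) v \<circ> Fc k) (rc_p A.residual k y) =
        rc_p B.residual k ((completed_act H (occ_act Y \<psi> k) v \<circ> Fo k) y)"
      if "1 \<le> k" "y \<in> topspace (rc_occs A.residual k)" for k y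
      using D(3)[OF that] gset_map.completed_map_hact[OF B.upper_gset_map v Fo[OF that, unfolded B.residual_simps]]
      unfolding B.residual_simps by simp
    show "(completed_act H (cell_act \<psi>) v \<circ> Fc (k - 1)) (rc_q A.residual k y) =
        rc_q B.residual k ((completed_act H (occ_act Y \<psi> k) v \<circ> Fo k) y)"
      if "1 \<le> k" "y \<in> topspace (rc_occs A.residual k)" for k y
      using D(4)[OF that] gset_map.completed_map_hact[OF B.lower_gset_map v Fo[OF that, unfolded B.residual_simps]]
      unfolding B.residual_simps by simp
    fix x assume x: "x \<in> carrier (profinite_completion G)"
    then have \<eta>x: "\<eta> x \<in> carrier (profinite_completion H)" using \<eta> by blast
    show "(completed_act H (cell_act \<psi>) v \<circ> Fc k) (completed_act G (cell_act \<phi>) x y) =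
        completed_act H (cell_act \<psi>) ((Inn (profinite_completion H) v \<circ> \<eta>) x) ((completed_act H (cell_act \<psi>) v \<circ> Fc k) y)"
      if "y \<in> topspace (rc_cells A.residual k)" for k y
      using E(1)[OF x that[unfolded A.residual_simps]]
        gset.hact_Inn[OF B.cells_gset v \<eta>x Fc[OF that, unfolded B.residual_simps]] by simp
    show "(completed_act H (occ_act Y \<psi> k) v \<circ> Fo k) (completed_act G (occ_act X \<phi> k) x y) =
        completed_act H (occ_act Y \<psi> k) ((Inn (profinite_completion H) v \<circ> \<eta>) x) ((completed_act H (occ_act Y \<psi> k) v \<circ> Fo k) y)"
      if "1 \<le> k" "y \<in> topspace (rc_occs A.residual k)" for k y
      using E(2)[OF x that(1) that(2)[unfolded A.residual_simps]]
        gset.hact_Inn[OF B.occurrences_gset v \<eta>x Fo[OF that, unfolded B.residual_simps]] by simp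
  qed
qed

section \<open>Inner automorphisms, density, and descent to the original groups\<close>

lemma (in group) Inn_closed: "u \<in> carrier G \<Longrightarrow> x \<in> carrier G \<Longrightarrow> Inn G u x \<in> carrier G"
  by (simp add: Inn_def)

lemma (in group) Inn_Inn:
  "u \<in> carrier G \<Longrightarrow> v \<in> carrier G \<Longrightarrow> x \<in> carrier G \<Longrightarrow> Inn G u (Inn G v x) = Inn G (u \<otimes> v) x"
  by (simp add: Inn_def m_assoc inv_mult_group)

lemma (in group) Inn_one: "x \<in> carrier G \<Longrightarrow> Inn G \<one> x = x"
  by (simp add: Inn_def)

lemma (in group) Inn_iso:
  assumes u: "u \<in> carrier G"
  shows "Inn G u \<in> iso G G"
proof (rule isoI)
  have "inv u \<otimes> (u \<otimes> b) = b" if "b \<in> carrier G" for b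
    using u that by (simp flip: m_assoc)
  then show "Inn G u \<in> hom G G"
    using u by (intro homI) (simp_all add: Inn_def m_assoc)
  show "bij_betw (Inn G u) (carrier G) (carrier G)"
    by (rule bij_betw_byWitness[of _ "Inn G (inv u)"])
       (use u in \<open>auto simp: Inn_Inn Inn_one Inn_closed\<close>)
qed

text \<open>A basic neighbourhood constrains finitely many coordinates, and one deep core lies below
  all of them; a representative of \<open>x\<close> there agrees with \<open>x\<close> at each. The
  prescribed coordinate \<open>M\<close> is the one that \<open>completed_hom\<close> reads.\<close>

lemma (in fg_group) completion_embedding_dense:
  assumes U: "openin (profinite_topology G) U" and x: "x \<in> U" and M: "M \<in> fin_index_normals G"
  shows "\<exists>g \<in> carrier G. completion_embedding G g \<in> U \<and> completion_embedding G g M = x M"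
proof -
  let ?P = "product_topology (\<lambda>N. discrete_topology (carrier (G Mod N))) (fin_index_normals G)"
  obtain T where T: "openin ?P T" "U = T \<inter> carrier (profinite_completion G)"
    using U by (auto simp: profinite_topology_def openin_subtopology)
  have xT: "x \<in> T" and xG: "x \<in> carrier (profinite_completion G)" using x T(2) by auto
  obtain W where W: "finite {N \<in> fin_index_normals G. W N \<noteq> carrier (G Mod N)}"
      "x \<in> Pi\<^sub>E (fin_index_normals G) W" "Pi\<^sub>E (fin_index_normals G) W \<subseteq> T"
    using T(1) xT unfolding openin_product_topology_alt by (auto simp: topspace_discrete_topology) 
  \<comment> \<open>Including \<open>M\<close> secures the extra agreement and also makes the
    maximum below range over a nonempty set.\<close>
  define J where "J = insert M {N \<in> fin_index_normals G. W N \<noteq> carrier (G Mod N)}"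
  have "\<forall>N\<in>J. \<exists>m\<ge>1. Kcore G m \<subseteq> N"
    using M Kcore_subset_fin_index unfolding J_def by blast
  then obtain ix where ix: "\<And>N. N \<in> J \<Longrightarrow> ix N \<ge> 1 \<and> Kcore G (ix N) \<subseteq> N" by metis
  define m where "m = Max (ix ` J)"
  have finJ: "finite (ix ` J)" using W(1) by (simp add: J_def)
  have m: "m \<ge> ix N" if "N \<in> J" for N unfolding m_def using that finJ by (intro Max_ge) auto
  have m1: "m \<ge> 1" using m[of M] ix[of M] by (auto simp: J_def)
  obtain g where g: "g \<in> carrier G" "x (Kcore G m) = Kcore G m #> g"
    using completion_memD[OF xG Kcore_normals[OF m1]] .
  have eq: "completion_embedding G g N = x N" if N: "N \<in> J" for N
  proof -
    have Nf: "N \<in> fin_index_normals G" using N M by (auto simp: J_def)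
    have "Kcore G m \<subseteq> N" using Kcore_antimono[OF m[OF N], of G] ix[OF N] by (meson subset_trans)
    then have "x (Kcore G m) \<subseteq> x N" by (rule completion_mono[OF xG Kcore_normals[OF m1] Nf])
    then have "g \<in> x N" using g(2) r_coset_self[OF Kcore_subgroup[OF m1] g(1)] by auto
    moreover obtain b where "b \<in> carrier G" "x N = N #> b" using completion_memD[OF xG Nf] .
    ultimately show ?thesis
      using r_coset_eqI[OF fin_index_normals_subgroup[OF Nf], of b g] Nf by (simp add: completion_embedding_def)
  qed
  note gc = completion_embedding_closed[OF g(1)]
  have "completion_embedding G g \<in> Pi\<^sub>E (fin_index_normals G) W"
  proof (rule PiE_I)
    fix N assume N: "N \<in> fin_index_normals G"
    show "completion_embedding G g N \<in> W N"
    proof (cases "N \<in> J")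
      case True
      then show ?thesis using eq W(2) N by (auto simp: PiE_iff)
    next
      case False
      then have "W N = carrier (G Mod N)" using N by (simp add: J_def)
      then show ?thesis using gc N by (auto simp: profinite_completion_def)
    qed
  qed (simp add: completion_embedding_def)
  then have "completion_embedding G g \<in> U" using W(3) T(2) gc by blast
  then show ?thesis using g(1) eq[of M] by (auto simp: J_def)
qed

lemma topspace_profinite: "topspace (profinite_topology G) = carrier (profinite_completion G)"
  by (auto simp: profinite_topology_def profinite_completion_def)

text \<open>Both parts are what \<open>completed_hom\<close> needs: its coordinate at
  \<open>N\<close> consults a legitimate index on the source side, and on a coset of the preimage
  its formula yields a single coset of \<open>N\<close>.\<close>

lemma preimage_fin_index_normal:
  assumes "group G" "group H" and h: "h \<in> hom G H" and N: "N \<in> fin_index_normals H"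
  shows "{g \<in> carrier G. h g \<in> N} \<in> fin_index_normals G" (is "?M \<in> _")
    and "g \<in> carrier G \<Longrightarrow> N <#>\<^bsub>H\<^esub> h ` ({g \<in> carrier G. h g \<in> N} #>\<^bsub>G\<^esub> g) = N #>\<^bsub>H\<^esub> h g"
proof -
  interpret G: group G by fact
  interpret H: group H by fact
  interpret h: group_hom G H h by unfold_locales (rule h)
  have sN: "subgroup N H" by (rule H.fin_index_normals_subgroup[OF N])
  have NH: "n \<in> carrier H" if "n \<in> N" for n using subgroup.mem_carrier[OF sN that] .
  have nN: "N \<lhd> H" by (rule H.fin_index_normals_normal[OF N])
  have sM: "subgroup ?M G"
    by (rule G.subgroupI)
       (use subgroup.m_closed[OF sN] subgroup.m_inv_closed[OF sN] subgroup.one_closed[OF sN] h.hom_one G.one_closed in \<open>auto simp del: h.hom_one\<close>)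
  have "x \<otimes>\<^bsub>G\<^esub> k \<otimes>\<^bsub>G\<^esub> inv\<^bsub>G\<^esub> x \<in> ?M" if "x \<in> carrier G" "k \<in> ?M" for x k
    using that normal.inv_op_closed2[OF nN h.hom_closed[OF that(1)], of "h k"] by simp
  then have nM: "?M \<lhd> G" using sM by (simp add: G.normal_inv_iff)
  \<comment> \<open>Cosets of the preimage are preimages of cosets, so there are at most as many of
    them as cosets of \<open>N\<close>.\<close>
  have coset: "?M #>\<^bsub>G\<^esub> a = {b \<in> carrier G. h b \<in> N #>\<^bsub>H\<^esub> h a}" if a: "a \<in> carrier G" for a
  proof (intro equalityI subsetI)
    fix b assume "b \<in> ?M #>\<^bsub>G\<^esub> a"
    then obtain k where "k \<in> carrier G" "h k \<in> N" "b = k \<otimes>\<^bsub>G\<^esub> a" by (auto simp: r_coset_def)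
    then show "b \<in> {b \<in> carrier G. h b \<in> N #>\<^bsub>H\<^esub> h a}" using a by (auto simp: r_coset_def)
  next
    fix b assume b: "b \<in> {b \<in> carrier G. h b \<in> N #>\<^bsub>H\<^esub> h a}"
    then obtain n where n: "n \<in> N" "h b = n \<otimes>\<^bsub>H\<^esub> h a" by (auto simp: r_coset_def)
    have bG: "b \<in> carrier G" using b by simp
    have "h (b \<otimes>\<^bsub>G\<^esub> inv\<^bsub>G\<^esub> a) = n" using n a bG NH by (simp add: H.m_assoc)
    then have "b \<otimes>\<^bsub>G\<^esub> inv\<^bsub>G\<^esub> a \<in> ?M" using n a bG by simp
    then have "(b \<otimes>\<^bsub>G\<^esub> inv\<^bsub>G\<^esub> a) \<otimes>\<^bsub>G\<^esub> a \<in> ?M #>\<^bsub>G\<^esub> a" unfolding r_coset_def by blast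
    then show "b \<in> ?M #>\<^bsub>G\<^esub> a" using a bG by (simp add: G.m_assoc)
  qed
  have "rcosets\<^bsub>G\<^esub> ?M \<subseteq> (\<lambda>C. {b \<in> carrier G. h b \<in> C}) ` (rcosets\<^bsub>H\<^esub> N)"
  proof
    fix C assume "C \<in> rcosets\<^bsub>G\<^esub> ?M"
    then obtain a where a: "a \<in> carrier G" "C = ?M #>\<^bsub>G\<^esub> a" by (rule G.rcosets_cases)
    have "N #>\<^bsub>H\<^esub> h a \<in> rcosets\<^bsub>H\<^esub> N"
      using H.rcosetsI[OF subgroup.subset[OF sN]] a by simp
    then show "C \<in> (\<lambda>C. {b \<in> carrier G. h b \<in> C}) ` (rcosets\<^bsub>H\<^esub> N)"
      unfolding a(2) coset[OF a(1)] by (rule imageI)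
  qed
  moreover have "finite (rcosets\<^bsub>H\<^esub> N)" using N by (simp add: fin_index_normals_def)
  ultimately have "finite (rcosets\<^bsub>G\<^esub> ?M)" by (rule finite_surj[rotated])
  then show "?M \<in> fin_index_normals G" using nM by (simp add: fin_index_normals_def)
  show "N <#>\<^bsub>H\<^esub> h ` (?M #>\<^bsub>G\<^esub> g) = N #>\<^bsub>H\<^esub> h g" if g: "g \<in> carrier G"
  proof (intro equalityI subsetI)
    fix y assume "y \<in> N <#>\<^bsub>H\<^esub> h ` (?M #>\<^bsub>G\<^esub> g)"
    then obtain n b where nb: "n \<in> N" "b \<in> ?M #>\<^bsub>G\<^esub> g" "y = n \<otimes>\<^bsub>H\<^esub> h b"
      unfolding set_mult_def by auto
    then obtain n' where n': "n' \<in> N" "h b = n' \<otimes>\<^bsub>H\<^esub> h g"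
      unfolding coset[OF g] by (auto simp: r_coset_def)
    have "y = (n \<otimes>\<^bsub>H\<^esub> n') \<otimes>\<^bsub>H\<^esub> h g" using nb n' NH g by (simp add: H.m_assoc)
    then show "y \<in> N #>\<^bsub>H\<^esub> h g"
      using subgroup.m_closed[OF sN nb(1) n'(1)] unfolding r_coset_def by blast
  next
    fix y assume "y \<in> N #>\<^bsub>H\<^esub> h g"
    then obtain n where n: "n \<in> N" "y = n \<otimes>\<^bsub>H\<^esub> h g" unfolding r_coset_def by blast
    have "h g \<in> h ` (?M #>\<^bsub>G\<^esub> g)" by (rule imageI[OF G.r_coset_self[OF sM g]])
    with n show "y \<in> N <#>\<^bsub>H\<^esub> h ` (?M #>\<^bsub>G\<^esub> g)"
      unfolding set_mult_def by blast
  qed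
qed

lemma completed_hom_coord:
  assumes "group G" "group H" "h \<in> hom G H" "N \<in> fin_index_normals H" "g \<in> carrier G"
    and "x {g \<in> carrier G. h g \<in> N} = completion_embedding G g {g \<in> carrier G. h g \<in> N}"
  shows "completed_hom G H h x N = completion_embedding H (h g) N"
  using preimage_fin_index_normal[OF assms(1-4)] assms(4-6)
  by (simp add: completed_hom_def completion_embedding_def)

text \<open>By density of the group it suffices to compare both sides coordinatewise on it, where the
  inner twist only sees the coordinate at hand.\<close>

lemma twisted_completion_eq_completed_hom:
  assumes G: "fg_group G" and H: "group H" and h: "h \<in> hom G H"
    and \<eta>: "continuous_map (profinite_topology G) (profinite_topology H) \<eta>"
    and v: "v \<in> carrier (profinite_completion H)"
    and eq: "\<And>g. g \<in> carrier G \<Longrightarrow>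
      Inn (profinite_completion H) v (\<eta> (completion_embedding G g)) = completion_embedding H (h g)"
    and x: "x \<in> carrier (profinite_completion G)"
  shows "Inn (profinite_completion H) v (\<eta> x) = completed_hom G H h x"
proof (rule extensionalityI[of _ "fin_index_normals H"])
  interpret G: fg_group G by (rule G)
  interpret H: group H by (rule H)
  interpret Hh: group "profinite_completion H" by (rule H.group_completion)
  show "Inn (profinite_completion H) v (\<eta> x) \<in> extensional (fin_index_normals H)"
    by (simp add: Inn_def profinite_completion_def)
  show "completed_hom G H h x \<in> extensional (fin_index_normals H)"
    by (simp add: completed_hom_def)
  fix N assume N: "N \<in> fin_index_normals H"
  let ?M = "{g \<in> carrier G. h g \<in> N}"
  \<comment> \<open>The coordinate of \<open>\<eta>\<close> at \<open>N\<close> takes values in a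
    discrete space, so it is constant on an open set around \<open>x\<close>, where an element of
    the group can be found.\<close>
  let ?U = "{y \<in> topspace (profinite_topology G). \<eta> y N \<in> {\<eta> x N}}"
  have "continuous_map (profinite_topology H) (discrete_topology (carrier (H Mod N))) (\<lambda>y. y N)"
    unfolding profinite_topology_def
    by (intro continuous_map_from_subtopology continuous_map_product_projection N)
  from continuous_map_compose[OF \<eta> this]
  have cm: "continuous_map (profinite_topology G) (discrete_topology (carrier (H Mod N))) (\<lambda>y. \<eta> y N)"
    by (simp add: comp_def)
  have xt: "x \<in> topspace (profinite_topology G)" using x by (simp add: topspace_profinite)
  then have "\<eta> x N \<in> carrier (H Mod N)" using cm by (auto simp: continuous_map_def)
  then have U: "openin (profinite_topology G) ?U"
    by (intro openin_continuous_map_preimage[OF cm]) simp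
  have "x \<in> ?U" using xt by simp
  then obtain g where g: "g \<in> carrier G" "completion_embedding G g \<in> ?U"
      "completion_embedding G g ?M = x ?M"
    using G.completion_embedding_dense[OF U _ preimage_fin_index_normal(1)[OF G.is_group H h N]] by blast
  have "Inn (profinite_completion H) v (\<eta> x) N =
      Inn (profinite_completion H) v (\<eta> (completion_embedding G g)) N"
    using g(2) by (simp add: Inn_def H.completion_mult[OF N])
  also have "\<dots> = completion_embedding H (h g) N" by (simp add: eq g(1))
  also have "\<dots> = completed_hom G H h x N"
    using completed_hom_coord[OF G.is_group H h N g(1), of x] g(3) by simp
  finally show "Inn (profinite_completion H) v (\<eta> x) N = completed_hom G H h x N" .
qed

text \<open>Injectivity of the embedding of \<open>H\<close> makes the induced map multiplicative
  and surjective; that of the embedding of \<open>G\<close>, together with injectivity of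
  \<open>\<theta>\<close>, makes it injective.\<close>

lemma iso_of_embedded_groups:
  assumes G: "group G" and H: "group H" and rfG: "residually_finite_group G" and rfH: "residually_finite_group H"
    and \<theta>: "\<theta> \<in> iso (profinite_completion G) (profinite_completion H)"
    and into: "\<And>g. g \<in> carrier G \<Longrightarrow> \<exists>g' \<in> carrier H. \<theta> (completion_embedding G g) = completion_embedding H g'"
    and onto: "\<And>g'. g' \<in> carrier H \<Longrightarrow> \<exists>g \<in> carrier G. \<theta> (completion_embedding G g) = completion_embedding H g'"
  obtains h where "h \<in> iso G H"
    "\<And>g. g \<in> carrier G \<Longrightarrow> \<theta> (completion_embedding G g) = completion_embedding H (h g)"
proof -
  interpret G: group G by (rule G)
  interpret H: group H by (rule H)
  obtain h where h: "\<And>g. g \<in> carrier G \<Longrightarrow> h g \<in> carrier H"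
      "\<And>g. g \<in> carrier G \<Longrightarrow> \<theta> (completion_embedding G g) = completion_embedding H (h g)"
    using into by metis
  have \<theta>hom: "\<theta> \<in> hom (profinite_completion G) (profinite_completion H)"
    and \<theta>inj: "inj_on \<theta> (carrier (profinite_completion G))"
    using \<theta> by (auto simp: iso_def bij_betw_def)
  have "h \<in> iso G H"
  proof (rule isoI)
    show "h \<in> hom G H"
    proof (rule homI)
      fix a b assume ab: "a \<in> carrier G" "b \<in> carrier G"
      have "completion_embedding H (h (a \<otimes>\<^bsub>G\<^esub> b)) = \<theta> (completion_embedding G (a \<otimes>\<^bsub>G\<^esub> b))"
        using h(2) ab by simp
      also have "\<dots> = \<theta> (completion_embedding G a) \<otimes>\<^bsub>profinite_completion H\<^esub> \<theta> (completion_embedding G b)"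
        using ab by (simp add: G.completion_embedding_mult G.completion_embedding_closed hom_mult[OF \<theta>hom])
      also have "\<dots> = completion_embedding H (h a \<otimes>\<^bsub>H\<^esub> h b)"
        using ab h by (simp add: H.completion_embedding_mult)
      finally show "h (a \<otimes>\<^bsub>G\<^esub> b) = h a \<otimes>\<^bsub>H\<^esub> h b"
        using ab h(1) by (intro H.completion_embedding_inj[OF rfH]) simp_all
    qed (rule h(1))
    show "bij_betw h (carrier G) (carrier H)"
      unfolding bij_betw_def
    proof
      show "inj_on h (carrier G)"
      proof (rule inj_onI)
        fix a b assume ab: "a \<in> carrier G" "b \<in> carrier G" "h a = h b"
        then have "\<theta> (completion_embedding G a) = \<theta> (completion_embedding G b)" using h(2) by simp
        then have "completion_embedding G a = completion_embedding G b"
          using inj_onD[OF \<theta>inj] ab G.completion_embedding_closed by blast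
        then show "a = b" by (rule G.completion_embedding_inj[OF rfG ab(1,2)])
      qed
      show "h ` carrier G = carrier H"
      proof
        show "carrier H \<subseteq> h ` carrier G"
        proof
          fix g' assume g': "g' \<in> carrier H"
          obtain g where g: "g \<in> carrier G" "\<theta> (completion_embedding G g) = completion_embedding H g'"
            using onto[OF g'] by blast
          then have "h g = g'" using h g' by (intro H.completion_embedding_inj[OF rfH]) simp_all
          then show "g' \<in> h ` carrier G" using g(1) by blast
        qed
      qed (use h(1) in blast)
    qed
  qed
  then show thesis using h(2) by (rule that)
qed

text \<open>Fix a vertex \<open>s\<close> with image \<open>t\<close>. For \<open>g\<close> in
  \<open>G\<close> the original vertex \<open>g s\<close> goes to \<open>\<theta>(g) t\<close>,
  which is again original, so \<open>\<theta>(g)\<close> lies in \<open>H\<close> by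
  \<open>point_to_point\<close>. Surjectivity of \<open>\<theta>\<close> and injectivity of
  \<open>Fc 0\<close> give the converse.\<close>

lemma normalized_iso_restricts:
  assumes A: "residual_setting G X \<phi>" and B: "residual_setting H Y \<psi>"
    and rfG: "residually_finite_group G" and rfH: "residually_finite_group H"
    and freeX: "free_action G (topspace (cw_top X)) \<phi>" and freeY: "free_action H (topspace (cw_top Y)) \<psi>"
    and iso: "equivariant_residual_iso G X \<phi> H Y \<psi> \<theta> Fc Fo"
    and \<theta>: "\<theta> \<in> iso (profinite_completion G) (profinite_completion H)"
    and ne: "cw_cells X 0 \<noteq> {}"
    and orig: "Fc 0 ` original_points G (cw_cells X 0) (cell_act \<phi>) = original_points H (cw_cells Y 0) (cell_act \<psi>)"
  obtains h where "h \<in> iso G H"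
    "\<And>g. g \<in> carrier G \<Longrightarrow> \<theta> (completion_embedding G g) = completion_embedding H (h g)"
proof -
  interpret A: residual_setting G X \<phi> by (rule A)
  interpret B: residual_setting H Y \<psi> by (rule B)
  interpret VA: free_gset G "cw_cells X 0" "cell_act \<phi>" by (rule A.vertices_free_gset[OF freeX])
  interpret VB: free_gset H "cw_cells Y 0" "cell_act \<psi>" by (rule B.vertices_free_gset[OF freeY])
  have \<theta>cl: "\<theta> x \<in> carrier VB.Ghat" if "x \<in> carrier VA.Ghat" for x
    using \<theta> that by (auto simp: iso_def hom_def)
  have \<theta>surj: "\<theta> ` carrier VA.Ghat = carrier VB.Ghat"
    using \<theta> by (auto simp: iso_def bij_betw_def)
  have riso: "residual_complex_iso A.residual B.residual Fc Fo"
    using iso by (simp add: equivariant_residual_iso_def)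
  have Finj: "inj_on (Fc 0) VA.Ehat"
    using homeomorphic_imp_injective_map[OF residual_complex_isoD(1)[OF riso, of 0]]
    by (simp add: A.residual_simps)
  obtain s where s: "s \<in> cw_cells X 0" using ne by blast
  have images: "\<exists>t \<in> cw_cells Y 0. Fc 0 (VA.point r) = VB.point t" if "r \<in> cw_cells X 0" for r
  proof -
    have "Fc 0 (VA.point r) \<in> VB.point ` cw_cells Y 0"
      using orig that unfolding VA.original_points_eq VB.original_points_eq by blast
    then show ?thesis by blast
  qed
  obtain t where t: "t \<in> cw_cells Y 0" "Fc 0 (VA.point s) = VB.point t" using images[OF s] by blast
  have equiv: "Fc 0 (VA.hact x (VA.point s)) = VB.hact (\<theta> x) (VB.point t)" if "x \<in> carrier VA.Ghat" for x
    using equivariant_residual_isoD(1)[OF iso that VA.point_mem[OF s]] t(2) by simp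
  show thesis
  proof (rule iso_of_embedded_groups[OF A.is_group B.is_group rfG rfH \<theta> _ _ that])
    fix g assume g: "g \<in> carrier G"
    let ?x = "completion_embedding G g"
    have x: "?x \<in> carrier VA.Ghat" by (rule A.completion_embedding_closed[OF g])
    obtain t' where t': "t' \<in> cw_cells Y 0" "Fc 0 (VA.point (cell_act \<phi> g s)) = VB.point t'"
      using images[OF VA.act_closed[OF g s]] by blast
    then have "VB.hact (\<theta> ?x) (VB.point t) = VB.point t'"
      using equiv[OF x] VA.hact_embedding_point[OF g s] by simp
    then show "\<exists>g'\<in>carrier H. \<theta> ?x = completion_embedding H g'"
      using VB.point_to_point[OF \<theta>cl[OF x] t(1) t'(1)] by blast
  next
    fix g' assume g': "g' \<in> carrier H"
    obtain x where x: "x \<in> carrier VA.Ghat" "\<theta> x = completion_embedding H g'"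
      using \<theta>surj B.completion_embedding_closed[OF g'] by (metis imageE)
    have "Fc 0 (VA.hact x (VA.point s)) = VB.point (cell_act \<psi> g' t)"
      using equiv[OF x(1)] VB.hact_embedding_point[OF g' t(1)] x(2) by simp
    moreover have "VB.point (cell_act \<psi> g' t) \<in> Fc 0 ` (VA.point ` cw_cells X 0)"
      using orig VB.act_closed[OF g' t(1)] unfolding VA.original_points_eq VB.original_points_eq by blast
    ultimately obtain r where r: "r \<in> cw_cells X 0" "Fc 0 (VA.hact x (VA.point s)) = Fc 0 (VA.point r)"
      by auto
    have "VA.hact x (VA.point s) = VA.point r"
      by (rule inj_onD[OF Finj r(2) VA.hact_closed[OF x(1) VA.point_mem[OF s]] VA.point_mem[OF r(1)]])
    then show "\<exists>g\<in>carrier G. \<theta> (completion_embedding G g) = completion_embedding H g'"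
      using VA.point_to_point[OF x(1) s r(1)] x(2) by metis
  qed
qed

theorem theorem2p3:
  fixes G1 :: "('g, 'm) monoid_scheme" and G2 :: "('h, 'n) monoid_scheme"
    and X1 :: "('a, 'z) cw_complex_scheme" and X2 :: "('b, 'w) cw_complex_scheme"
    and \<phi>1 :: "'g \<Rightarrow> 'a \<Rightarrow> 'a" and \<phi>2 :: "'h \<Rightarrow> 'b \<Rightarrow> 'b"
    and \<eta> :: "('g set \<Rightarrow> 'g set) \<Rightarrow> ('h set \<Rightarrow> 'h set)"
    and Fc :: "nat \<Rightarrow> (nat \<Rightarrow> 'a set set) \<Rightarrow> (nat \<Rightarrow> 'b set set)"
    and Fo :: "nat \<Rightarrow> (nat \<Rightarrow> 'a occurrence set) \<Rightarrow> (nat \<Rightarrow> 'b occurrence set)"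
  assumes "finitely_generated_group G1" and "residually_finite_group G1"
    and "finitely_generated_group G2" and "residually_finite_group G2"
    and "regular_cw_complex X1" and "finite_dimensional_cw X1" and "locally_finite_cw X1"
    and "connected_space (cw_top X1)" and "topspace (cw_top X1) \<noteq> {}"
    and "regular_cw_complex X2" and "finite_dimensional_cw X2" and "locally_finite_cw X2"
    and "connected_space (cw_top X2)" and "topspace (cw_top X2) \<noteq> {}"
    and "cellular_action G1 X1 \<phi>1" and "free_action G1 (topspace (cw_top X1)) \<phi>1"
    and "cocompact_action G1 (cw_top X1) \<phi>1"
    and "cellular_action G2 X2 \<phi>2" and "free_action G2 (topspace (cw_top X2)) \<phi>2"
    and "cocompact_action G2 (cw_top X2) \<phi>2"
    and "continuous_iso G1 G2 \<eta>"
    and "equivariant_residual_iso G1 X1 \<phi>1 G2 X2 \<phi>2 \<eta> Fc Fo"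
  shows "\<exists>u \<in> carrier (profinite_completion G2). \<exists>h \<in> iso G1 G2.
     ((\<forall>x \<in> carrier (profinite_completion G1).
         \<eta> x = Inn (profinite_completion G2) u (completed_hom G1 G2 h x)) \<and>
      (\<forall>k. Fc k ` original_points G1 (cw_cells X1 k) (cell_act \<phi>1) =
         completed_act G2 (cell_act \<phi>2) u ` original_points G2 (cw_cells X2 k) (cell_act \<phi>2)) \<and>
      (\<forall>k\<ge>1. Fo k ` original_points G1 (occurrences X1 k) (occ_act X1 \<phi>1 k) =
         completed_act G2 (occ_act X2 \<phi>2 k) u `
           original_points G2 (occurrences X2 k) (occ_act X2 \<phi>2 k))) \<and>
     (let v = inv\<^bsub>profinite_completion G2\<^esub> u;
          \<eta>' = Inn (profinite_completion G2) v \<circ> \<eta>;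
          Fc' = (\<lambda>k. completed_act G2 (cell_act \<phi>2) v \<circ> Fc k);
          Fo' = (\<lambda>k. completed_act G2 (occ_act X2 \<phi>2 k) v \<circ> Fo k)
      in (\<forall>x \<in> carrier (profinite_completion G1). \<eta>' x = completed_hom G1 G2 h x) \<and>
         equivariant_residual_iso G1 X1 \<phi>1 G2 X2 \<phi>2 \<eta>' Fc' Fo' \<and>
         (\<forall>k. Fc' k ` original_points G1 (cw_cells X1 k) (cell_act \<phi>1) =
            original_points G2 (cw_cells X2 k) (cell_act \<phi>2)) \<and>
         (\<forall>k\<ge>1. Fo' k ` original_points G1 (occurrences X1 k) (occ_act X1 \<phi>1 k) =
            original_points G2 (occurrences X2 k) (occ_act X2 \<phi>2 k)))"
proof -
  let ?P1 = "profinite_completion G1" and ?P2 = "profinite_completion G2"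
  interpret A: residual_setting G1 X1 \<phi>1
    using assms unfolding residual_setting_def residual_setting_axioms_def fg_group_def
      fg_group_axioms_def regular_cw_def finitely_generated_group_def by simp
  interpret B: residual_setting G2 X2 \<phi>2
    using assms unfolding residual_setting_def residual_setting_axioms_def fg_group_def
      fg_group_axioms_def regular_cw_def finitely_generated_group_def by simp
  have A: "residual_setting G1 X1 \<phi>1" and B: "residual_setting G2 X2 \<phi>2"
    by unfold_locales
  interpret P2: group ?P2 by (rule B.group_completion)
  interpret VB: free_gset G2 "cw_cells X2 0" "cell_act \<phi>2"
    by (rule B.vertices_free_gset) fact
  note iso = assms(22)
  have riso: "residual_complex_iso A.residual B.residual Fc Fo"
    using iso by (simp add: equivariant_residual_iso_def)
  have \<eta>iso: "\<eta> \<in> iso ?P1 ?P2" and \<eta>cont: "continuous_map (profinite_topology G1) (profinite_topology G2) \<eta>"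
    using assms(21) by (simp_all add: continuous_iso_def)
  have \<eta>cl: "\<eta> \<in> carrier ?P1 \<rightarrow> carrier ?P2"
    using \<eta>iso by (auto simp: iso_def hom_def)
  have Fc_top: "Fc k y \<in> topspace (rc_cells B.residual k)" if "y \<in> topspace (rc_cells A.residual k)" for k y
    using homeomorphic_imp_surjective_map[OF residual_complex_isoD(1)[OF riso]] that by blast
  have Fo_top: "Fo k y \<in> topspace (rc_occs B.residual k)" if "1 \<le> k" "y \<in> topspace (rc_occs A.residual k)" for k y
    using homeomorphic_imp_surjective_map[OF residual_complex_isoD(2)[OF riso that(1)]] that(2) by blast
  have ne: "cw_cells X1 0 \<noteq> {}" by (rule A.vertex_exists) fact
  then obtain p where p: "p \<in> A.cell_points 0" unfolding A.cell_points_eq by blast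
  have "Fc 0 p \<in> VB.Ehat"
    using Fc_top[OF subsetD[OF A.cell_points_subset p]] unfolding B.residual_simps .
  \<comment> \<open>This is the \<open>u\<close> of the conclusion, read off from the image of one
    vertex. The vertex \<open>w\<close> need not correspond to \<open>p\<close> in any way: it only
    has to be original.\<close>
  then obtain u w where u: "u \<in> carrier ?P2" and w: "w \<in> cw_cells X2 0"
    and Fp: "Fc 0 p = VB.hact u (VB.point w)"
    using VB.Ehat_is_translate by blast
  define v where "v = inv\<^bsub>?P2\<^esub> u"
  have v: "v \<in> carrier ?P2" using u by (simp add: v_def)
  define Fc' where "Fc' = (\<lambda>k. completed_act G2 (cell_act \<phi>2) v \<circ> Fc k)"
  define Fo' where "Fo' = (\<lambda>k. completed_act G2 (occ_act X2 \<phi>2 k) v \<circ> Fo k)"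
  define \<eta>' where "\<eta>' = Inn ?P2 v \<circ> \<eta>"
  have iso': "equivariant_residual_iso G1 X1 \<phi>1 G2 X2 \<phi>2 \<eta>' Fc' Fo'"
    unfolding \<eta>'_def Fc'_def Fo'_def
    by (rule equivariant_residual_iso_translate[OF A B iso \<eta>cl v])
  then have riso': "residual_complex_iso A.residual B.residual Fc' Fo'"
    by (simp add: equivariant_residual_iso_def)
  have "VB.hact v (VB.hact u (VB.point w)) = VB.point w"
    using u v w VB.point_mem by (simp add: v_def VB.hact_one flip: VB.hact_mult)
  then have "Fc' 0 p \<in> B.cell_points 0"
    using w by (simp add: Fc'_def Fp VB.original_points_eq)
  \<comment> \<open>After translation by the inverse of \<open>u\<close> one original vertex has an
    original image, which suffices for the whole complex.\<close>
  note onto = residual_iso_onto_original_points[OF A B assms(7,8,12,13) riso' p this]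
  have \<eta>'iso: "\<eta>' \<in> iso ?P1 ?P2"
    unfolding \<eta>'_def using \<eta>iso P2.Inn_iso[OF v] by (rule iso_set_trans)
  obtain h where h: "h \<in> iso G1 G2"
      "\<And>g. g \<in> carrier G1 \<Longrightarrow> \<eta>' (completion_embedding G1 g) = completion_embedding G2 (h g)"
    using normalized_iso_restricts[OF A B assms(2,4,16,19) iso' \<eta>'iso ne onto(1)] by blast
  have \<eta>'h: "\<eta>' x = completed_hom G1 G2 h x" if x: "x \<in> carrier ?P1" for x
    unfolding \<eta>'_def comp_apply
  proof (rule twisted_completion_eq_completed_hom[OF _ B.is_group _ \<eta>cont v _ x])
    show "fg_group G1" by unfold_locales
    show "h \<in> hom G1 G2" using h(1) by (simp add: iso_def)
  qed (use h(2) in \<open>simp add: \<eta>'_def\<close>)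
  have uv: "u \<otimes>\<^bsub>?P2\<^esub> v = \<one>\<^bsub>?P2\<^esub>" using u by (simp add: v_def)
  have \<eta>h: "\<eta> x = Inn ?P2 u (completed_hom G1 G2 h x)" if x: "x \<in> carrier ?P1" for x
  proof -
    have "\<eta> x \<in> carrier ?P2" using \<eta>cl x by blast
    then have "Inn ?P2 u (\<eta>' x) = \<eta> x"
      using u v by (simp add: \<eta>'_def P2.Inn_Inn uv P2.Inn_one)
    then show ?thesis using \<eta>'h[OF x] by simp
  qed
  \<comment> \<open>The unnormalized form follows by undoing the translation: \<open>u\<close>
    cancels \<open>v\<close> on every image point.\<close>
  have cells: "Fc k ` A.cell_points k = completed_act G2 (cell_act \<phi>2) u ` B.cell_points k" for k
  proof -
    interpret C: gset G2 "cw_cells X2 k" "cell_act \<phi>2" by (rule B.cells_gset)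
    have "C.hact u (C.hact v (Fc k y)) = Fc k y" if "y \<in> A.cell_points k" for y
      using Fc_top[OF subsetD[OF A.cell_points_subset that]] u v
      unfolding B.residual_simps by (simp add: uv C.hact_one flip: C.hact_mult)
    then show ?thesis
      unfolding onto(1)[symmetric] Fc'_def image_image by simp
  qed
  have occs: "Fo k ` A.occ_points k = completed_act G2 (occ_act X2 \<phi>2 k) u ` B.occ_points k"
    if k: "1 \<le> k" for k
  proof -
    interpret C: gset G2 "occurrences X2 k" "occ_act X2 \<phi>2 k" by (rule B.occurrences_gset)
    have "C.hact u (C.hact v (Fo k y)) = Fo k y" if "y \<in> A.occ_points k" for y
      using Fo_top[OF k subsetD[OF A.occ_points_subset that]] u v
      unfolding B.residual_simps by (simp add: uv C.hact_one flip: C.hact_mult)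
    then show ?thesis
      unfolding onto(2)[OF k, symmetric] Fo'_def image_image by simp
  qed
  show ?thesis
    unfolding Let_def
    by (intro bexI[OF _ u] bexI[OF _ h(1)] conjI allI impI ballI \<eta>h cells occs
        \<eta>'h[unfolded \<eta>'_def v_def] iso'[unfolded \<eta>'_def Fc'_def Fo'_def v_def]
        onto(1)[unfolded Fc'_def v_def] onto(2)[unfolded Fo'_def v_def])
qed

end
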